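(* Consider the light-traffic M/G/1 queue described in the context, with tail index $\alpha\in(2,4)$ and $Z_1(t)=\sum_{i=1}^{\lfloor t\rfloor}W_i$. Let $\ell$ be a slowly varying function such that, as $\varepsilon\downarrow0$, $$\varepsilon^{\frac2\alpha}\ell(\varepsilon^{-1})\Big(Z_1\big(\tfrac{\cdot}{\varepsilon}\big)-\tfrac{\cdot}{\varepsilon}\mu_W\Big)\Rightarrow L_{\alpha/2}\Big(\frac{\cdot}{\mathbb E[\tau_1]}\Big)\quad\text{weakly in the }M_1\text{ topology},$$ where $\tau_1=\inf\{k\ge1:W_k=0\}$, $\mu_W=\mathbb E[\sum_{i=1}^{\tau_1}W_i]/\mathbb E[\tau_1]$ and $L_{\alpha/2}$ is a mean-zero, spectrally positive $\frac\alpha2$-stable Lévy process. Fix an integer $m\ge2$ and, for $\iota\in\{\mathrm{sec},\mathrm{bm},\mathrm{rs}\}$, let $Z_2^{*,\iota}$ be the sectioning, batch-means, or random-scaling process built from $Z_1$ as in the context (using $m$ independent queueing systems for sectioning). Then for every $\iota\in\{\mathrm{sec},\mathrm{bm},\mathrm{rs}\}$ and every $0<\nu<\frac{\alpha}{\alpha-2}$, for every $K>0$, $$\lim_{\eta\downarrow0}\limsup_{\varepsilon\downarrow0}\mathbb P\Big(\inf_{n\in\mathbb N:\ \varepsilon^{-\nu}\le n\le\eta a_\varepsilon}\frac{\sqrt{Z_2^{*,\iota}(n)}}{n}\le K\varepsilon\Big)=0,$$ where $A(x)=x^{1-\frac2\alpha}\ell(x)$ and $a_\varepsilon=A^{\leftarrow}(\varepsilon^{-1})$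 with $A^{\leftarrow}$ an asymptotic inverse of $A$.
   Context: Queue. The inter-arrival times $\{A_n\}_{n\ge1}$ are i.i.d. exponential with $\mathbb E[A_n]=\lambda_A^{-1}$; the (nonnegative) service times $\{U_n\}_{n\ge0}$ are i.i.d. with mean $\mu_U$ and regularly varying with index $\alpha\in(2,4)$, i.e. $x\mapsto\mathbb P(U_0>x)$ is regularly varying at infinity with index $-\alpha$; the two sequences are independent; there is a single server; and $\mu_U<\lambda_A^{-1}$ (light traffic). The delay sequence is $W_0=0$, $W_{n+1}=(W_n+U_n-A_{n+1})_+$. Scaling processes (for $t>0$; all defined to be zero at $t=0$). Sectioning: with $Z_1^{(1)},\dots,Z_1^{(m)}$ independent copies of $Z_1$ and $\bar Z_1=\frac1m\sum_{i=1}^mZ_1^{(i)}$, $Z_2^{*,\mathrm{sec}}(t)=\frac1{m-1}\sum_{i=1}^m\frac1t\int_0^t(Z_1^{(i)}(s)-\bar Z_1(s))^2ds$. Batch means: $Z_2^{*,\mathrm{bm}}(t)=\frac1{m-1}\sum_{k=1}^m\frac1t\int_0^t\big(Z_1(\frac kms)-Z_1(\frac{k-1}ms)-\frac1mZ_1(s)\big)^2ds$. Random scaling: $Z_2^{\mathrm{rs}}(u)=\frac1u\int_0^u(Z_1(s)-\frac suZ_1(u))^2ds$ and $Z_2^{*,\mathrm{rs}}(t)=\frac1t\int_0^tZ_2^{\mathrm{rs}}(u)\,du$. Asymptotic inverse: $A^{\leftarrow}$ is a function with $A(A^{\leftarrow}(x))\sim x$ as $x\to\infty$. $M_1$ denotes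 the usual Skorokhod $M_1$ topology on $D([0,\infty),\mathbb R)$ (convergence of restrictions to $[0,T]$ for every continuity point $T$ of the limit). *)

theory Defs
  imports "HOL-Probability.Probability" "HOL-Library.Landau_Symbols"
begin

section \<open>Regular variation\<close>

definition regularly_varying :: "(real \<Rightarrow> real) \<Rightarrow> real \<Rightarrow> bool" where
  "regularly_varying f \<rho> \<longleftrightarrow>
     (\<exists>X. f \<in> borel_measurable (restrict_space borel {X..}) \<and> (\<forall>x\<ge>X. 0 < f x)) \<and>
     (\<forall>c>0. ((\<lambda>x. f (c * x) / f x) \<longlongrightarrow> c powr \<rho>) at_top)"

abbreviation slowly_varying :: "(real \<Rightarrow> real) \<Rightarrow> bool" where
  "slowly_varying f \<equiv> regularly_varying f 0"

definition asymptotic_inverse :: "(real \<Rightarrow> real) \<Rightarrow> (real \<Rightarrow> real) \<Rightarrow> bool" where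
  "asymptotic_inverse A Ainv \<longleftrightarrow> asymp_equiv (\<lambda>x. A (Ainv x)) at_top (\<lambda>x. x)"


section \<open>The light-traffic M/G/1 queue\<close>

text \<open>
  The input of one queue is the family \<open>case_sum A U\<close>: the inter-arrival times \<open>A n\<close> for
  \<open>n \<ge> 1\<close> are indexed by \<open>Inl n\<close>, the service times \<open>U n\<close> for \<open>n \<ge> 0\<close> by \<open>Inr n\<close>. The
  value \<open>A 0\<close> is not used.
\<close>

definition queue_index :: "(nat + nat) set" where
  "queue_index = Inl ` {1..} \<union> range Inr"

definition mg1_queue ::
  "'a measure \<Rightarrow> real \<Rightarrow> real \<Rightarrow> real \<Rightarrow> (nat \<Rightarrow> 'a \<Rightarrow> real) \<Rightarrow> (nat \<Rightarrow> 'a \<Rightarrow> real) \<Rightarrow> bool" where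
  "mg1_queue M lamA muU \<alpha> A U \<longleftrightarrow>
     prob_space M \<and>
     prob_space.indep_vars M (\<lambda>_. borel) (case_sum A U) queue_index \<and>
     0 < lamA \<and> (\<forall>n\<ge>1. distributed M lborel (A n) (exponential_density lamA)) \<and>
     (\<forall>n. distr M borel (U n) = distr M borel (U 0)) \<and>
     (AE \<omega> in M. 0 \<le> U 0 \<omega>) \<and>
     integrable M (U 0) \<and> integral\<^sup>L M (U 0) = muU \<and>
     regularly_varying (\<lambda>x. measure M {\<omega> \<in> space M. x < U 0 \<omega>}) (- \<alpha>) \<and>
     muU < 1 / lamA"

text \<open>
  \<open>m\<close> mutually independent queueing systems, labelled \<open>1, \<dots>, m\<close>, each with the same law as the
  queue with input \<open>A\<close>, \<open>U\<close>. No relation to \<open>A\<close>, \<open>U\<close> other than equality in law is imposed.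
\<close>

definition independent_mg1_copies ::
  "'a measure \<Rightarrow> real \<Rightarrow> real \<Rightarrow> real \<Rightarrow> (nat \<Rightarrow> 'a \<Rightarrow> real) \<Rightarrow>
   nat \<Rightarrow> (nat \<Rightarrow> nat \<Rightarrow> 'a \<Rightarrow> real) \<Rightarrow> (nat \<Rightarrow> nat \<Rightarrow> 'a \<Rightarrow> real) \<Rightarrow> bool" where
  "independent_mg1_copies M lamA muU \<alpha> U m Ac Uc \<longleftrightarrow>
     (\<forall>i\<in>{1..m}. mg1_queue M lamA muU \<alpha> (Ac i) (Uc i) \<and>
        distr M borel (Uc i 0) = distr M borel (U 0)) \<and>
     prob_space.indep_vars M (\<lambda>_. borel) (\<lambda>(i, k). case_sum (Ac i) (Uc i) k) ({1..m} \<times> queue_index)"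

primrec delay :: "(nat \<Rightarrow> 'a \<Rightarrow> real) \<Rightarrow> (nat \<Rightarrow> 'a \<Rightarrow> real) \<Rightarrow> nat \<Rightarrow> 'a \<Rightarrow> real" where
  "delay A U 0 \<omega> = 0"
| "delay A U (Suc n) \<omega> = max 0 (delay A U n \<omega> + U n \<omega> - A (Suc n) \<omega>)"

definition Z1 :: "(nat \<Rightarrow> 'a \<Rightarrow> real) \<Rightarrow> (nat \<Rightarrow> 'a \<Rightarrow> real) \<Rightarrow> 'a \<Rightarrow> real \<Rightarrow> real" where
  "Z1 A U \<omega> t = (\<Sum>i = 1..nat \<lfloor>t\<rfloor>. delay A U i \<omega>)"

text \<open>
  The infimum is over a set that is almost surely nonempty, because of light traffic; on the
  exceptional null set \<open>tau1\<close> is the unspecified natural number \<open>Inf {}\<close>.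
\<close>

definition tau1 :: "(nat \<Rightarrow> 'a \<Rightarrow> real) \<Rightarrow> (nat \<Rightarrow> 'a \<Rightarrow> real) \<Rightarrow> 'a \<Rightarrow> nat" where
  "tau1 A U \<omega> = Inf {k. 1 \<le> k \<and> delay A U k \<omega> = 0}"

definition E_tau1 :: "'a measure \<Rightarrow> (nat \<Rightarrow> 'a \<Rightarrow> real) \<Rightarrow> (nat \<Rightarrow> 'a \<Rightarrow> real) \<Rightarrow> real" where
  "E_tau1 M A U = (\<integral>\<omega>. real (tau1 A U \<omega>) \<partial>M)"

definition mu_W :: "'a measure \<Rightarrow> (nat \<Rightarrow> 'a \<Rightarrow> real) \<Rightarrow> (nat \<Rightarrow> 'a \<Rightarrow> real) \<Rightarrow> real" where
  "mu_W M A U = (\<integral>\<omega>. (\<Sum>i = 1..tau1 A U \<omega>. delay A U i \<omega>) \<partial>M) / E_tau1 M A U"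


section \<open>Scaling processes, as functionals of paths\<close>

definition Z2_sec :: "nat \<Rightarrow> (nat \<Rightarrow> real \<Rightarrow> real) \<Rightarrow> real \<Rightarrow> real" where
  "Z2_sec m zc t = (if t \<le> 0 then 0 else
     1 / (real m - 1) * (\<Sum>i = 1..m.
       1 / t * (LINT s:{0..t}|lborel. (zc i s - 1 / real m * (\<Sum>j = 1..m. zc j s))\<^sup>2)))"

definition Z2_bm :: "nat \<Rightarrow> (real \<Rightarrow> real) \<Rightarrow> real \<Rightarrow> real" where
  "Z2_bm m z t = (if t \<le> 0 then 0 else
     1 / (real m - 1) * (\<Sum>k = 1..m.
       1 / t * (LINT s:{0..t}|lborel.
         (z (real k / real m * s) - z ((real k - 1) / real m * s) - 1 / real m * z s)\<^sup>2)))"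

definition Z2_rs_inner :: "(real \<Rightarrow> real) \<Rightarrow> real \<Rightarrow> real" where
  "Z2_rs_inner z u = (if u \<le> 0 then 0 else
     1 / u * (LINT s:{0..u}|lborel. (z s - s / u * z u)\<^sup>2))"

definition Z2_rs :: "(real \<Rightarrow> real) \<Rightarrow> real \<Rightarrow> real" where
  "Z2_rs z t = (if t \<le> 0 then 0 else 1 / t * (LINT u:{0..t}|lborel. Z2_rs_inner z u))"

datatype scaling = Sec | Bm | Rs

text \<open>
  \<open>z\<close> is a path of the single process used by batch means and random scaling; \<open>zc 1, \<dots>, zc m\<close>
  are paths of the independent copies used by sectioning.
\<close>

fun Z2_star :: "scaling \<Rightarrow> nat \<Rightarrow> (real \<Rightarrow> real) \<Rightarrow> (nat \<Rightarrow> real \<Rightarrow> real) \<Rightarrow> real \<Rightarrow> real" where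
  "Z2_star Sec m z zc t = Z2_sec m zc t"
| "Z2_star Bm m z zc t = Z2_bm m z t"
| "Z2_star Rs m z zc t = Z2_rs z t"


section \<open>The Skorokhod $M_1$ topology on $D([0,\infty),\mathbb{R})$\<close>

text \<open>
  Elements of $D([0,\infty),\mathbb{R})$ are represented by functions on all of \<open>real\<close> whose values
  at negative arguments are ignored. Functions that agree on \<open>{0..}\<close> are topologically
  indistinguishable below, so continuous real-valued functionals do not separate them.
\<close>

definition cadlag :: "(real \<Rightarrow> real) set" where
  "cadlag = {x. (\<forall>t\<ge>0. continuous (at_right t) x) \<and> (\<forall>t>0. \<exists>l. (x \<longlongrightarrow> l) (at_left t))}"

text \<open>The usual convention \<open>x(0-) = x(0)\<close> is adopted.\<close>

definition left_lim :: "(real \<Rightarrow> real) \<Rightarrow> real \<Rightarrow> real" where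
  "left_lim x t = (if t \<le> 0 then x 0 else Lim (at_left t) x)"

text \<open>Points of the completed graph are pairs \<open>(z, t)\<close> of a spatial and a time coordinate.\<close>

definition completed_graph :: "real \<Rightarrow> (real \<Rightarrow> real) \<Rightarrow> (real \<times> real) set" where
  "completed_graph T x = {(z, t). 0 \<le> t \<and> t \<le> T \<and> z \<in> closed_segment (left_lim x t) (x t)}"

definition graph_le :: "(real \<Rightarrow> real) \<Rightarrow> real \<times> real \<Rightarrow> real \<times> real \<Rightarrow> bool" where
  "graph_le x p q \<longleftrightarrow> snd p < snd q \<or>
     (snd p = snd q \<and> \<bar>left_lim x (snd p) - fst p\<bar> \<le> \<bar>left_lim x (snd p) - fst q\<bar>)"

definition parametric_rep :: "real \<Rightarrow> (real \<Rightarrow> real) \<Rightarrow> (real \<Rightarrow> real \<times> real) \<Rightarrow> bool" where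
  "parametric_rep T x g \<longleftrightarrow>
     continuous_on {0..1} g \<and> g ` {0..1} = completed_graph T x \<and>
     (\<forall>s\<in>{0..1}. \<forall>s'\<in>{0..1}. s \<le> s' \<longrightarrow> graph_le x (g s) (g s'))"

definition M1_dist :: "real \<Rightarrow> (real \<Rightarrow> real) \<Rightarrow> (real \<Rightarrow> real) \<Rightarrow> real" where
  "M1_dist T x y = Inf {max (SUP s\<in>{0..1}. \<bar>fst (g s) - fst (h s)\<bar>)
                            (SUP s\<in>{0..1}. \<bar>snd (g s) - snd (h s)\<bar>) | g h.
                        parametric_rep T x g \<and> parametric_rep T y h}"

definition M1_converges :: "(nat \<Rightarrow> real \<Rightarrow> real) \<Rightarrow> (real \<Rightarrow> real) \<Rightarrow> bool" where
  "M1_converges xs x \<longleftrightarrow> (\<forall>T>0. isCont x T \<longrightarrow> (\<lambda>n. M1_dist T (xs n) x) \<longlonglongrightarrow> 0)"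

text \<open>
  $M_1$ convergence on $D([0,\infty),\mathbb{R})$ is metrizable, so the topology it comes from
  consists of the sequentially open sets.
\<close>

definition M1_open :: "(real \<Rightarrow> real) set \<Rightarrow> bool" where
  "M1_open V \<longleftrightarrow> V \<subseteq> cadlag \<and>
     (\<forall>x\<in>V. \<forall>xs. range xs \<subseteq> cadlag \<longrightarrow> M1_converges xs x \<longrightarrow> (\<forall>\<^sub>F n in sequentially. xs n \<in> V))"

definition M1_topology :: "(real \<Rightarrow> real) topology" where
  "M1_topology = topology M1_open"

lemma istopology_M1_open: "istopology M1_open"
  unfolding istopology_def
proof (intro conjI allI impI)
  fix S T assume "M1_open S" "M1_open T"
  then show "M1_open (S \<inter> T)"
    unfolding M1_open_def by (auto intro: eventually_conj)
next
  fix K assume K: "\<forall>S\<in>K. M1_open S"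
  show "M1_open (\<Union>K)"
    unfolding M1_open_def
  proof (intro conjI ballI allI impI)
    show "\<Union>K \<subseteq> cadlag" using K unfolding M1_open_def by blast
    fix x xs assume "x \<in> \<Union>K" and xs: "range xs \<subseteq> cadlag" "M1_converges xs x"
    then obtain S where S: "S \<in> K" "x \<in> S" by blast
    with K xs have "\<forall>\<^sub>F n in sequentially. xs n \<in> S" unfolding M1_open_def by blast
    then show "\<forall>\<^sub>F n in sequentially. xs n \<in> \<Union>K"
      by (rule eventually_mono) (use S in blast)
  qed
qed

lemma openin_M1_topology: "openin M1_topology = M1_open"
  unfolding M1_topology_def by (rule topology_inverse'[OF istopology_M1_open])

lemma topspace_M1_topology: "topspace M1_topology = cadlag"
proof -
  have "M1_open cadlag" unfolding M1_open_def by (auto intro!: always_eventually)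
  then show ?thesis
    unfolding topspace_def openin_M1_topology by (auto simp: M1_open_def)
qed

text \<open>
  Convergence in distribution along a filter of \<open>cadlag\<close>-valued processes. Continuous functionals
  are measurable for the $\sigma$-algebra generated by the coordinates, which is the Borel
  $\sigma$-algebra of $M_1$, so the integrals below are those of bounded random variables.
\<close>

definition weakly_converges_M1 ::
  "'e filter \<Rightarrow> 'a measure \<Rightarrow> ('e \<Rightarrow> 'a \<Rightarrow> real \<Rightarrow> real) \<Rightarrow> 'b measure \<Rightarrow> ('b \<Rightarrow> real \<Rightarrow> real) \<Rightarrow> bool" where
  "weakly_converges_M1 F M X N Y \<longleftrightarrow>
     (\<forall>f. continuous_map M1_topology euclideanreal f \<longrightarrow> bounded (f ` topspace M1_topology) \<longrightarrow>
        ((\<lambda>e. \<integral>\<omega>. f (X e \<omega>) \<partial>M) \<longlongrightarrow> (\<integral>\<omega>. f (Y \<omega>) \<partial>N)) F)"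


section \<open>Stable L\'evy processes\<close>

definition levy_process :: "'b measure \<Rightarrow> ('b \<Rightarrow> real \<Rightarrow> real) \<Rightarrow> bool" where
  "levy_process N L \<longleftrightarrow>
     prob_space N \<and>
     (\<forall>t\<ge>0. (\<lambda>\<omega>. L \<omega> t) \<in> borel_measurable N) \<and>
     (\<forall>\<omega>\<in>space N. L \<omega> \<in> cadlag) \<and>
     (AE \<omega> in N. L \<omega> 0 = 0) \<and>
     (\<forall>n (ts :: nat \<Rightarrow> real). 0 \<le> ts 0 \<longrightarrow> mono ts \<longrightarrow>
        prob_space.indep_vars N (\<lambda>_. borel) (\<lambda>i \<omega>. L \<omega> (ts (Suc i)) - L \<omega> (ts i)) {..<n}) \<and>
     (\<forall>s\<ge>0. \<forall>t\<ge>0. distr N borel (\<lambda>\<omega>. L \<omega> (s + t) - L \<omega> s) = distr N borel (\<lambda>\<omega>. L \<omega> t))"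

text \<open>
  A nondegenerate L\'evy process is \<open>\<beta>\<close>-stable if the law \<open>\<mu>\<close> of its value at time 1 is: for every
  \<open>c > 0\<close>, the convolution power \<open>\<mu>^c\<close>, i.e. the law at time \<open>c\<close>, is the image of \<open>\<mu>\<close> under
  \<open>x \<mapsto> c^(1/\<beta>) x + d\<close> for some \<open>d\<close>.
\<close>

definition stable_levy_process :: "real \<Rightarrow> 'b measure \<Rightarrow> ('b \<Rightarrow> real \<Rightarrow> real) \<Rightarrow> bool" where
  "stable_levy_process \<beta> N L \<longleftrightarrow>
     levy_process N L \<and>
     \<not> (\<exists>a. AE \<omega> in N. L \<omega> 1 = a) \<and>
     (\<forall>c>0. \<exists>d. distr N borel (\<lambda>\<omega>. L \<omega> c) = distr N borel (\<lambda>\<omega>. c powr (1 / \<beta>) * L \<omega> 1 + d))"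

definition mean_zero :: "'b measure \<Rightarrow> ('b \<Rightarrow> real \<Rightarrow> real) \<Rightarrow> bool" where
  "mean_zero N L \<longleftrightarrow>
     (\<forall>t\<ge>0. integrable N (\<lambda>\<omega>. L \<omega> t) \<and> (\<integral>\<omega>. L \<omega> t \<partial>N) = 0)"

definition spectrally_positive :: "'b measure \<Rightarrow> ('b \<Rightarrow> real \<Rightarrow> real) \<Rightarrow> bool" where
  "spectrally_positive N L \<longleftrightarrow> (AE \<omega> in N. \<forall>t>0. left_lim (L \<omega>) t \<le> L \<omega> t)"

end

theory Submission
  imports Defs
begin

text \<open>
  Write \<open>b y = y powr (2/\<alpha>) / ell y\<close> for the scale on which \<open>Z1\<close> fluctuates over \<open>y\<close> customers and
  \<open>A y = y / b y\<close>, which is regularly varying with the positive index \<open>1 - 2/\<alpha>\<close>. At time \<open>n\<close> the ratio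
  \<open>sqrt (Z2 n) / n\<close> is typically of order \<open>b n / n = 1 / A n\<close>, while \<open>\<epsilon>\<close> is of order \<open>1 / A a\<close> with
  \<open>a = Ainv (1/\<epsilon>)\<close>. So for \<open>n\<close> below a small multiple of \<open>a\<close> the event in question forces the
  estimator to be smaller than its typical size by a factor of order \<open>\<epsilon> * A n\<close>, and one has to see that
  this is so unlikely that the probabilities can be added over all scales \<open>n\<close>, \<open>2n\<close>, \<open>4n\<close>, ... between
  \<open>\<epsilon> powr (-\<nu>)\<close> and \<open>a\<close>.

  One dyadic scale is enough at a time because \<open>t * Z2 t\<close> is bounded below, for all \<open>t \<ge> N\<close>
  simultaneously, by a squared distance on a window of length of order \<open>N\<close> between \<open>Z1\<close> of one
  queue and a path that does not depend on the customers who arrive in the window: another queue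
  for sectioning, the past for batch means, a regression line fitted to the past for random scaling
  (\<open>estimator_distance_bound\<close>).

  A small distance is improbable because the window contains many almost independent blocks.
  A fixed linear functional of the path (\<open>contrast\<close>) is computed on every block. If the queue empties
  early in the block, then its value depends on the customers of the block alone, so the path that is
  given in advance would have to predict independent random quantities, one for each block
  (\<open>small_ball_blocks\<close>). On a block of \<open>y\<close> customers the contrast differs from every constant by a
  multiple of \<open>b y\<close> with a probability that is bounded below. This is what the weak convergence gives: the
  functional is continuous for \<open>M\<^sub>1\<close>, and its limit under the stable process is not degenerate
  (\<open>weak_limit_nonconcentration\<close>, \<open>queue_contrast_spread\<close>). Hence \<open>k\<close> blocks cost a factor
  \<open>(1 - c/2) ^ k\<close>. That the queue is short at the start of a block and drains fast follows from
  the second moment of the service times through the drift of \<open>W\<^sup>2\<close> in Lindley's recursion.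

  Finally, on the scale \<open>a / 2 ^ l\<close> one takes \<open>l\<close> blocks. They are shorter than the window by a factor
  \<open>2 ^ (l div d)\<close>, which diminishes \<open>b\<close> less than \<open>\<epsilon> * A\<close> has been diminished by going down \<open>l\<close> scales,
  provided that \<open>d\<close> is large (\<open>dyadic_levels\<close>). The sum over \<open>l \<ge> i\<close> is of order \<open>(1 - c/2) ^ i\<close>, up to an
  error that is a power of \<open>\<epsilon>\<close>, and \<open>\<eta> \<le> 2 ^ -i\<close> leaves only these levels.
\<close>

section \<open>Cadlag paths and their parametric representations\<close>

lemma cadlag_right: "x \<in> cadlag \<Longrightarrow> 0 \<le> t \<Longrightarrow> (x \<longlongrightarrow> x t) (at_right t)"
  unfolding cadlag_def continuous_within by auto

lemma cadlag_left:
  assumes "x \<in> cadlag" "0 < t"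
  shows "(x \<longlongrightarrow> left_lim x t) (at_left t)"
proof -
  obtain l where l: "(x \<longlongrightarrow> l) (at_left t)"
    using assms unfolding cadlag_def by auto
  then have "Lim (at_left t) x = l"
    by (intro tendsto_Lim) auto
  with l assms show ?thesis unfolding left_lim_def by simp
qed

lemma left_lim_0: "t \<le> 0 \<Longrightarrow> left_lim x t = x 0"
  unfolding left_lim_def by simp

text \<open>
  The bound passes from \<open>x\<close> to its left limits because these are limits of values of \<open>x\<close> in the same
  one-sided neighbourhood.
\<close>

lemma cadlag_near_right:
  assumes x: "x \<in> cadlag" and t: "0 \<le> t" and e: "0 < e"
  obtains d where "0 < d"
    "\<And>u. t < u \<Longrightarrow> u < t + d \<Longrightarrow> \<bar>x u - x t\<bar> \<le> e \<and> \<bar>left_lim x u - x t\<bar> \<le> e"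
proof -
  have "eventually (\<lambda>u. \<bar>x u - x t\<bar> < e) (at_right t)"
    using tendstoD[OF cadlag_right[OF x t] e] by (simp add: dist_real_def)
  then obtain b where b: "b > t" "\<And>y. t < y \<Longrightarrow> y < b \<Longrightarrow> \<bar>x y - x t\<bar> < e"
    unfolding eventually_at_right_field by auto
  have "\<bar>left_lim x u - x t\<bar> \<le> e" if "t < u" "u < b" for u
  proof -
    have u: "0 < u" using that t by simp
    have "((\<lambda>y. \<bar>x y - x t\<bar>) \<longlongrightarrow> \<bar>left_lim x u - x t\<bar>) (at_left u)"
      by (intro tendsto_intros cadlag_left x u)
    moreover have "eventually (\<lambda>y. \<bar>x y - x t\<bar> \<le> e) (at_left u)"
      unfolding eventually_at_left_field using b that
      by (intro exI[of _ t]) (auto intro!: less_imp_le)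
    ultimately show ?thesis
      by (intro tendsto_upperbound) auto
  qed
  then show thesis
    using b by (intro that[of "b - t"]) (auto intro!: less_imp_le)
qed

lemma cadlag_near_left:
  assumes x: "x \<in> cadlag" and t: "0 < t" and e: "0 < e"
  obtains d where "0 < d" "d \<le> t"
    "\<And>u. t - d < u \<Longrightarrow> u < t \<Longrightarrow> \<bar>x u - left_lim x t\<bar> \<le> e \<and> \<bar>left_lim x u - left_lim x t\<bar> \<le> e"
proof -
  have "eventually (\<lambda>u. \<bar>x u - left_lim x t\<bar> < e) (at_left t)"
    using tendstoD[OF cadlag_left[OF x t] e] by (simp add: dist_real_def)
  then obtain b' where b': "b' < t" "\<And>y. b' < y \<Longrightarrow> y < t \<Longrightarrow> \<bar>x y - left_lim x t\<bar> < e"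
    unfolding eventually_at_left_field by auto
  define b where "b = max 0 b'"
  have b: "b < t" "0 \<le> b" "\<And>y. b < y \<Longrightarrow> y < t \<Longrightarrow> \<bar>x y - left_lim x t\<bar> < e"
    using b' t unfolding b_def by auto
  have "\<bar>left_lim x u - left_lim x t\<bar> \<le> e" if "b < u" "u < t" for u
  proof -
    have u: "0 < u" using that b by simp
    have "((\<lambda>y. \<bar>x y - left_lim x t\<bar>) \<longlongrightarrow> \<bar>left_lim x u - left_lim x t\<bar>) (at_left u)"
      by (intro tendsto_intros cadlag_left x u)
    moreover have "eventually (\<lambda>y. \<bar>x y - left_lim x t\<bar> \<le> e) (at_left u)"
      unfolding eventually_at_left_field using b that
      by (intro exI[of _ b]) (auto intro!: less_imp_le)
    ultimately show ?thesis
      by (intro tendsto_upperbound) auto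
  qed
  then show thesis
    using b t by (intro that[of "t - b"]) (auto intro!: less_imp_le)
qed

text \<open>
  Jumps larger than \<open>1 / (n + 1)\<close> cannot accumulate at a point, as \<open>x\<close> has one-sided limits there.
\<close>

lemma cadlag_countable_jumps:
  assumes x: "x \<in> cadlag"
  shows "countable {t. 0 < t \<and> left_lim x t \<noteq> x t}"
proof -
  define P where "P n = {t. 0 < t \<and> inverse (Suc n) < \<bar>x t - left_lim x t\<bar>}" for n :: nat
  have "countable ({0<..} \<inter> P n)" for n
  proof (rule sparse_imp_countable)
    show "open {0::real<..}" by simp
    then show "P n sparse_in {0<..}"
    proof (subst sparse_in_eventually_iff, assumption, intro ballI)
      fix t :: real assume "t \<in> {0<..}"
      then have t: "0 < t" by simp
      define e where "e = inverse (real (Suc n)) / 2"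
      have e: "0 < e" unfolding e_def by simp
      obtain d1 where d1: "0 < d1" "\<And>u. t < u \<Longrightarrow> u < t + d1 \<Longrightarrow> \<bar>x u - x t\<bar> \<le> e \<and> \<bar>left_lim x u - x t\<bar> \<le> e"
        using cadlag_near_right[OF x less_imp_le[OF t] e] by metis
      obtain d2 where d2: "0 < d2" "\<And>u. t - d2 < u \<Longrightarrow> u < t \<Longrightarrow> \<bar>x u - left_lim x t\<bar> \<le> e \<and> \<bar>left_lim x u - left_lim x t\<bar> \<le> e"
        using cadlag_near_left[OF x t e] by metis
      have "u \<notin> P n" if "dist u t < min d1 d2" "u \<noteq> t" for u
      proof -
        have "\<bar>x u - left_lim x u\<bar> \<le> 2 * e"
        proof (cases "t < u")
          case True
          then show ?thesis using d1(2)[of u] that by (auto simp: dist_real_def)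
        next
          case False
          then show ?thesis using d2(2)[of u] that by (auto simp: dist_real_def)
        qed
        then show ?thesis unfolding P_def e_def by (auto simp: not_less)
      qed
      then show "\<forall>\<^sub>F y in at t. y \<notin> P n"
        unfolding eventually_at using d1(1) d2(1)
        by (intro exI[of _ "min d1 d2"]) auto
    qed
  qed
  moreover have "{t. 0 < t \<and> left_lim x t \<noteq> x t} \<subseteq> (\<Union>n. {0<..} \<inter> P n)"
  proof safe
    fix t assume t: "0 < t" "left_lim x t \<noteq> x t"
    then obtain n where "inverse (of_nat (Suc n)) < \<bar>x t - left_lim x t\<bar>"
      using reals_Archimedean[of "\<bar>x t - left_lim x t\<bar>"] by auto
    then show "t \<in> (\<Union>n. {0<..} \<inter> P n)" unfolding P_def using t by auto
  qed
  ultimately show ?thesis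
    by (meson countable_UN countableI_type countable_subset)
qed

lemma cadlag_isCont:
  assumes x: "x \<in> cadlag" and "0 < t" "left_lim x t = x t"
  shows "isCont x t"
  unfolding continuous_at
  using cadlag_right[of x t] cadlag_left[of x t] assms
  by (simp add: filterlim_at_split)

text \<open>
  A cadlag path has a parametric representation on every \<open>[0, T]\<close>. Time is stretched so
  that every jump time \<open>t\<close> is blown up to an interval, on which the representation runs linearly
  through the jump: the stretched clock is \<open>t + F t\<close>, where \<open>F\<close> is the distribution function of a
  probability measure that charges every jump time.
\<close>

lemma exists_parametric_rep:
  assumes x: "x \<in> cadlag" and T: "0 < T"
  shows "\<exists>g. parametric_rep T x g"
proof -
  define D where "D = {t. 0 < t \<and> left_lim x t \<noteq> x t}"
  have D: "countable D" unfolding D_def by (rule cadlag_countable_jumps[OF x])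
  \<comment> \<open>A geometric number, sent through an enumeration of the jump times, hits each of them with
    positive probability. If there are no jumps, \<open>from_nat_into {}\<close> makes \<open>\<mu>\<close> some point mass;
    an atom that is not a jump time is harmless, since \<open>left_lim x t = x t\<close> there.\<close>
  define \<mu> where "\<mu> = distr (measure_pmf (geometric_pmf (1/2))) borel (from_nat_into D)"
  interpret \<mu>: real_distribution \<mu>
    unfolding \<mu>_def
    by (rule real_distribution.intro, rule prob_space.prob_space_distr) 
      (auto intro: prob_space_measure_pmf simp: real_distribution_axioms_def)
  define lo hi where "lo t = t + measure \<mu> {..<t}" and "hi t = t + cdf \<mu> t" for t
  \<comment> \<open>The stretched clock spends the interval \<open>[lo t, hi t]\<close> at time \<open>t\<close>.\<close>
  have hi_diff: "hi t - lo t = measure \<mu> {t}" for t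
  proof -
    have "cdf \<mu> t = measure \<mu> ({..<t} \<union> {t})" unfolding cdf_def
      by (rule arg_cong[where f = "measure \<mu>"]) auto
    also have "\<dots> = measure \<mu> {..<t} + measure \<mu> {t}"
      by (rule \<mu>.finite_measure_Union) auto
    finally show ?thesis unfolding hi_def lo_def by simp
  qed
  have atom: "0 < measure \<mu> {t}" if td: "t \<in> D" for t
  proof -
    obtain n where n: "from_nat_into D n = t"
      using from_nat_into_surj[OF D td] by blast
    have "0 < pmf (geometric_pmf (1/2 :: real)) n" by (simp add: )
    also have "\<dots> = measure (measure_pmf (geometric_pmf (1/2))) {n}"
      by (simp add: measure_pmf_single)
    also have "\<dots> \<le> measure (measure_pmf (geometric_pmf (1/2))) (from_nat_into D -` {t})"
      by (rule measure_pmf.finite_measure_mono) (use n in auto)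
    also have "\<dots> = measure \<mu> {t}" unfolding \<mu>_def by (subst measure_distr) auto
    finally show ?thesis .
  qed
  have lo_le_hi: "lo t \<le> hi t" for t using hi_diff[of t] measure_nonneg[of \<mu> "{t}"] by linarith
  have gap: "hi s + (t - s) \<le> lo t" if "s < t" for s t
  proof -
    have "cdf \<mu> s \<le> measure \<mu> {..<t}" unfolding cdf_def
      by (rule \<mu>.finite_measure_mono) (use that in auto)
    then show ?thesis unfolding hi_def lo_def by simp
  qed
  have uniq: "s = t" if "lo s \<le> r" "r \<le> hi s" "lo t \<le> r" "r \<le> hi t" for r s t
    using gap[of s t] gap[of t s] that by (cases s t rule: linorder_cases) auto
  have ex: "\<exists>t. 0 \<le> t \<and> t \<le> T \<and> lo t \<le> r \<and> r \<le> hi t" if r: "lo 0 \<le> r" "r \<le> hi T" for r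
  proof -
    define A where "A = {t. 0 \<le> t \<and> t \<le> T \<and> lo t \<le> r}"
    have A: "A \<noteq> {}" "bdd_above A" unfolding A_def using r T by (auto intro!: bdd_aboveI[of _ T] exI[of _ 0])
    define t where "t = Sup A"
    have t0: "0 \<le> t" unfolding t_def using A r T by (intro cSup_upper) (auto simp: A_def)
    have tT: "t \<le> T" unfolding t_def using A by (intro cSup_least) (auto simp: A_def)
    have "hi s \<le> r" if "s < t" for s
    proof -
      obtain t' where "t' \<in> A" "s < t'" using \<open>s < t\<close> A unfolding t_def by (auto simp: less_cSup_iff)
      then show ?thesis using gap[of s t'] by (auto simp: A_def)
    qed
    then have "eventually (\<lambda>s. hi s \<le> r) (at_left t)"
      by (auto simp: eventually_at_left_field intro: exI[of _ "t - 1"])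
    moreover have "(hi \<longlongrightarrow> lo t) (at_left t)"
      unfolding hi_def lo_def by (intro tendsto_intros \<mu>.cdf_at_left)
    ultimately have "lo t \<le> r" by (intro tendsto_upperbound) auto
    moreover have "r \<le> hi t"
    proof (cases "t = T")
      case False
      then have "t < T" using tT by simp
      have "r \<le> hi u" if "t < u" "u < T" for u
      proof -
        have "u \<notin> A" using that cSup_upper[OF _ A(2), of u] unfolding t_def by auto
        then show ?thesis using that t0 lo_le_hi[of u] unfolding A_def by auto
      qed
      then have "eventually (\<lambda>u. r \<le> hi u) (at_right t)"
        using \<open>t < T\<close> by (auto simp: eventually_at_right_field intro!: exI[of _ T])
      moreover have "(hi \<longlongrightarrow> hi t) (at_right t)"
        unfolding hi_def using \<mu>.cdf_is_right_cont[of t]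
        by (intro tendsto_intros) (auto simp: continuous_within)
      ultimately show ?thesis by (intro tendsto_lowerbound) auto
    qed (use r in simp)
    ultimately show ?thesis using t0 tT by auto
  qed
  define r0 r1 where "r0 = lo 0" and "r1 = hi T"
  have r01: "r0 < r1" using gap[OF T] lo_le_hi[of 0] lo_le_hi[of T] T unfolding r0_def r1_def by linarith
  define \<tau> where "\<tau> r = (SOME t. 0 \<le> t \<and> t \<le> T \<and> lo t \<le> r \<and> r \<le> hi t)" for r
  have \<tau>: "0 \<le> \<tau> r" "\<tau> r \<le> T" "lo (\<tau> r) \<le> r" "r \<le> hi (\<tau> r)" if "r0 \<le> r" "r \<le> r1" for r
    using someI_ex[OF ex[of r]] that unfolding r0_def r1_def \<tau>_def by auto
  have \<tau>_eq: "\<tau> r = t" if "r0 \<le> r" "r \<le> r1" "lo t \<le> r" "r \<le> hi t" for r t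
    using uniq[of "\<tau> r" r t] \<tau>[OF that(1,2)] that by auto
  have \<tau>_mono: "\<tau> r \<le> \<tau> r'" if "r0 \<le> r" "r \<le> r'" "r' \<le> r1" for r r'
  proof (rule ccontr)
    assume "\<not> ?thesis"
    then have "\<tau> r' < \<tau> r" by simp
    then show False using gap[of "\<tau> r'" "\<tau> r"] \<tau>[of r] \<tau>[of r'] that by auto
  qed
  have \<tau>_lip: "\<tau> r' - \<tau> r \<le> r' - r" if "r0 \<le> r" "r \<le> r'" "r' \<le> r1" for r r'
  proof (cases "\<tau> r = \<tau> r'")
    case False
    then have "\<tau> r < \<tau> r'" using \<tau>_mono[OF that] by simp
    then show ?thesis using gap[of "\<tau> r" "\<tau> r'"] \<tau>[of r] \<tau>[of r'] that by auto
  qed (use that in auto)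
  \<comment> \<open>The fraction of the jump at \<open>\<tau> r\<close> that has been passed; it is 0 by division by zero where the
    clock is not stretched.\<close>
  define \<theta> where "\<theta> r = (r - lo (\<tau> r)) / (hi (\<tau> r) - lo (\<tau> r))" for r
  have \<theta>: "0 \<le> \<theta> r" "\<theta> r \<le> 1" if "r0 \<le> r" "r \<le> r1" for r
    using \<tau>[OF that] unfolding \<theta>_def by (auto simp: divide_simps)
  define v where "v r = left_lim x (\<tau> r) + \<theta> r * (x (\<tau> r) - left_lim x (\<tau> r))" for r
  have no_atom: "left_lim x t = x t" if "hi t = lo t" "0 \<le> t" for t
    using atom[of t] hi_diff[of t] that unfolding D_def by (cases "t = 0") (auto simp: left_lim_0)
  have v_hi: "v r = x (\<tau> r)" if "r0 \<le> r" "r \<le> r1" "r = hi (\<tau> r)" for r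
    using no_atom[of "\<tau> r"] \<tau>[OF that(1,2)] that(3) unfolding v_def \<theta>_def
    by (cases "hi (\<tau> r) = lo (\<tau> r)") auto
  have v_lo: "v r = left_lim x (\<tau> r)" if "r = lo (\<tau> r)" for r
    using that unfolding v_def \<theta>_def by simp
  have v_near: "\<bar>v r - z\<bar> \<le> e" if "r0 \<le> r" "r \<le> r1" "\<bar>x (\<tau> r) - z\<bar> \<le> e" "\<bar>left_lim x (\<tau> r) - z\<bar> \<le> e" for r z e
  proof -
    have "v r - z = (1 - \<theta> r) * (left_lim x (\<tau> r) - z) + \<theta> r * (x (\<tau> r) - z)"
      unfolding v_def by (simp add: algebra_simps)
    also have "\<bar>\<dots>\<bar> \<le> (1 - \<theta> r) * \<bar>left_lim x (\<tau> r) - z\<bar> + \<theta> r * \<bar>x (\<tau> r) - z\<bar>"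
      using \<theta>[OF that(1,2)] by (intro order_trans[OF abs_triangle_ineq]) (simp add: abs_mult)
    also have "\<dots> \<le> (1 - \<theta> r) * e + \<theta> r * e"
      using \<theta>[OF that(1,2)] that by (intro add_mono mult_left_mono) auto
    finally show ?thesis by (simp add: algebra_simps)
  qed
  have lin: "\<exists>d>0. \<forall>r'. \<bar>r' - r\<bar> < d \<longrightarrow> r0 \<le> r' \<longrightarrow> r' \<le> r1 \<longrightarrow> \<tau> r' = \<tau> r \<longrightarrow> \<bar>v r' - v r\<bar> \<le> e" 
    if e: "0 < e" for r e
  proof -
    define C where "C = \<bar>x (\<tau> r) - left_lim x (\<tau> r)\<bar> / \<bar>hi (\<tau> r) - lo (\<tau> r)\<bar>"
    have C: "0 \<le> C" unfolding C_def by simp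
    have "\<bar>v r' - v r\<bar> \<le> e" if "\<bar>r' - r\<bar> < e / (C + 1)" "\<tau> r' = \<tau> r" for r'
    proof -
      have "v r' - v r = (r' - r) * ((x (\<tau> r) - left_lim x (\<tau> r)) / (hi (\<tau> r) - lo (\<tau> r)))"
        unfolding v_def \<theta>_def that by (simp add: diff_divide_distrib algebra_simps)
      then have "\<bar>v r' - v r\<bar> = \<bar>r' - r\<bar> * C" unfolding C_def by (simp add: abs_mult)
      also have "\<dots> \<le> e / (C + 1) * (C + 1)" using that C e by (intro mult_mono) auto
      finally show ?thesis using C by simp
    qed
    then show ?thesis using e C by (intro exI[of _ "e / (C + 1)"]) auto
  qed
  \<comment> \<open>Continuity from the right: inside a stretched interval \<open>v\<close> is linear, and at its end the clock
    moves on to times right of \<open>\<tau> r\<close>, where \<open>x\<close> is close to \<open>x (\<tau> r)\<close>. Likewise from the left.\<close>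
  have right: "\<exists>d>0. \<forall>r'. r < r' \<longrightarrow> r' < r + d \<longrightarrow> r' \<le> r1 \<longrightarrow> \<bar>v r' - v r\<bar> \<le> e"
    if r: "r0 \<le> r" "r \<le> r1" and e: "0 < e" for r e
  proof (cases "r = hi (\<tau> r)")
    case True
    obtain d where d: "0 < d" "\<And>u. \<tau> r < u \<Longrightarrow> u < \<tau> r + d \<Longrightarrow> \<bar>x u - x (\<tau> r)\<bar> \<le> e \<and> \<bar>left_lim x u - x (\<tau> r)\<bar> \<le> e"
      using cadlag_near_right[OF x \<tau>(1)[OF r] e] by metis
    show ?thesis
    proof (intro exI[of _ d] conjI d allI impI)
      fix r' assume r': "r < r'" "r' < r + d" "r' \<le> r1"
      then have in': "r0 \<le> r'" using r by simp
      have "\<tau> r \<noteq> \<tau> r'" using \<tau>(4)[OF in' r'(3)] True r' by auto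
      then have "\<tau> r < \<tau> r'" using \<tau>_mono[of r r'] r r' by auto
      moreover have "\<tau> r' < \<tau> r + d" using \<tau>_lip[of r r'] r r' by auto
      ultimately show "\<bar>v r' - v r\<bar> \<le> e"
        unfolding v_hi[OF r True] using v_near[OF in' r'(3)] d(2) by auto
    qed
  next
    case False
    then have lt: "r < hi (\<tau> r)" using \<tau>(4)[OF r] by simp
    obtain d where d: "0 < d" "\<And>r'. \<bar>r' - r\<bar> < d \<Longrightarrow> r0 \<le> r' \<Longrightarrow> r' \<le> r1 \<Longrightarrow> \<tau> r' = \<tau> r \<Longrightarrow> \<bar>v r' - v r\<bar> \<le> e"
      using lin[OF e, of r] by metis
    show ?thesis
    proof (intro exI[of _ "min d (hi (\<tau> r) - r)"] conjI allI impI)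
      fix r' assume r': "r < r'" "r' < r + min d (hi (\<tau> r) - r)" "r' \<le> r1"
      have "\<tau> r' = \<tau> r" using r r' \<tau>(3)[OF r] by (intro \<tau>_eq) auto
      then show "\<bar>v r' - v r\<bar> \<le> e" using d(2)[of r'] r r' by auto
    qed (use d lt in auto)
  qed
  have left: "\<exists>d>0. \<forall>r'. r' < r \<longrightarrow> r - d < r' \<longrightarrow> r0 \<le> r' \<longrightarrow> \<bar>v r' - v r\<bar> \<le> e"
    if r: "r0 \<le> r" "r \<le> r1" and e: "0 < e" for r e
  proof (cases "r = lo (\<tau> r)")
    case True
    show ?thesis
    proof (cases "\<tau> r = 0")
      case True
      then have "r = r0" using \<open>r = lo (\<tau> r)\<close> unfolding r0_def by simp
      then show ?thesis by (intro exI[of _ 1]) auto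
    next
      case False
      then have "0 < \<tau> r" using \<tau>(1)[OF r] by simp
      then obtain d where d: "0 < d" "\<And>u. \<tau> r - d < u \<Longrightarrow> u < \<tau> r \<Longrightarrow> \<bar>x u - left_lim x (\<tau> r)\<bar> \<le> e \<and> \<bar>left_lim x u - left_lim x (\<tau> r)\<bar> \<le> e"
        using cadlag_near_left[OF x _ e] by metis
      show ?thesis
      proof (intro exI[of _ d] conjI d allI impI)
        fix r' assume r': "r' < r" "r - d < r'" "r0 \<le> r'"
        then have in': "r' \<le> r1" using r by simp
        have "\<tau> r \<noteq> \<tau> r'" using \<tau>(3)[OF r'(3) in'] True r' by auto
        then have "\<tau> r' < \<tau> r" using \<tau>_mono[of r' r] r r' by auto
        moreover have "\<tau> r - d < \<tau> r'" using \<tau>_lip[of r' r] r r' by auto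
        ultimately show "\<bar>v r' - v r\<bar> \<le> e"
          unfolding v_lo[OF True] using v_near[OF r'(3) in'] d(2) by auto
      qed
    qed
  next
    case False
    then have lt: "lo (\<tau> r) < r" using \<tau>(3)[OF r] by simp
    obtain d where d: "0 < d" "\<And>r'. \<bar>r' - r\<bar> < d \<Longrightarrow> r0 \<le> r' \<Longrightarrow> r' \<le> r1 \<Longrightarrow> \<tau> r' = \<tau> r \<Longrightarrow> \<bar>v r' - v r\<bar> \<le> e"
      using lin[OF e, of r] by metis
    show ?thesis
    proof (intro exI[of _ "min d (r - lo (\<tau> r))"] conjI allI impI)
      fix r' assume r': "r' < r" "r - min d (r - lo (\<tau> r)) < r'" "r0 \<le> r'"
      have "\<tau> r' = \<tau> r" using r r' \<tau>(4)[OF r] by (intro \<tau>_eq) auto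
      then show "\<bar>v r' - v r\<bar> \<le> e" using d(2)[of r'] r r' by auto
    qed (use d lt in auto)
  qed
  have v_cont: "continuous_on {r0..r1} v"
    unfolding continuous_on_iff
  proof (intro ballI allI impI)
    fix r e :: real assume "r \<in> {r0..r1}" "0 < e"
    then have r: "r0 \<le> r" "r \<le> r1" and e: "0 < e / 2" by auto
    obtain d1 where d1: "0 < d1" "\<And>r'. r < r' \<Longrightarrow> r' < r + d1 \<Longrightarrow> r' \<le> r1 \<Longrightarrow> \<bar>v r' - v r\<bar> \<le> e / 2"
      using right[OF r e] by metis
    obtain d2 where d2: "0 < d2" "\<And>r'. r' < r \<Longrightarrow> r - d2 < r' \<Longrightarrow> r0 \<le> r' \<Longrightarrow> \<bar>v r' - v r\<bar> \<le> e / 2"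
      using left[OF r e] by metis
    show "\<exists>d>0. \<forall>x'\<in>{r0..r1}. dist x' r < d \<longrightarrow> dist (v x') (v r) < e"
    proof (intro exI[of _ "min d1 d2"] conjI ballI impI)
      fix r' assume r': "r' \<in> {r0..r1}" "dist r' r < min d1 d2"
      have "\<bar>v r' - v r\<bar> \<le> e / 2"
        using d1(2)[of r'] d2(2)[of r'] r' e by (cases r r' rule: linorder_cases) (auto simp: dist_real_def)
      then show "dist (v r') (v r) < e" using \<open>0 < e\<close> by (simp add: dist_real_def)
    qed (use d1 d2 in auto)
  qed
  have \<tau>_cont: "continuous_on {r0..r1} \<tau>"
    unfolding continuous_on_iff
  proof (intro ballI allI impI)
    fix r e :: real assume "r \<in> {r0..r1}" "0 < e"
    then have r: "r0 \<le> r" "r \<le> r1" by auto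
    have "\<bar>\<tau> r' - \<tau> r\<bar> \<le> \<bar>r' - r\<bar>" if "r0 \<le> r'" "r' \<le> r1" for r'
    proof (cases "r \<le> r'")
      case True
      then show ?thesis using \<tau>_lip[of r r'] \<tau>_mono[of r r'] r that by auto
    next
      case False
      then show ?thesis using \<tau>_lip[of r' r] \<tau>_mono[of r' r] r that by auto
    qed
    then show "\<exists>d>0. \<forall>x'\<in>{r0..r1}. dist x' r < d \<longrightarrow> dist (\<tau> x') (\<tau> r) < e"
      using \<open>0 < e\<close> by (intro exI[of _ e]) (fastforce simp: dist_real_def)
  qed
  define \<rho> where "\<rho> s = r0 + s * (r1 - r0)" for s
  have \<rho>: "r0 \<le> \<rho> s" "\<rho> s \<le> r1" if "0 \<le> s" "s \<le> 1" for s
  proof -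
    have "0 \<le> r1 - r0" using r01 by simp
    then have "0 \<le> s * (r1 - r0)" "s * (r1 - r0) \<le> r1 - r0"
      using that by (auto intro: mult_left_le_one_le)
    then show "r0 \<le> \<rho> s" "\<rho> s \<le> r1" unfolding \<rho>_def by (auto simp only: le_diff_eq add.commute le_add_same_cancel1)
  qed
  have \<rho>_onto: "\<exists>s\<in>{0..1}. \<rho> s = r" if "r0 \<le> r" "r \<le> r1" for r
    using that r01 unfolding \<rho>_def by (intro bexI[of _ "(r - r0) / (r1 - r0)"]) (auto simp: divide_simps)
  have \<rho>_mono: "\<rho> s \<le> \<rho> s'" if "s \<le> s'" for s s'
    unfolding \<rho>_def using that r01 by (intro add_left_mono mult_right_mono) auto
  define g where "g s = (v (\<rho> s), \<tau> (\<rho> s))" for s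
  have "parametric_rep T x g"
    unfolding parametric_rep_def
  proof (intro conjI ballI impI)
    have "continuous_on {0..1} \<rho>" unfolding \<rho>_def by (intro continuous_intros)
    moreover have "\<rho> ` {0..1} \<subseteq> {r0..r1}" using \<rho> by auto
    ultimately show "continuous_on {0..1} g" unfolding g_def
      by (intro continuous_on_Pair continuous_on_compose2[OF v_cont] continuous_on_compose2[OF \<tau>_cont]) auto
    show "g ` {0..1} = completed_graph T x"
    proof (intro set_eqI iffI)
      fix p assume "p \<in> g ` {0..1}"
      then obtain s where s: "0 \<le> s" "s \<le> 1" "p = g s" by auto
      have "v (\<rho> s) \<in> closed_segment (left_lim x (\<tau> (\<rho> s))) (x (\<tau> (\<rho> s)))"
        unfolding closed_segment_def v_def using \<theta>[OF \<rho>[OF s(1,2)]]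
        by (auto intro!: exI[of _ "\<theta> (\<rho> s)"] simp: algebra_simps)
      then show "p \<in> completed_graph T x"
        unfolding completed_graph_def s(3) g_def using \<tau>[OF \<rho>[OF s(1,2)]] by auto
    next
      fix p assume "p \<in> completed_graph T x"
      then obtain z t where p: "p = (z, t)" "0 \<le> t" "t \<le> T" "z \<in> closed_segment (left_lim x t) (x t)"
        unfolding completed_graph_def by auto
      then obtain u where u: "0 \<le> u" "u \<le> 1" "z = left_lim x t + u * (x t - left_lim x t)"
        unfolding closed_segment_def by (auto simp: algebra_simps)
      define r where "r = lo t + u * (hi t - lo t)"
      have rt: "lo t \<le> r" "r \<le> hi t" unfolding r_def using u lo_le_hi[of t] mult_right_mono[of u 1 "hi t - lo t"] by auto
      have "lo 0 \<le> lo t" using p gap[of 0 t] lo_le_hi[of 0] by (cases "t = 0") auto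
      moreover have "hi t \<le> hi T" using p gap[of t T] lo_le_hi[of T] by (cases "t = T") auto
      ultimately have r: "r0 \<le> r" "r \<le> r1" using rt unfolding r0_def r1_def by auto
      have \<tau>r: "\<tau> r = t" by (rule \<tau>_eq[OF r rt])
      have "v r = z"
      proof (cases "hi t = lo t")
        case True
        then have "left_lim x t = x t" using no_atom p by auto
        then show ?thesis unfolding v_def \<tau>r u(3) by simp
      next
        case False
        then have "\<theta> r = u" unfolding \<theta>_def \<tau>r unfolding r_def by simp
        then show ?thesis unfolding v_def \<tau>r u(3) by simp
      qed
      with \<tau>r \<rho>_onto[OF r] p show "p \<in> g ` {0..1}" unfolding g_def by auto
    qed
    fix s s' :: real assume "s \<in> {0..1}" "s' \<in> {0..1}" "s \<le> s'"
    then have in1: "r0 \<le> \<rho> s" "\<rho> s \<le> \<rho> s'" "\<rho> s' \<le> r1" "r0 \<le> \<rho> s'" "\<rho> s \<le> r1" using \<rho> \<rho>_mono by auto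
    show "graph_le x (g s) (g s')"
    proof (cases "\<tau> (\<rho> s) = \<tau> (\<rho> s')")
      case True
      have "\<theta> (\<rho> s) \<le> \<theta> (\<rho> s')" unfolding \<theta>_def True using in1 lo_le_hi
        by (intro divide_right_mono) auto
      then have "\<theta> (\<rho> s) * \<bar>x (\<tau> (\<rho> s')) - left_lim x (\<tau> (\<rho> s'))\<bar> \<le> \<theta> (\<rho> s') * \<bar>x (\<tau> (\<rho> s')) - left_lim x (\<tau> (\<rho> s'))\<bar>"
        by (intro mult_right_mono) auto
      then show ?thesis unfolding graph_le_def g_def v_def True
        using \<theta>[of "\<rho> s"] \<theta>[of "\<rho> s'"] in1 by (simp add: abs_mult)
    next
      case False
      then show ?thesis using \<tau>_mono[OF in1(1-3)] unfolding graph_le_def g_def by auto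
    qed
  qed
  then show ?thesis by blast
qed


lemma parametric_rep_bdd:
  assumes "parametric_rep T x g"
  shows "compact (completed_graph T x)" "continuous_on {0..1} (\<lambda>s. fst (g s))" "continuous_on {0..1} (\<lambda>s. snd (g s))"
proof -
  have g: "continuous_on {0..1} g" "completed_graph T x = g ` {0..1}"
    using assms unfolding parametric_rep_def by auto
  show "compact (completed_graph T x)" unfolding g(2) by (intro compact_continuous_image g) auto
  show "continuous_on {0..1} (\<lambda>s. fst (g s))" "continuous_on {0..1} (\<lambda>s. snd (g s))"
    by (intro continuous_on_fst continuous_on_snd g)+
qed

lemma M1_close_reps:
  assumes x: "x \<in> cadlag" and y: "y \<in> cadlag" and T: "0 < T" and d: "M1_dist T y x < d"
  obtains g h where "parametric_rep T y g" "parametric_rep T x h"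
    "\<And>s. s \<in> {0..1} \<Longrightarrow> \<bar>fst (g s) - fst (h s)\<bar> < d \<and> \<bar>snd (g s) - snd (h s)\<bar> < d"
proof -
  define m :: "(real \<Rightarrow> real \<times> real) \<Rightarrow> (real \<Rightarrow> real \<times> real) \<Rightarrow> real" where
    "m g h = max (SUP s\<in>{0..1}. \<bar>fst (g s) - fst (h s)\<bar>) (SUP s\<in>{0..1}. \<bar>snd (g s) - snd (h s)\<bar>)" for g h
  define S where "S = {m g h | g h. parametric_rep T y g \<and> parametric_rep T x h}"
  have "S \<noteq> {}" using exists_parametric_rep[OF x T] exists_parametric_rep[OF y T] unfolding S_def by blast
  moreover have "Inf S < d" using d unfolding M1_dist_def S_def m_def .
  ultimately obtain r where r: "r \<in> S" "r < d" using cInf_lessD[of S d] by blast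
  then obtain g h where gh: "r = m g h" "parametric_rep T y g" "parametric_rep T x h" unfolding S_def by blast
  have bdd: "bdd_above ((\<lambda>s. \<bar>f s\<bar>) ` {0..1})" if "continuous_on {0..1::real} f" for f :: "real \<Rightarrow> real"
    by (intro bounded_imp_bdd_above compact_imp_bounded compact_continuous_image continuous_on_rabs that) auto
  show thesis
  proof (rule that[OF gh(2,3)])
    fix s :: real assume s: "s \<in> {0..1}"
    have "continuous_on {0..1} (\<lambda>s. fst (g s) - fst (h s))" "continuous_on {0..1} (\<lambda>s. snd (g s) - snd (h s))"
      using parametric_rep_bdd[OF gh(2)] parametric_rep_bdd[OF gh(3)] by (auto intro: continuous_on_diff)
    note c = this[THEN bdd]
    have "\<bar>fst (g s) - fst (h s)\<bar> \<le> (SUP s\<in>{0..1}. \<bar>fst (g s) - fst (h s)\<bar>)"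
      by (rule cSUP_upper[OF s c(1)])
    moreover have "\<bar>snd (g s) - snd (h s)\<bar> \<le> (SUP s\<in>{0..1}. \<bar>snd (g s) - snd (h s)\<bar>)"
      by (rule cSUP_upper[OF s c(2)])
    ultimately show "\<bar>fst (g s) - fst (h s)\<bar> < d \<and> \<bar>snd (g s) - snd (h s)\<bar> < d"
      using r(2) unfolding gh(1) m_def max_less_iff_conj by (meson le_less_trans)
  qed
qed

text \<open>
  The distance is an infimum over a nonempty set, as parametric representations exist, so some pair of
  representations is uniformly closer than \<open>d\<close>; the parameter at which the first one passes \<open>(y t, t)\<close>
  gives the point for the second one.
\<close>

lemma M1_close_graphs:
  assumes "x \<in> cadlag" "y \<in> cadlag" "0 < T" "M1_dist T y x < d" and t: "0 \<le> t" "t \<le> T"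
  obtains z u where "(z, u) \<in> completed_graph T x" "\<bar>y t - z\<bar> < d" "\<bar>t - u\<bar> < d"
proof -
  obtain g h where gh: "parametric_rep T y g" "parametric_rep T x h"
    "\<And>s. s \<in> {0..1} \<Longrightarrow> \<bar>fst (g s) - fst (h s)\<bar> < d \<and> \<bar>snd (g s) - snd (h s)\<bar> < d"
    by (rule M1_close_reps[OF assms(1-4)]) blast
  have "(y t, t) \<in> g ` {0..1}" using gh(1) t unfolding parametric_rep_def completed_graph_def by auto
  then obtain s where s: "s \<in> {0..1}" "g s = (y t, t)" by auto
  have "h s \<in> completed_graph T x" using gh(2) s(1) unfolding parametric_rep_def by auto
  then show thesis
    using gh(3)[OF s(1)] s(2) by (intro that[of "fst (h s)" "snd (h s)"]) auto
qed

lemma cadlag_continuity_point: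
  assumes x: "x \<in> cadlag" and B: "0 \<le> B"
  obtains T where "B < T" "isCont x T"
proof -
  have "\<not> {B<..<B + 1} \<subseteq> {t. 0 < t \<and> left_lim x t \<noteq> x t}"
    using cadlag_countable_jumps[OF x] countable_subset uncountable_open_interval[of B "B + 1"] by auto
  then obtain T where "B < T" "left_lim x T = x T" using B by auto
  then show thesis using cadlag_isCont[OF x, of T] B by (intro that[of T]) auto
qed

text \<open>
  Near a continuity point of \<open>x\<close> the completed graph of \<open>x\<close> is close to the single value \<open>x t\<close>.
\<close>

lemma M1_converges_pointwise:
  assumes x: "x \<in> cadlag" and xs: "\<And>n. xs n \<in> cadlag" and conv: "M1_converges xs x"
    and t: "0 < t" "isCont x t"
  shows "(\<lambda>n. xs n t) \<longlonglongrightarrow> x t"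
proof (rule LIMSEQ_I)
  fix e :: real assume e: "0 < e"
  obtain T where T: "t < T" "isCont x T" using cadlag_continuity_point[OF x, of t] t by auto
  obtain d0 where d0: "0 < d0" "\<And>u. \<bar>u - t\<bar> < d0 \<Longrightarrow> \<bar>x u - x t\<bar> < e / 2"
    using t(2) e unfolding continuous_at_eps_delta dist_real_def by (metis half_gt_zero)
  define d where "d = min (d0 / 2) (min (t / 2) (e / 2))"
  have d: "0 < d" "d \<le> d0 / 2" "d \<le> t / 2" "d \<le> e / 2" unfolding d_def using d0 t e by auto
  have seg: "\<bar>z - x t\<bar> \<le> e / 2" if "(z, u) \<in> completed_graph T x" "\<bar>t - u\<bar> < d" for z u
  proof -
    have u: "0 < u" using that d by auto
    have "\<bar>left_lim x u - x t\<bar> \<le> e / 2"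
    proof -
      have "((\<lambda>v. \<bar>x v - x t\<bar>) \<longlongrightarrow> \<bar>left_lim x u - x t\<bar>) (at_left u)"
        by (intro tendsto_intros cadlag_left x u)
      moreover have "eventually (\<lambda>v. \<bar>x v - x t\<bar> \<le> e / 2) (at_left u)"
        unfolding eventually_at_left_field
      proof (intro exI[of _ "u - d0 / 2"] conjI allI impI)
        fix v assume "u - d0 / 2 < v" "v < u"
        then have "\<bar>v - t\<bar> < d0" using that(2) d by linarith
        then show "\<bar>x v - x t\<bar> \<le> e / 2" by (intro less_imp_le d0(2))
      qed (use d0 in simp)
      ultimately show ?thesis by (intro tendsto_upperbound) auto
    qed
    moreover have "\<bar>x u - x t\<bar> \<le> e / 2" using that d by (intro less_imp_le d0(2)) linarith
    moreover have "z \<in> closed_segment (left_lim x u) (x u)" using that(1) unfolding completed_graph_def by auto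
    ultimately show ?thesis unfolding closed_segment_eq_real_ivl by (smt (verit) atLeastAtMost_iff)
  qed
  have "(\<lambda>n. M1_dist T (xs n) x) \<longlonglongrightarrow> 0"
    using conv T t unfolding M1_converges_def by auto
  then have "eventually (\<lambda>n. M1_dist T (xs n) x < d) sequentially"
    using d(1) by (rule order_tendstoD)
  then obtain n0 where n0: "\<And>n. n0 \<le> n \<Longrightarrow> M1_dist T (xs n) x < d"
    unfolding eventually_sequentially by auto
  have "norm (xs n t - x t) < e" if n: "n0 \<le> n" for n
  proof -
    have "0 < T" "0 \<le> t" "t \<le> T" using t T by auto
    then obtain z u where zu: "(z, u) \<in> completed_graph T x" "\<bar>xs n t - z\<bar> < d" "\<bar>t - u\<bar> < d"
      by (rule M1_close_graphs[OF x xs _ n0[OF n]])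
    show ?thesis using seg[OF zu(1,3)] zu(2) d(4) by (simp add: abs_if split: if_splits)
  qed
  then show "\<exists>n0. \<forall>n\<ge>n0. norm (xs n t - x t) < e" by blast
qed

lemma M1_converges_bounded:
  assumes x: "x \<in> cadlag" and xs: "\<And>n. xs n \<in> cadlag" and conv: "M1_converges xs x" and B: "0 \<le> B"
  obtains C n0 where "\<And>n t. n0 \<le> n \<Longrightarrow> 0 \<le> t \<Longrightarrow> t \<le> B \<Longrightarrow> \<bar>xs n t\<bar> \<le> C"
proof -
  obtain T where T: "B < T" "isCont x T" using cadlag_continuity_point[OF x B] by auto
  obtain h where "parametric_rep T x h" using exists_parametric_rep[OF x, of T] T B by auto
  then have "bounded (completed_graph T x)" by (intro compact_imp_bounded parametric_rep_bdd)
  then obtain C where C: "\<And>p. p \<in> completed_graph T x \<Longrightarrow> norm p \<le> C" unfolding bounded_iff by auto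
  have "(\<lambda>n. M1_dist T (xs n) x) \<longlonglongrightarrow> 0"
    using conv T B unfolding M1_converges_def by auto
  then have "eventually (\<lambda>n. M1_dist T (xs n) x < 1) sequentially"
    by (rule order_tendstoD) simp
  then obtain n0 where n0: "\<And>n. n0 \<le> n \<Longrightarrow> M1_dist T (xs n) x < 1"
    unfolding eventually_sequentially by auto
  have "\<bar>xs n t\<bar> \<le> C + 1" if n: "n0 \<le> n" "0 \<le> t" "t \<le> B" for n t
  proof -
    have "0 < T" "t \<le> T" using n T by auto
    then obtain z u where zu: "(z, u) \<in> completed_graph T x" "\<bar>xs n t - z\<bar> < 1"
      by (rule M1_close_graphs[OF x xs _ n0[OF n(1)] n(2)])
    have "\<bar>z\<bar> \<le> norm (z, u)" using norm_fst_le[of z u] by simp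
    then have "\<bar>z\<bar> \<le> C" using C[OF zu(1)] by simp
    then show ?thesis using zu(2) by auto
  qed
  then show thesis by (rule that)
qed



section \<open>A continuous functional for the $M_1$ topology\<close>

text \<open>
  By right-continuity, \<open>L \<omega> s\<close> is the limit of the values of \<open>L \<omega>\<close> at the first point of the grid
  \<open>{i/n}\<close> to the right of \<open>s\<close>, which are jointly measurable in \<open>\<omega>\<close> and \<open>s\<close>.
\<close>

lemma cadlag_jointly_measurable:
  assumes meas: "\<And>t. 0 \<le> t \<Longrightarrow> (\<lambda>\<omega>. L \<omega> t) \<in> borel_measurable N"
    and cad: "\<And>\<omega>. \<omega> \<in> space N \<Longrightarrow> L \<omega> \<in> cadlag"
  shows "(\<lambda>p. indicator {0..} (snd p) * L (fst p) (snd p)) \<in> borel_measurable (N \<Otimes>\<^sub>M (borel :: real measure))"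
proof (rule borel_measurable_LIMSEQ_real)
  let ?g = "\<lambda>(i::int) k. (real_of_int (max 0 i) + 1) / real (Suc k)"
  let ?f = "\<lambda>k p. indicator {0..} (snd p) * L (fst p) (?g \<lfloor>real (Suc k) * snd p\<rfloor> k)"
  show "(\<lambda>k. ?f k p) \<longlonglongrightarrow> indicator {0..} (snd p) * L (fst p) (snd p)"
    if p: "p \<in> space (N \<Otimes>\<^sub>M borel)" for p
  proof (cases "0 \<le> snd p")
    case True
    define s where "s = snd p"
    have s: "0 \<le> s" using True unfolding s_def .
    have pos: "max 0 \<lfloor>real (Suc k) * s\<rfloor> = \<lfloor>real (Suc k) * s\<rfloor>" for k
      using s by (auto simp: max_def zero_le_mult_iff)
    have gt: "s < ?g \<lfloor>real (Suc k) * s\<rfloor> k" for k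
    proof -
      have "real (Suc k) * s < real_of_int \<lfloor>real (Suc k) * s\<rfloor> + 1" by linarith
      then show ?thesis unfolding pos by (simp add: pos_less_divide_eq mult.commute)
    qed
    have le: "?g \<lfloor>real (Suc k) * s\<rfloor> k \<le> s + 1 / real (Suc k)" for k
    proof -
      have "real_of_int \<lfloor>real (Suc k) * s\<rfloor> + 1 \<le> real (Suc k) * s + 1" by linarith
      then have "?g \<lfloor>real (Suc k) * s\<rfloor> k \<le> (real (Suc k) * s + 1) / real (Suc k)" 
        unfolding pos by (rule divide_right_mono) simp
      then show ?thesis by (simp add: add_divide_distrib)
    qed
    have "(\<lambda>k. s + 1 / real (Suc k)) \<longlonglongrightarrow> s + 0"
      by (rule tendsto_add[OF tendsto_const LIMSEQ_Suc[OF lim_1_over_n]])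
    then have "(\<lambda>k. ?g \<lfloor>real (Suc k) * s\<rfloor> k) \<longlonglongrightarrow> s"
      using real_tendsto_sandwich[OF always_eventually[OF allI[OF less_imp_le[OF gt]]] always_eventually[OF allI[OF le]] tendsto_const]
      by simp
    then have g: "filterlim (\<lambda>k. ?g \<lfloor>real (Suc k) * s\<rfloor> k) (at_right s) sequentially"
      by (rule tendsto_imp_filterlim_at_right) (rule always_eventually, rule allI, rule gt)
    have l: "(L (fst p) \<longlongrightarrow> L (fst p) s) (at_right s)"
      using p by (intro cadlag_right cad s) (auto simp: space_pair_measure)
    show ?thesis unfolding s_def[symmetric]
      by (rule tendsto_mult[OF tendsto_const filterlim_compose[OF l g]])
  qed simp
  show "?f k \<in> borel_measurable (N \<Otimes>\<^sub>M borel)" for k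
  proof (rule measurable_compose_countable[where f = "\<lambda>i p. indicator {0..} (snd p) * L (fst p) (?g i k)"
        and g = "\<lambda>p. \<lfloor>real (Suc k) * snd p\<rfloor>"])
    fix i :: int
    have l: "(\<lambda>p. L (fst p) (?g i k)) \<in> borel_measurable (N \<Otimes>\<^sub>M (borel :: real measure))"
      by (rule measurable_compose[OF measurable_fst meas]) simp
    have i: "(\<lambda>p. indicator {0..} (snd p) :: real) \<in> borel_measurable (N \<Otimes>\<^sub>M (borel :: real measure))"
      by (rule measurable_compose[OF measurable_snd borel_measurable_indicator]) simp
    show "(\<lambda>p. indicator {0..} (snd p) * L (fst p) (?g i k)) \<in> borel_measurable (N \<Otimes>\<^sub>M (borel :: real measure))"
      by (rule borel_measurable_times[OF i l])
  next
    have "(\<lambda>p. real (Suc k) * snd p) \<in> borel_measurable (N \<Otimes>\<^sub>M (borel :: real measure))"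
      by (intro borel_measurable_times borel_measurable_const measurable_snd)
    then show "(\<lambda>p. \<lfloor>real (Suc k) * snd p\<rfloor>) \<in> N \<Otimes>\<^sub>M borel \<rightarrow>\<^sub>M count_space UNIV"
      by (rule measurable_compose[OF _ measurable_real_floor])
  qed
qed

lemma cadlag_measurable:
  assumes "x \<in> cadlag"
  shows "(\<lambda>s. indicator {0..} s * x s) \<in> borel_measurable (borel :: real measure)"
proof -
  define f where "f = (\<lambda>p :: unit \<times> real. indicator {0..} (snd p) * x (snd p))"
  have f: "f \<in> borel_measurable (count_space UNIV \<Otimes>\<^sub>M borel)" unfolding f_def
    by (rule cadlag_jointly_measurable[of "\<lambda>_. x" "count_space (UNIV :: unit set)"]) (simp_all add: assms)
  have "(\<lambda>s. ((), s)) \<in> borel \<rightarrow>\<^sub>M count_space (UNIV :: unit set) \<Otimes>\<^sub>M (borel :: real measure)"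
    by (intro measurable_Pair measurable_const measurable_ident_sets) simp_all
  from measurable_compose[OF this f] show ?thesis unfolding f_def by (simp only: snd_conv)
qed

text \<open>
  The increment of lag 1 ignores the initial piece of the path before time 1 and cancels linear drifts
  up to a constant; the average over a window replaces the evaluation at single times, which is not
  continuous for \<open>M\<^sub>1\<close>.
\<close>

definition mean_increment :: "real \<Rightarrow> (real \<Rightarrow> real) \<Rightarrow> real" where
  "mean_increment h x = (LINT s:{1..1 + h}|lborel. x (s + 1) - x s)"

lemma cadlag_increment_measurable:
  fixes z :: "real \<Rightarrow> real"
  assumes z: "z \<in> cadlag"
  shows "(\<lambda>s. indicator {1..1 + h} s *\<^sub>R (z (s + 1) - z s)) \<in> borel_measurable lborel"
proof -
  have ind: "indicator {1..1 + h} s *\<^sub>R (z (s + 1) - z s) =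
      indicator {1..1 + h} s * (indicator {0..} (s + 1) * z (s + 1) - indicator {0..} s * z s)" for s
    by (auto simp: indicator_def)
  have [measurable]: "(\<lambda>s. indicator {0..} s * z s) \<in> borel_measurable borel" by (rule cadlag_measurable[OF z])
  have "(\<lambda>s. s + 1 :: real) \<in> borel_measurable borel" by measurable
  from measurable_compose[OF this cadlag_measurable[OF z]]
  have [measurable]: "(\<lambda>s. indicator {0..} (s + 1) * z (s + 1)) \<in> borel_measurable borel" .
  show ?thesis unfolding ind by measurable
qed

text \<open>
  Dominated convergence: the paths converge at all but countably many times and are uniformly bounded.
\<close>

lemma mean_increment_M1_sequentially:
  assumes x: "x \<in> cadlag" and xs: "\<And>n. xs n \<in> cadlag" and conv: "M1_converges xs x" and h: "0 \<le> h"
  shows "(\<lambda>n. mean_increment h (xs n)) \<longlonglongrightarrow> mean_increment h x"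
proof -
  let ?J = "{t. 0 < t \<and> left_lim x t \<noteq> x t}"
  have "0 \<le> 2 + h" using h by simp
  then obtain C n0 where C: "\<And>n t. n0 \<le> n \<Longrightarrow> 0 \<le> t \<Longrightarrow> t \<le> 2 + h \<Longrightarrow> \<bar>xs n t\<bar> \<le> C"
    by (rule M1_converges_bounded[OF x xs conv]) blast
  note m = cadlag_increment_measurable
  have "(\<lambda>n. mean_increment h (xs (n + n0))) \<longlonglongrightarrow> mean_increment h x"
    unfolding mean_increment_def set_lebesgue_integral_def
  proof (rule integral_dominated_convergence[OF m[OF x] m[OF xs], where w = "\<lambda>s. indicator {1..1 + h} s * (2 * C)"])
    show "integrable lborel (\<lambda>s. indicator {1..1 + h} s * (2 * C))"
      by (intro integrable_mult_left integrable_real_indicator) (auto simp: h)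
    have J: "countable ?J" by (rule cadlag_countable_jumps[OF x])
    then have "countable (?J \<union> (\<lambda>t. t - 1) ` ?J)" by simp
    then have "?J \<union> (\<lambda>t. t - 1) ` ?J \<in> null_sets lborel" by (rule countable_imp_null_set_lborel)
    then have "AE s in lborel. s \<notin> ?J \<union> (\<lambda>t. t - 1) ` ?J" by (rule AE_not_in)
    then show "AE s in lborel. (\<lambda>n. indicator {1..1 + h} s *\<^sub>R (xs (n + n0) (s + 1) - xs (n + n0) s)) \<longlonglongrightarrow>
        indicator {1..1 + h} s *\<^sub>R (x (s + 1) - x s)"
    proof eventually_elim
      case (elim s)
      show ?case
      proof (cases "s \<in> {1..1 + h}")
        case True
        have "s + 1 \<notin> ?J" using elim by (force simp: image_iff)
        then have "isCont x s" "isCont x (s + 1)" using elim True by (simp_all add: cadlag_isCont[OF x])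
        then have "(\<lambda>n. xs n (s + 1) - xs n s) \<longlonglongrightarrow> x (s + 1) - x s"
          using True by (intro tendsto_diff M1_converges_pointwise[OF x xs conv]) auto
        then have "(\<lambda>n. xs (n + n0) (s + 1) - xs (n + n0) s) \<longlonglongrightarrow> x (s + 1) - x s"
          by (rule LIMSEQ_ignore_initial_segment[where f = "\<lambda>n. xs n (s + 1) - xs n s" and k = n0])
        then show ?thesis by (rule tendsto_scaleR[OF tendsto_const])
      qed simp
    qed
    show "AE s in lborel. norm (indicator {1..1 + h} s *\<^sub>R (xs (n + n0) (s + 1) - xs (n + n0) s)) \<le> indicator {1..1 + h} s * (2 * C)" for n
    proof (rule AE_I2)
      fix s :: real
      show "norm (indicator {1..1 + h} s *\<^sub>R (xs (n + n0) (s + 1) - xs (n + n0) s)) \<le> indicator {1..1 + h} s * (2 * C)"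
      proof (cases "s \<in> {1..1 + h}")
        case True
        then show ?thesis using C[of "n + n0" s] C[of "n + n0" "s + 1"] by auto
      qed simp
    qed
  qed
  then show ?thesis by (rule LIMSEQ_offset[where f = "\<lambda>n. mean_increment h (xs n)" and k = n0])
qed

lemma continuous_map_M1_mean_increment:
  assumes h: "0 \<le> h" and \<phi>: "continuous_on UNIV \<phi>"
  shows "continuous_map M1_topology euclideanreal (\<lambda>x. \<phi> (mean_increment h x))"
  unfolding continuous_map_def topspace_M1_topology openin_M1_topology
proof (intro conjI allI impI)
  show "(\<lambda>x. \<phi> (mean_increment h x)) \<in> cadlag \<rightarrow> topspace euclideanreal" by simp
  fix V :: "real set" assume "openin euclideanreal V"
  then have V: "open V" by simp
  show "M1_open {x \<in> cadlag. \<phi> (mean_increment h x) \<in> V}"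
    unfolding M1_open_def
  proof (intro conjI ballI allI impI)
    fix x xs assume x: "x \<in> {x \<in> cadlag. \<phi> (mean_increment h x) \<in> V}" "range xs \<subseteq> cadlag" "M1_converges xs x"
    then have xs: "\<And>n. xs n \<in> cadlag" by auto
    have "(\<lambda>n. mean_increment h (xs n)) \<longlonglongrightarrow> mean_increment h x"
      by (rule mean_increment_M1_sequentially) (use x xs h in auto)
    then have "(\<lambda>n. \<phi> (mean_increment h (xs n))) \<longlonglongrightarrow> \<phi> (mean_increment h x)"
      by (intro continuous_on_tendsto_compose[OF \<phi>]) auto
    then have "eventually (\<lambda>n. \<phi> (mean_increment h (xs n)) \<in> V) sequentially"
      using x V by (intro topological_tendstoD) auto
    then show "\<forall>\<^sub>F n in sequentially. xs n \<in> {x \<in> cadlag. \<phi> (mean_increment h x) \<in> V}"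
      by eventually_elim (use xs in auto)
  qed auto
qed

section \<open>Spread of the functional under a stable limit\<close>

lemma cadlag_time_scale:
  assumes x: "x \<in> cadlag" and c: "0 < c"
  shows "(\<lambda>t. x (t / c)) \<in> cadlag"
proof -
  have r: "((\<lambda>t. x (t / c)) \<longlongrightarrow> x (t / c)) (at_right t)" if "0 \<le> t" for t
  proof -
    have l: "(x \<longlongrightarrow> x (t / c)) (at_right (t / c))" using that c by (intro cadlag_right[OF x]) auto
    have "((\<lambda>s. s / c) \<longlongrightarrow> t / c) (at_right t)" by (intro tendsto_intros) (use c in auto)
    moreover have "eventually (\<lambda>s. t / c < s / c) (at_right t)"
      using eventually_at_right_less[of t] by eventually_elim (use c in \<open>simp add: divide_strict_right_mono\<close>)
    ultimately have g: "filterlim (\<lambda>s. s / c) (at_right (t / c)) (at_right t)"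
      by (rule tendsto_imp_filterlim_at_right)
    show ?thesis by (rule filterlim_compose[OF l g])
  qed
  have "\<exists>l. ((\<lambda>t. x (t / c)) \<longlongrightarrow> l) (at_left t)" if "0 < t" for t
  proof -
    have l: "(x \<longlongrightarrow> left_lim x (t / c)) (at_left (t / c))" using that c by (intro cadlag_left[OF x]) auto
    have "((\<lambda>s. s / c) \<longlongrightarrow> t / c) (at_left t)" by (intro tendsto_intros) (use c in auto)
    moreover have "eventually (\<lambda>s. s < t) (at_left t)"
      by (simp add: eventually_at_filter)
    then have "eventually (\<lambda>s. s / c < t / c) (at_left t)"
      by eventually_elim (use c in \<open>simp add: divide_strict_right_mono\<close>)
    ultimately have g: "filterlim (\<lambda>s. s / c) (at_left (t / c)) (at_left t)"
      by (rule tendsto_imp_filterlim_at_left)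
    show ?thesis using filterlim_compose[OF l g] by blast
  qed
  with r show ?thesis unfolding cadlag_def continuous_within by auto
qed

lemma mean_increment_limit:
  assumes x: "x \<in> cadlag"
  shows "(\<lambda>n. real (Suc n) * mean_increment (1 / real (Suc n)) x) \<longlonglongrightarrow> x 2 - x 1"
proof (rule LIMSEQ_I)
  fix e :: real assume e: "0 < e"
  define D where "D = x 2 - x 1"
  have e4: "0 < e / 4" using e by simp
  obtain d1 where d1: "0 < d1" "\<And>u. 1 < u \<Longrightarrow> u < 1 + d1 \<Longrightarrow> \<bar>x u - x 1\<bar> \<le> e / 4"
    by (rule cadlag_near_right[OF x zero_le_one e4]) blast
  obtain d2 where d2: "0 < d2" "\<And>u. 2 < u \<Longrightarrow> u < 2 + d2 \<Longrightarrow> \<bar>x u - x 2\<bar> \<le> e / 4"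
    by (rule cadlag_near_right[OF x zero_le_numeral e4]) blast
  obtain n0 where n0: "inverse (real (Suc n0)) < min d1 d2"
    using reals_Archimedean[of "min d1 d2"] d1(1) d2(1) by auto
  have "norm (real (Suc n) * mean_increment (1 / real (Suc n)) x - D) < e" if n: "n0 \<le> n" for n
  proof -
    define h where "h = 1 / real (Suc n)"
    have "h \<le> inverse (real (Suc n0))" using n unfolding h_def by (simp add: divide_simps)
    then have h: "0 < h" "h < d1" "h < d2" using n0 unfolding h_def by auto
    let ?f = "\<lambda>s. indicator {1..1 + h} s *\<^sub>R (x (s + 1) - x s)"
    have bd: "\<bar>x (s + 1) - x s - D\<bar> \<le> e / 2" if "s \<in> {1..1 + h}" for s
    proof (cases "s = 1")
      case True
      then show ?thesis using e unfolding D_def by simp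
    next
      case False
      have "\<bar>x s - x 1\<bar> \<le> e / 4" using that h False by (intro d1(2)) auto
      moreover have "\<bar>x (s + 1) - x 2\<bar> \<le> e / 4" using that h False by (intro d2(2)) auto
      ultimately show ?thesis unfolding D_def by linarith
    qed
    have ind: "integrable lborel (\<lambda>s. indicator {1..1 + h} s * C)" for C :: real
      by (intro integrable_mult_left integrable_real_indicator) (use h in auto)
    have lI: "(\<integral>s. indicator {1..1 + h} s * C \<partial>lborel) = h * C" for C :: real
      using h by simp
    have int: "integrable lborel ?f"
    proof (rule Bochner_Integration.integrable_bound[OF ind[of "\<bar>D\<bar> + e / 2"]])
      show "AE s in lborel. norm (?f s) \<le> norm (indicator {1..1 + h} s * (\<bar>D\<bar> + e / 2))"
      proof (rule AE_I2)
        fix s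
        show "norm (?f s) \<le> norm (indicator {1..1 + h} s * (\<bar>D\<bar> + e / 2))"
        proof (cases "s \<in> {1..1 + h}")
          case True
          have "\<bar>x (s + 1) - x s\<bar> \<le> \<bar>D\<bar> + e / 2" using bd[OF True] by linarith
          then show ?thesis using True by simp
        qed simp
      qed
    qed (rule cadlag_increment_measurable[OF x])
    have "norm (\<integral>s. ?f s - indicator {1..1 + h} s * D \<partial>lborel) \<le> (\<integral>s. indicator {1..1 + h} s * (e / 2) \<partial>lborel)"
    proof (rule Bochner_Integration.integral_norm_bound_integral[OF Bochner_Integration.integrable_diff[OF int ind] ind])
      fix s
      show "norm (?f s - indicator {1..1 + h} s * D) \<le> indicator {1..1 + h} s * (e / 2)"
        using bd[of s] by (cases "s \<in> {1..1 + h}") auto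
    qed
    also have "(\<integral>s. ?f s - indicator {1..1 + h} s * D \<partial>lborel) = mean_increment h x - h * D"
      unfolding mean_increment_def set_lebesgue_integral_def using int ind[of D] lI[of D]
      by (subst Bochner_Integration.integral_diff) auto
    finally have "\<bar>mean_increment h x - h * D\<bar> \<le> h * (e / 2)" unfolding lI by simp
    then have "real (Suc n) * \<bar>mean_increment h x - h * D\<bar> \<le> real (Suc n) * (h * (e / 2))"
      by (intro mult_left_mono) auto
    also have "real (Suc n) * (h * (e / 2)) = e / 2" unfolding h_def by (simp del: of_nat_Suc)
    also have "real (Suc n) * \<bar>mean_increment h x - h * D\<bar> = \<bar>real (Suc n) * (mean_increment h x - h * D)\<bar>"
      by (simp add: abs_mult)
    also have "real (Suc n) * (mean_increment h x - h * D) = real (Suc n) * mean_increment h x - D"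
      unfolding h_def by (simp add: right_diff_distrib del: of_nat_Suc)
    finally show ?thesis using e unfolding h_def by (simp del: of_nat_Suc)
  qed
  then show "\<exists>n0. \<forall>n\<ge>n0. norm (real (Suc n) * mean_increment (1 / real (Suc n)) x - (x 2 - x 1)) < e"
    unfolding D_def by blast
qed

text \<open>
  Otherwise the infimum of the levels \<open>u\<close> below which \<open>Y\<close> has positive mass would be an almost sure
  value of \<open>Y\<close>.
\<close>

lemma (in prob_space) nondegenerate_two_sided:
  fixes Y :: "'a \<Rightarrow> real"
  assumes Y[measurable]: "Y \<in> borel_measurable M" and nd: "\<not> (\<exists>a. AE \<omega> in M. Y \<omega> = a)"
  obtains u v where "u < v" "0 < prob {\<omega> \<in> space M. Y \<omega> \<le> u}" "0 < prob {\<omega> \<in> space M. v \<le> Y \<omega>}"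
proof (rule ccontr)
  assume "\<not> thesis"
  then have nt: "\<not> thesis" .
  note found = that
  have neg: "prob {\<omega> \<in> space M. Y \<omega> \<le> u} = 0 \<or> prob {\<omega> \<in> space M. v \<le> Y \<omega>} = 0" if lt: "u < v" for u v
  proof (rule ccontr)
    assume "\<not> ?thesis"
    then have "0 < prob {\<omega> \<in> space M. Y \<omega> \<le> u}" "0 < prob {\<omega> \<in> space M. v \<le> Y \<omega>}"
      by (auto simp: zero_less_measure_iff)
    from found[OF lt this] nt show False by blast
  qed
  have AE0: "AE \<omega> in M. \<not> P \<omega>" if "prob {\<omega> \<in> space M. P \<omega>} = 0" "Measurable.pred M P" for P
    using that prob_eq_0[of "{\<omega> \<in> space M. P \<omega>}"] by auto
  define S where "S = {u. 0 < prob {\<omega> \<in> space M. Y \<omega> \<le> u}}"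
  have "S \<noteq> {}"
  proof
    assume "S = {}"
    then have "prob {\<omega> \<in> space M. Y \<omega> \<le> real n} = 0" for n
      unfolding S_def using zero_less_measure_iff by blast
    then have "AE \<omega> in M. \<forall>n::nat. \<not> Y \<omega> \<le> real n" unfolding AE_all_countable by (intro allI AE0) measurable
    then have "AE \<omega> in M. False" proof eventually_elim
      case (elim \<omega>)
      obtain n where "Y \<omega> \<le> real n" using real_arch_simple by blast
      with elim show ?case by blast
    qed
    then show False by simp
  qed
  have "bdd_below S"
  proof (rule ccontr)
    assume "\<not> bdd_below S"
    have "prob {\<omega> \<in> space M. - real n \<le> Y \<omega>} = 0" for n
    proof -
      obtain u where u: "u \<in> S" "u < - real n"
        using \<open>\<not> bdd_below S\<close> unfolding bdd_below_def by (meson not_le)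
      have "prob {\<omega> \<in> space M. Y \<omega> \<le> u} \<noteq> 0" using u(1) unfolding S_def by simp
      with neg[OF u(2)] show ?thesis by blast
    qed
    then have "AE \<omega> in M. \<forall>n::nat. \<not> - real n \<le> Y \<omega>" unfolding AE_all_countable by (intro allI AE0) measurable
    then have "AE \<omega> in M. False"
    proof eventually_elim
      case (elim \<omega>)
      obtain n where "- Y \<omega> \<le> real n" using real_arch_simple by blast
      then have "- real n \<le> Y \<omega>" by linarith
      with elim show ?case by blast
    qed
    then show False by simp
  qed
  define a where "a = Inf S"
  have "AE \<omega> in M. \<forall>n::nat. \<not> a + 1 / real (Suc n) \<le> Y \<omega>"
    unfolding AE_all_countable
  proof (intro allI AE0)
    fix n
    have "Inf S < a + 1 / real (Suc n)" unfolding a_def by simp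
    then obtain u where u: "u \<in> S" "u < a + 1 / real (Suc n)" using cInf_lessD[OF \<open>S \<noteq> {}\<close>] by metis
    have "prob {\<omega> \<in> space M. Y \<omega> \<le> u} \<noteq> 0" using u(1) unfolding S_def by simp
    with neg[OF u(2)] show "prob {\<omega> \<in> space M. a + 1 / real (Suc n) \<le> Y \<omega>} = 0" by blast
  qed measurable
  moreover have "AE \<omega> in M. \<forall>n::nat. \<not> Y \<omega> \<le> a - 1 / real (Suc n)"
    unfolding AE_all_countable
  proof (intro allI AE0)
    fix n
    have "a - 1 / real (Suc n) \<notin> S"
    proof
      assume "a - 1 / real (Suc n) \<in> S"
      then have "a \<le> a - 1 / real (Suc n)" unfolding a_def by (intro cInf_lower \<open>bdd_below S\<close>)
      then show False by (simp del: of_nat_Suc)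
    qed
    then show "prob {\<omega> \<in> space M. Y \<omega> \<le> a - 1 / real (Suc n)} = 0"
      unfolding S_def mem_Collect_eq zero_less_measure_iff by simp
  qed measurable
  ultimately have "AE \<omega> in M. Y \<omega> = a"
  proof eventually_elim
    case (elim \<omega>)
    have "Y \<omega> \<le> a"
    proof (rule ccontr)
      assume "\<not> ?thesis"
      then obtain n where "inverse (real (Suc n)) < Y \<omega> - a" using reals_Archimedean[of "Y \<omega> - a"] by auto
      with elim(1)[rule_format, of n] show False by (simp add: inverse_eq_divide)
    qed
    moreover have "a \<le> Y \<omega>"
    proof (rule ccontr)
      assume "\<not> ?thesis"
      then obtain n where "inverse (real (Suc n)) < a - Y \<omega>" using reals_Archimedean[of "a - Y \<omega>"] by auto
      with elim(2)[rule_format, of n] show False by (simp add: inverse_eq_divide)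
    qed
    ultimately show ?case by simp
  qed
  with nd show False by blast
qed

text \<open>
  Over short windows the averaged increment approximates the increment between times 1 and 2. If it
  were constant for every window length, that increment, and by stationarity and stability also the
  value at time 1, would be constant.
\<close>

lemma stable_mean_increment_nondegenerate:
  assumes st: "stable_levy_process \<beta> N L" and E: "0 < E"
  obtains h where "0 < h" "h \<le> 1" "(\<lambda>\<omega>. mean_increment h (\<lambda>t. L \<omega> (t / E))) \<in> borel_measurable N"
    "\<not> (\<exists>a. AE \<omega> in N. mean_increment h (\<lambda>t. L \<omega> (t / E)) = a)"
proof -
  define x where "x \<omega> t = L \<omega> (t / E)" for \<omega> t
  have lev: "levy_process N L" and nd: "\<not> (\<exists>a. AE \<omega> in N. L \<omega> 1 = a)"
    and scale: "\<And>c. 0 < c \<Longrightarrow> \<exists>d. distr N borel (\<lambda>\<omega>. L \<omega> c) = distr N borel (\<lambda>\<omega>. c powr (1 / \<beta>) * L \<omega> 1 + d)"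
    using st unfolding stable_levy_process_def by auto
  interpret N: prob_space N using lev unfolding levy_process_def by simp
  have meas[measurable]: "(\<lambda>\<omega>. L \<omega> t) \<in> borel_measurable N" if "0 \<le> t" for t
    using lev that unfolding levy_process_def by simp
  have cad: "x \<omega> \<in> cadlag" if "\<omega> \<in> space N" for \<omega>
    using lev that cadlag_time_scale[OF _ E] unfolding levy_process_def x_def by auto
  have xm: "(\<lambda>\<omega>. x \<omega> t) \<in> borel_measurable N" if "0 \<le> t" for t
    unfolding x_def using that E by (intro meas) simp
  have j: "(\<lambda>p. indicator {0..} (snd p) * x (fst p) (snd p)) \<in> borel_measurable (N \<Otimes>\<^sub>M (borel :: real measure))"
    by (rule cadlag_jointly_measurable) (auto intro: xm cad)
  have I[measurable]: "(\<lambda>\<omega>. mean_increment h (x \<omega>)) \<in> borel_measurable N" for h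
  proof -
    let ?g = "\<lambda>p. indicator {1..1 + h} (snd p) * (indicator {0..} (snd p + 1) * x (fst p) (snd p + 1) - indicator {0..} (snd p) * x (fst p) (snd p))"
    have sh: "(\<lambda>p. (fst p, snd p + 1)) \<in> N \<Otimes>\<^sub>M borel \<rightarrow>\<^sub>M N \<Otimes>\<^sub>M (borel :: real measure)"
      by measurable
    have j1: "(\<lambda>p. indicator {0..} (snd p + 1) * x (fst p) (snd p + 1)) \<in> borel_measurable (N \<Otimes>\<^sub>M (borel :: real measure))"
      using measurable_compose[OF sh j] by simp
    have i: "(\<lambda>p. indicator {1..1 + h} (snd p) :: real) \<in> borel_measurable (N \<Otimes>\<^sub>M (borel :: real measure))"
      by (rule measurable_compose[OF measurable_snd borel_measurable_indicator]) simp
    have "?g \<in> borel_measurable (N \<Otimes>\<^sub>M (borel :: real measure))"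
      by (rule borel_measurable_times[OF i borel_measurable_diff[OF j1 j]])
    moreover have "sets (N \<Otimes>\<^sub>M (borel :: real measure)) = sets (N \<Otimes>\<^sub>M lborel)"
      by (intro sets_pair_measure_cong) auto
    ultimately have "?g \<in> borel_measurable (N \<Otimes>\<^sub>M lborel)"
      using measurable_cong_sets by blast
    then have "(\<lambda>\<omega>. \<integral>s. ?g (\<omega>, s) \<partial>lborel) \<in> borel_measurable N"
      by (intro lborel.borel_measurable_lebesgue_integral) (simp add: split_beta')
    moreover have "mean_increment h (x \<omega>) = (\<integral>s. ?g (\<omega>, s) \<partial>lborel)" for \<omega>
      unfolding mean_increment_def set_lebesgue_integral_def
      by (intro Bochner_Integration.integral_cong) (auto simp: indicator_def)
    ultimately show ?thesis by simp
  qed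
  have "\<exists>n. \<not> (\<exists>a. AE \<omega> in N. mean_increment (1 / real (Suc n)) (x \<omega>) = a)"
  proof (rule ccontr)
    assume "\<not> ?thesis"
    then obtain a where a: "\<And>n. AE \<omega> in N. mean_increment (1 / real (Suc n)) (x \<omega>) = a n" by metis
    then have "AE \<omega> in N. \<forall>n. mean_increment (1 / real (Suc n)) (x \<omega>) = a n" unfolding AE_all_countable by blast
    then have "AE \<omega> in N. (\<lambda>n. real (Suc n) * a n) \<longlonglongrightarrow> x \<omega> 2 - x \<omega> 1"
      using AE_space
    proof eventually_elim
      case (elim \<omega>)
      show ?case using mean_increment_limit[OF cad[OF elim(2)]] elim(1) by simp
    qed
    then have "AE \<omega> in N. x \<omega> 2 - x \<omega> 1 = lim (\<lambda>n. real (Suc n) * a n)"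
      by eventually_elim (simp add: limI)
    then obtain b where b: "AE \<omega> in N. L \<omega> (1 / E + 1 / E) - L \<omega> (1 / E) = b"
      unfolding x_def by (auto simp: add_divide_distrib[symmetric])
    define c where "c = 1 / E"
    have c: "0 < c" unfolding c_def using E by simp
    have const_transfer: "AE \<omega> in N. g \<omega> = r" if "distr N borel f = distr N borel g" "AE \<omega> in N. f \<omega> = r"
      and [measurable]: "f \<in> borel_measurable N" "g \<in> borel_measurable N" for f g :: "'a \<Rightarrow> real" and r
    proof -
      have "AE y in distr N borel f. y = r" using that(2) by (subst AE_distr_iff) auto
      then show ?thesis unfolding that(1) by (subst (asm) AE_distr_iff) auto
    qed
    have "distr N borel (\<lambda>\<omega>. L \<omega> (c + c) - L \<omega> c) = distr N borel (\<lambda>\<omega>. L \<omega> c)"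
      using lev c unfolding levy_process_def by (meson less_imp_le)
    then have Lc: "AE \<omega> in N. L \<omega> c = b"
      by (rule const_transfer) (use b c in \<open>auto simp: c_def[symmetric]\<close>)
    obtain d where "distr N borel (\<lambda>\<omega>. L \<omega> c) = distr N borel (\<lambda>\<omega>. c powr (1 / \<beta>) * L \<omega> 1 + d)"
      using scale[OF c] by auto
    then have "AE \<omega> in N. c powr (1 / \<beta>) * L \<omega> 1 + d = b"
      by (rule const_transfer) (use Lc c in auto)
    then have "AE \<omega> in N. L \<omega> 1 = (b - d) / c powr (1 / \<beta>)"
      by eventually_elim (use c in \<open>auto simp: field_simps\<close>)
    with nd show False by blast
  qed
  then obtain n where "\<not> (\<exists>a. AE \<omega> in N. mean_increment (1 / real (Suc n)) (x \<omega>) = a)" by blast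
  then show thesis using I[of "1 / real (Suc n)"] by (intro that[of "1 / real (Suc n)"]) (auto simp: x_def[abs_def])
qed

text \<open>
  Weak convergence in \<open>M\<^sub>1\<close> to a nondegenerate limit keeps the averaged increments away from
  every constant: they have mass bounded below on both sides of a gap.
\<close>

lemma weak_limit_nonconcentration:
  assumes M: "prob_space M" and N: "prob_space N"
    and conv: "weakly_converges_M1 (at_right 0) M X N Y"
    and h: "0 \<le> h"
    and X[measurable]: "\<And>e. 0 < e \<Longrightarrow> (\<lambda>\<omega>. mean_increment h (X e \<omega>)) \<in> borel_measurable M"
    and Y[measurable]: "(\<lambda>\<omega>. mean_increment h (Y \<omega>)) \<in> borel_measurable N"
    and nd: "\<not> (\<exists>a. AE \<omega> in N. mean_increment h (Y \<omega>) = a)"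
  obtains c where "0 < c" "c < 1"
    "\<forall>\<^sub>F e in at_right (0::real). \<forall>r. measure M {\<omega> \<in> space M. \<bar>mean_increment h (X e \<omega>) - r\<bar> \<le> c} \<le> 1 - c"
proof -
  interpret M: prob_space M by (rule M)
  interpret N: prob_space N by (rule N)
  obtain u v where uv: "u < v" "0 < measure N {\<omega> \<in> space N. mean_increment h (Y \<omega>) \<le> u}"
    "0 < measure N {\<omega> \<in> space N. v \<le> mean_increment h (Y \<omega>)}"
    using N.nondegenerate_two_sided[OF Y nd] by blast
  define p where "p = min (measure N {\<omega> \<in> space N. mean_increment h (Y \<omega>) \<le> u}) (measure N {\<omega> \<in> space N. v \<le> mean_increment h (Y \<omega>)})"
  have p: "0 < p" unfolding p_def using uv by simp
  \<comment> \<open>A continuous function between the indicators of \<open>F\<close> and \<open>G\<close> carries mass from the limit to \<open>X e\<close>.\<close>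
  have mass: "\<forall>\<^sub>F e in at_right (0::real). p / 2 < measure M {\<omega> \<in> space M. mean_increment h (X e \<omega>) \<in> G}"
    if \<phi>: "continuous_on UNIV \<phi>" "\<And>x. 0 \<le> \<phi> x" "\<And>x. \<phi> x \<le> 1" "\<And>x. x \<in> F \<Longrightarrow> \<phi> x = 1" "\<And>x. x \<notin> G \<Longrightarrow> \<phi> x = 0"
      and F: "p \<le> measure N {\<omega> \<in> space N. mean_increment h (Y \<omega>) \<in> F}" "F \<in> sets borel" "G \<in> sets borel"
    for \<phi> :: "real \<Rightarrow> real" and F G
  proof -
    have [measurable]: "\<phi> \<in> borel_measurable borel" using \<phi>(1) by (rule borel_measurable_continuous_onI)
    note [measurable] = F(2,3)
    have b: "bounded ((\<lambda>x. \<phi> (mean_increment h x)) ` topspace M1_topology)"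
      unfolding bounded_iff using \<phi>(2,3) by (intro exI[of _ 1]) auto
    have lim: "((\<lambda>e. \<integral>\<omega>. \<phi> (mean_increment h (X e \<omega>)) \<partial>M) \<longlongrightarrow> (\<integral>\<omega>. \<phi> (mean_increment h (Y \<omega>)) \<partial>N)) (at_right 0)"
      by (rule conv[unfolded weakly_converges_M1_def, rule_format, OF continuous_map_M1_mean_increment[OF h \<phi>(1)] b])
    have "p \<le> (\<integral>\<omega>. indicator {\<omega> \<in> space N. mean_increment h (Y \<omega>) \<in> F} \<omega> \<partial>N)"
      using F(1) by simp
    also have "\<dots> \<le> (\<integral>\<omega>. \<phi> (mean_increment h (Y \<omega>)) \<partial>N)"
    proof (rule integral_mono)
      show "integrable N (\<lambda>\<omega>. \<phi> (mean_increment h (Y \<omega>)))"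
        by (rule N.integrable_const_bound[where B = 1]) (use \<phi>(2,3) in auto)
      show "indicator {\<omega> \<in> space N. mean_increment h (Y \<omega>) \<in> F} \<omega> \<le> \<phi> (mean_increment h (Y \<omega>))" for \<omega>
        using \<phi>(2,4) by (auto simp: indicator_def)
    qed (rule integrable_real_indicator, auto simp: less_top[symmetric])
    finally have "p / 2 < (\<integral>\<omega>. \<phi> (mean_increment h (Y \<omega>)) \<partial>N)" using p by simp
    from order_tendstoD(1)[OF lim this]
    have "\<forall>\<^sub>F e in at_right 0. p / 2 < (\<integral>\<omega>. \<phi> (mean_increment h (X e \<omega>)) \<partial>M)" .
    moreover have "\<forall>\<^sub>F e in at_right (0::real). 0 < e" by (rule eventually_at_right_less)
    ultimately show ?thesis
    proof eventually_elim
      case (elim e)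
      note [measurable] = X[OF elim(2)]
      have "(\<integral>\<omega>. \<phi> (mean_increment h (X e \<omega>)) \<partial>M) \<le> (\<integral>\<omega>. indicator {\<omega> \<in> space M. mean_increment h (X e \<omega>) \<in> G} \<omega> \<partial>M)"
      proof (rule integral_mono)
        show "integrable M (\<lambda>\<omega>. \<phi> (mean_increment h (X e \<omega>)))"
          by (rule M.integrable_const_bound[where B = 1]) (use \<phi>(2,3) in auto)
        show "\<phi> (mean_increment h (X e \<omega>)) \<le> indicator {\<omega> \<in> space M. mean_increment h (X e \<omega>) \<in> G} \<omega>" if "\<omega> \<in> space M" for \<omega>
          using \<phi>(3,5) that by (auto simp: indicator_def)
      qed (rule integrable_real_indicator, auto simp: less_top[symmetric])
      also have "\<dots> = measure M {\<omega> \<in> space M. mean_increment h (X e \<omega>) \<in> G}" by simp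
      finally show ?case using elim by simp
    qed
  qed
  define g where "g = (v - u) / 3"
  have g: "0 < g" unfolding g_def using uv by simp
  have lo: "\<forall>\<^sub>F e in at_right (0::real). p / 2 < measure M {\<omega> \<in> space M. mean_increment h (X e \<omega>) \<in> {..u + g}}"
    by (rule mass[of "\<lambda>x. max 0 (min 1 ((u + g - x) / g))" "{..u}"])
      (intro continuous_intros, use g in \<open>auto simp: p_def field_simps min_def max_def\<close>)
  have hi: "\<forall>\<^sub>F e in at_right (0::real). p / 2 < measure M {\<omega> \<in> space M. mean_increment h (X e \<omega>) \<in> {v - g..}}"
    by (rule mass[of "\<lambda>x. max 0 (min 1 ((x - (v - g)) / g))" "{v..}"])
      (intro continuous_intros, use g in \<open>auto simp: p_def field_simps min_def max_def\<close>)
  define c where "c = min (g / 3) (min (p / 2) (1 / 2))"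
  have c: "0 < c" "c \<le> g / 3" "c \<le> p / 2" "c < 1" unfolding c_def using g p by auto
  have "\<forall>\<^sub>F e in at_right (0::real). 0 < e" by (rule eventually_at_right_less)
  with lo hi have "\<forall>\<^sub>F e in at_right (0::real). \<forall>r. measure M {\<omega> \<in> space M. \<bar>mean_increment h (X e \<omega>) - r\<bar> \<le> c} \<le> 1 - c"
  proof eventually_elim
    case (elim e)
    note [measurable] = X[OF elim(3)]
    show ?case
    proof
      fix r
      have disj: "measure M {\<omega> \<in> space M. \<bar>mean_increment h (X e \<omega>) - r\<bar> \<le> c} \<le> 1 - c"
        if "p / 2 < measure M {\<omega> \<in> space M. mean_increment h (X e \<omega>) \<in> G}" "\<And>x. x \<in> G \<Longrightarrow> \<not> \<bar>x - r\<bar> \<le> c" "G \<in> sets borel" for G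
      proof -
        note [measurable] = that(3)
        have "measure M {\<omega> \<in> space M. \<bar>mean_increment h (X e \<omega>) - r\<bar> \<le> c} \<le> measure M (space M - {\<omega> \<in> space M. mean_increment h (X e \<omega>) \<in> G})"
          by (rule M.finite_measure_mono) (use that(2) in auto)
        also have "\<dots> = 1 - measure M {\<omega> \<in> space M. mean_increment h (X e \<omega>) \<in> G}"
          by (rule M.prob_compl) auto
        finally show ?thesis using that(1) c by linarith
      qed
      have gap: "v - g - (u + g) = g" unfolding g_def by (simp add: field_simps)
      \<comment> \<open>The interval around \<open>r\<close> is too short to bridge the gap, so it misses one of the two masses.\<close>
      show "measure M {\<omega> \<in> space M. \<bar>mean_increment h (X e \<omega>) - r\<bar> \<le> c} \<le> 1 - c"
      proof (cases "r \<le> (u + v) / 2")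
        case True
        show ?thesis by (rule disj[OF elim(2)]) (use True c gap g in auto)
      next
        case False
        show ?thesis by (rule disj[OF elim(1)]) (use False c gap g in auto)
      qed
    qed
  qed
  with c show thesis by (intro that)
qed

section \<open>Lindley's recursion\<close>

primrec lindley :: "real \<Rightarrow> (nat \<Rightarrow> real) \<Rightarrow> nat \<Rightarrow> real" where
  "lindley w x 0 = w"
| "lindley w x (Suc n) = max 0 (lindley w x n + x n)"

text \<open>The area under the path of waiting times of a queue that starts empty, i.e. \<open>Z1\<close> as a function of the increments.\<close>

definition area :: "(nat \<Rightarrow> real) \<Rightarrow> nat \<Rightarrow> real" where
  "area x n = (\<Sum>i = 1..n. lindley 0 x i)"

lemma lindley_nonneg: "0 \<le> w \<Longrightarrow> 0 \<le> lindley w x n"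
  by (cases n) auto

lemma lindley_mono: "w \<le> w' \<Longrightarrow> lindley w x n \<le> lindley w' x n"
  by (induction n) auto

lemma lindley_ge_sum: "w + (\<Sum>i<n. x i) \<le> lindley w x n"
  by (induction n) auto

lemma lindley_eq_sum: "(\<And>i. 1 \<le> i \<Longrightarrow> i \<le> n \<Longrightarrow> 0 < lindley w x i) \<Longrightarrow> lindley w x n = w + (\<Sum>i<n. x i)"
proof (induction n)
  case (Suc n)
  have "lindley w x n = w + (\<Sum>i<n. x i)" using Suc.prems by (intro Suc.IH) auto
  moreover have "0 < lindley w x (Suc n)" by (rule Suc.prems) auto
  ultimately show ?case by (auto simp: max_def split: if_splits)
qed simp

lemma lindley_shift: "lindley w x (t + i) = lindley (lindley w x t) (\<lambda>k. x (t + k)) i"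
  by (induction i) auto

text \<open>
  The recursion started at \<open>w\<close> agrees with the walk until it hits 0, which must happen by step \<open>n\<close>.
  The recursion started at 0 lies below it, so both are 0 at that time and agree from then on.
\<close>

lemma lindley_coalesce:
  assumes w: "0 \<le> w" and hit: "w + (\<Sum>i<n. x i) \<le> 0" and "n \<le> i"
  shows "lindley w x i = lindley 0 x i"
proof -
  have "\<exists>j\<le>n. lindley w x j = 0"
  proof (rule ccontr)
    assume neg: "\<not> ?thesis"
    then have pos: "0 < lindley w x j" if "j \<le> n" for j
      using that lindley_nonneg[OF w, of x j] less_eq_real_def by auto
    then have "lindley w x n = w + (\<Sum>i<n. x i)" by (intro lindley_eq_sum) auto
    then show False using pos[of n] hit by simp
  qed
  then obtain j where j: "j \<le> n" "lindley w x j = 0" by blast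
  have "lindley 0 x j = 0"
    using lindley_mono[OF w, of x j] lindley_nonneg[of 0 x j] j by simp
  then show ?thesis
    using lindley_shift[of w x j "i - j"] lindley_shift[of 0 x j "i - j"] j \<open>n \<le> i\<close> by simp
qed

lemma area_mono: "m \<le> n \<Longrightarrow> area x m \<le> area x n"
  unfolding area_def by (intro sum_mono2) (auto intro: lindley_nonneg)

lemma area_nonneg: "0 \<le> area x n"
  unfolding area_def by (intro sum_nonneg) (auto intro: lindley_nonneg)

lemma area_diff:
  assumes "n \<le> i"
  shows "area x i - area x n = (\<Sum>j = Suc n..i. lindley 0 x j)"
proof -
  have "{1..i} = {1..n} \<union> {Suc n..i}" "{1..n} \<inter> {Suc n..i} = {}" using assms by auto
  then show ?thesis unfolding area_def by (simp add: sum.union_disjoint)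
qed

text \<open>
  Once the queue that carries initial work \<open>w\<close> at time \<open>t\<close> has emptied, it cannot be told from
  the queue that was empty at time \<open>t\<close>.
\<close>

lemma area_block:
  assumes "lindley 0 x t + (\<Sum>i<n. x (t + i)) \<le> 0" and "n \<le> i"
  shows "area x (t + i) - area x (t + n) = area (\<lambda>k. x (t + k)) i - area (\<lambda>k. x (t + k)) n"
proof -
  have "area x (t + i) - area x (t + n) = (\<Sum>j = Suc n + t..i + t. lindley 0 x j)"
    using assms by (subst area_diff) (auto simp: add.commute)
  also have "\<dots> = (\<Sum>j = Suc n..i. lindley 0 x (j + t))" by (rule sum.shift_bounds_cl_nat_ivl)
  also have "\<dots> = (\<Sum>j = Suc n..i. lindley 0 (\<lambda>k. x (t + k)) j)"
  proof (rule sum.cong[OF refl])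
    fix j assume "j \<in> {Suc n..i}"
    then show "lindley 0 x (j + t) = lindley 0 (\<lambda>k. x (t + k)) j"
      using lindley_coalesce[OF lindley_nonneg[OF order_refl] assms(1), of j] lindley_shift[of 0 x t j]
      by (simp add: add.commute)
  qed
  also have "\<dots> = area (\<lambda>k. x (t + k)) i - area (\<lambda>k. x (t + k)) n" using assms by (subst area_diff) auto
  finally show ?thesis .
qed

section \<open>Sequences of independent increments\<close>

abbreviation seq_space :: "(nat \<Rightarrow> real) measure" where
  "seq_space \<equiv> PiM UNIV (\<lambda>_. borel)"

definition iid_sequence :: "'a measure \<Rightarrow> real measure \<Rightarrow> (nat \<Rightarrow> 'a \<Rightarrow> real) \<Rightarrow> bool" where
  "iid_sequence M Q X \<longleftrightarrow> prob_space M \<and> prob_space.indep_vars M (\<lambda>_. borel) X UNIV \<and> (\<forall>i. distr M borel (X i) = Q)"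

lemma iid_measurable: "iid_sequence M Q X \<Longrightarrow> X i \<in> borel_measurable M"
  unfolding iid_sequence_def by (auto simp: prob_space.indep_vars_def)

lemma lindley_measurable [measurable]: "(\<lambda>x. lindley w x n) \<in> borel_measurable seq_space"
  by (induction n) auto

lemma area_measurable [measurable]: "(\<lambda>x. area x n) \<in> borel_measurable seq_space"
  unfolding area_def by measurable

lemma iid_path_measurable:
  assumes "iid_sequence M Q X"
  shows "(\<lambda>\<omega> k. X k \<omega>) \<in> M \<rightarrow>\<^sub>M seq_space"
  by (rule measurable_PiM_single') (auto intro: iid_measurable[OF assms])

lemma iid_path_distr:
  assumes X: "iid_sequence M Q X"
  shows "distr M seq_space (\<lambda>\<omega> k. X k \<omega>) = PiM UNIV (\<lambda>_. Q)"
proof -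
  interpret prob_space M using X unfolding iid_sequence_def by simp
  have "distr M seq_space (\<lambda>\<omega>. \<lambda>i\<in>UNIV. X i \<omega>) = PiM UNIV (\<lambda>i. distr M borel (X i))"
    using X by (subst indep_vars_iff_distr_eq_PiM[symmetric]) (auto simp: iid_sequence_def intro: iid_measurable[OF X])
  then show ?thesis using X unfolding iid_sequence_def by (simp add: restrict_UNIV)
qed

lemma (in prob_space) indep_vars_blocks:
  assumes V: "indep_vars (\<lambda>_. borel :: real measure) V I"
    and K: "\<And>j. j \<in> J \<Longrightarrow> K j \<subseteq> I" "disjoint_family_on K J"
    and f: "\<And>j. j \<in> J \<Longrightarrow> f j \<in> PiM (K j) (\<lambda>_. borel) \<rightarrow>\<^sub>M (borel :: real measure)"
  shows "indep_vars (\<lambda>_. borel) (\<lambda>j \<omega>. f j (\<lambda>i\<in>K j. V i \<omega>)) J"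
  using indep_vars_compose2[OF indep_vars_restrict[OF V K], of f "\<lambda>_. borel"] f by auto

lemma (in prob_space) indep_vars_reindex:
  assumes V: "indep_vars (\<lambda>_. borel :: real measure) V I" and e: "inj_on e J" "e ` J \<subseteq> I"
  shows "indep_vars (\<lambda>_. borel) (\<lambda>k. V (e k)) J"
proof -
  have "indep_vars (\<lambda>_. borel) (\<lambda>j \<omega>. (\<lambda>x. x (e j)) (\<lambda>i\<in>{e j}. V i \<omega>)) J"
    by (rule indep_vars_blocks[OF V]) (use e in \<open>auto simp: disjoint_family_on_def inj_on_def\<close>)
  then show ?thesis by simp
qed

lemma iid_shift:
  assumes X: "iid_sequence M Q X"
  shows "iid_sequence M Q (\<lambda>k. X (t + k))"
proof -
  interpret prob_space M using X unfolding iid_sequence_def by simp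
  have "indep_vars (\<lambda>_. borel) (\<lambda>k. X (t + k)) UNIV"
    using X by (intro indep_vars_reindex[of X UNIV "\<lambda>k. t + k"]) (auto simp: iid_sequence_def)
  then show ?thesis using X unfolding iid_sequence_def by auto
qed

lemma iid_map:
  assumes X: "iid_sequence M Q X" and f[measurable]: "f \<in> borel_measurable borel"
  shows "iid_sequence M (distr Q borel f) (\<lambda>k \<omega>. f (X k \<omega>))"
proof -
  interpret prob_space M using X unfolding iid_sequence_def by simp
  have "indep_vars (\<lambda>_. borel) (\<lambda>k \<omega>. f (X k \<omega>)) UNIV"
    using X by (intro indep_vars_compose2[of "\<lambda>_. borel" X UNIV "\<lambda>_. f"]) (auto simp: iid_sequence_def)
  moreover have "distr M borel (\<lambda>\<omega>. f (X k \<omega>)) = distr Q borel f" for k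
  proof -
    have "distr (distr M borel (X k)) borel f = distr M borel (f \<circ> X k)"
      by (rule distr_distr) (auto intro: iid_measurable[OF X])
    then show ?thesis using X unfolding iid_sequence_def comp_def by simp
  qed
  ultimately show ?thesis using X unfolding iid_sequence_def by auto
qed

lemma iid_integrable:
  assumes X: "iid_sequence M Q X" and f: "f \<in> borel_measurable borel"
  shows "integrable M (\<lambda>\<omega>. f (X k \<omega>) :: real) \<longleftrightarrow> integrable Q f" "(\<integral>\<omega>. f (X k \<omega>) \<partial>M) = (\<integral>x. f x \<partial>Q)"
proof -
  have Q: "Q = distr M borel (X k)" using X unfolding iid_sequence_def by simp
  show "integrable M (\<lambda>\<omega>. f (X k \<omega>) :: real) \<longleftrightarrow> integrable Q f"
    unfolding Q by (rule integrable_distr_eq[symmetric]) (use f iid_measurable[OF X] in auto)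
  show "(\<integral>\<omega>. f (X k \<omega>) \<partial>M) = (\<integral>x. f x \<partial>Q)"
    unfolding Q by (rule integral_distr[symmetric]) (use f iid_measurable[OF X] in auto)
qed

lemma iid_same_law:
  assumes X: "iid_sequence M Q X" and Y: "iid_sequence M' Q Y"
    and P: "Measurable.pred seq_space P"
  shows "measure M {\<omega> \<in> space M. P (\<lambda>k. X k \<omega>)} = measure M' {\<omega> \<in> space M'. P (\<lambda>k. Y k \<omega>)}"
proof -
  have sets_Collect_pred: "{x \<in> space seq_space. P x} \<in> sets seq_space" using P unfolding pred_def .
  have 1: "measure M {\<omega> \<in> space M. P (\<lambda>k. X k \<omega>)} = measure (PiM UNIV (\<lambda>_. Q)) {x \<in> space seq_space. P x}"
    if X: "iid_sequence M Q X" for M :: "'c measure" and X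
    unfolding iid_path_distr[OF X, symmetric] using sets_Collect_pred
    by (subst measure_distr[OF iid_path_measurable[OF X]])
      (auto intro!: arg_cong[where f = "measure M"] simp: space_PiM)
  show ?thesis unfolding 1[OF X] 1[OF Y] ..
qed

lemma iid_same_integral:
  assumes X: "iid_sequence M Q X" and Y: "iid_sequence M' Q Y" and f: "f \<in> borel_measurable seq_space"
  shows "(\<integral>\<omega>. f (\<lambda>k. X k \<omega>) \<partial>M) = (\<integral>\<omega>. f (\<lambda>k. Y k \<omega>) \<partial>M' :: real)"
proof -
  have 1: "(\<integral>\<omega>. f (\<lambda>k. X k \<omega>) \<partial>M) = (\<integral>x. f x \<partial>PiM UNIV (\<lambda>_. Q))"
    if X: "iid_sequence M Q X" for M :: "'c measure" and X
    unfolding iid_path_distr[OF X, symmetric] using f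
    by (rule integral_distr[OF iid_path_measurable[OF X], symmetric])
  show ?thesis unfolding 1[OF X] 1[OF Y] ..
qed

section \<open>Conditioning on the past\<close>

text \<open>
  The \<open>\<sigma>\<close>-algebra generated by the variables \<open>V i\<close> with \<open>i \<in> J\<close>, as a measure space on the sample space
  of \<open>M\<close>, so that the conditioning can be expressed by \<open>measurable\<close>.
\<close>

definition past :: "'a measure \<Rightarrow> ('i \<Rightarrow> 'a \<Rightarrow> real) \<Rightarrow> 'i set \<Rightarrow> 'a measure" where
  "past M V J = vimage_algebra (space M) (\<lambda>\<omega>. \<lambda>i\<in>J. V i \<omega>) (PiM J (\<lambda>_. borel))"

lemma space_past [simp]: "space (past M V J) = space M"
  unfolding past_def by simp

lemma past_coordinate: "i \<in> J \<Longrightarrow> V i \<in> borel_measurable (past M V J)"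
proof -
  assume i: "i \<in> J"
  have "(\<lambda>\<omega>. \<lambda>i\<in>J. V i \<omega>) \<in> past M V J \<rightarrow>\<^sub>M PiM J (\<lambda>_. borel)"
    unfolding past_def by (rule measurable_vimage_algebra1) (auto simp: space_PiM)
  from measurable_compose[OF this measurable_component_singleton[OF i]]
  show ?thesis using i by simp
qed

lemma past_least:
  assumes sp: "space F = space M" and V: "\<And>i. i \<in> J \<Longrightarrow> V i \<in> borel_measurable F"
  shows "sets (past M V J) \<subseteq> sets F"
proof
  have m: "(\<lambda>\<omega>. \<lambda>i\<in>J. V i \<omega>) \<in> F \<rightarrow>\<^sub>M PiM J (\<lambda>_. borel)"
    by (rule measurable_restrict) (rule V)
  fix A assume "A \<in> sets (past M V J)"
  then obtain B where B: "B \<in> sets (PiM J (\<lambda>_. borel))" "A = (\<lambda>\<omega>. \<lambda>i\<in>J. V i \<omega>) -` B \<inter> space M"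
    unfolding past_def by (subst (asm) sets_vimage_algebra2) (auto simp: space_PiM)
  show "A \<in> sets F" using measurable_sets[OF m B(1)] unfolding B(2) sp .
qed

lemma past_mono_measurable:
  assumes "f \<in> past M V J \<rightarrow>\<^sub>M T" "space F = space M" "\<And>i. i \<in> J \<Longrightarrow> V i \<in> borel_measurable F"
  shows "f \<in> F \<rightarrow>\<^sub>M T"
proof (rule measurableI)
  show "f \<omega> \<in> space T" if "\<omega> \<in> space F" for \<omega>
    using measurable_space[OF assms(1), of \<omega>] that assms(2) by simp
  show "f -` A \<inter> space F \<in> sets F" if "A \<in> sets T" for A
    using measurable_sets[OF assms(1) that] past_least[of F M J V, OF assms(2,3)] assms(2) by auto
qed

lemma (in prob_space) past_indep:
  assumes V: "indep_vars (\<lambda>_. borel) V I" and JK: "J \<inter> K = {}" "J \<subseteq> I" "K \<subseteq> I"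
    and f: "f \<in> past M V J \<rightarrow>\<^sub>M S" and g: "g \<in> past M V K \<rightarrow>\<^sub>M T"
  shows "indep_var S f T g"
proof -
  have Vm: "V i \<in> borel_measurable M" if "i \<in> I" for i using V that by (auto simp: indep_vars_def)
  have fM: "f \<in> M \<rightarrow>\<^sub>M S" by (rule past_mono_measurable[OF f]) (use Vm JK in auto)
  have gM: "g \<in> M \<rightarrow>\<^sub>M T" by (rule past_mono_measurable[OF g]) (use Vm JK in auto)
  have eq: "sigma_sets (space M) {(\<lambda>\<omega>. \<lambda>i\<in>J. V i \<omega>) -` A \<inter> space M |A. A \<in> sets (PiM J (\<lambda>_. borel))} = sets (past M V J)" for J
    unfolding past_def by (subst sets_vimage_algebra) auto
  have ind: "indep_set (sets (past M V J)) (sets (past M V K))"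
    using indep_var_restrict[OF V JK] unfolding indep_var_eq eq by simp
  have sub: "sigma_sets (space M) {f -` A \<inter> space M |A. A \<in> sets T} \<subseteq> sets (past M V J)"
    if "f \<in> past M V J \<rightarrow>\<^sub>M T" for f :: "'a \<Rightarrow> 'd" and T J
    using sets.sigma_sets_subset[of "{f -` A \<inter> space M |A. A \<in> sets T}" "past M V J"] measurable_sets[OF that] by auto
  have "indep_set (sigma_sets (space M) {f -` A \<inter> space M |A. A \<in> sets S}) (sigma_sets (space M) {g -` A \<inter> space M |A. A \<in> sets T})"
    using ind sub[OF f] sub[OF g] unfolding indep_set_def
    by (intro indep_sets_mono_sets[OF ind[unfolded indep_set_def]]) (auto split: bool.split)
  then show ?thesis unfolding indep_var_eq using fM gM by simp
qed

text \<open>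
  Fubini for a past-measurable quantity \<open>H\<close> and an independent \<open>G\<close>: if \<open>D\<close> has conditional
  probability at most \<open>q\<close> for every value of \<open>H\<close>, it multiplies the probability of a past event by
  at most \<open>q\<close>.
\<close>

lemma (in prob_space) past_conditional_bound:
  fixes H :: "'a \<Rightarrow> real" and G :: "'a \<Rightarrow> real \<times> real"
  assumes V: "indep_vars (\<lambda>_. borel) V I" and JK: "J \<inter> K = {}" "J \<subseteq> I" "K \<subseteq> I"
    and C: "C \<in> sets (past M V J)" and H: "H \<in> borel_measurable (past M V J)"
    and G: "G \<in> past M V K \<rightarrow>\<^sub>M borel \<Otimes>\<^sub>M borel" and D: "D \<in> sets (borel \<Otimes>\<^sub>M (borel \<Otimes>\<^sub>M borel))"
    and q: "\<And>h. prob {\<omega> \<in> space M. (h, G \<omega>) \<in> D} \<le> q"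
  shows "prob {\<omega> \<in> C. (H \<omega>, G \<omega>) \<in> D} \<le> q * prob C"
proof -
  let ?B = "borel \<Otimes>\<^sub>M borel :: (real \<times> real) measure"
  \<comment> \<open>\<open>C\<close> and \<open>H\<close> enter through one random vector of the same type as \<open>G\<close>, because \<open>indep_var\<close> relates
    variables with a common range type.\<close>
  define f where "f \<omega> = (H \<omega>, indicator C \<omega> :: real)" for \<omega>
  have Vm: "V i \<in> borel_measurable M" if "i \<in> I" for i using V that by (auto simp: indep_vars_def)
  have C_sub: "C \<subseteq> space M" using sets.sets_into_space[OF C] by simp
  have CM[measurable]: "C \<in> sets M"
    using past_least[of M M J V] C Vm JK by auto
  have fF: "f \<in> past M V J \<rightarrow>\<^sub>M ?B" unfolding f_def
    by (intro measurable_Pair H borel_measurable_indicator C)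
  have ind: "indep_var ?B f ?B G" by (rule past_indep[OF V JK fF G])
  have fm[measurable]: "f \<in> M \<rightarrow>\<^sub>M ?B" and Gm[measurable]: "G \<in> M \<rightarrow>\<^sub>M ?B"
    and joint: "distr M ?B f \<Otimes>\<^sub>M distr M ?B G = distr M (?B \<Otimes>\<^sub>M ?B) (\<lambda>\<omega>. (f \<omega>, G \<omega>))"
    using ind unfolding indep_var_distribution_eq by auto
  have q0: "0 \<le> q" using q[of 0] measure_nonneg order_trans by blast
  interpret B: prob_space "distr M ?B G" by (rule prob_space_distr[OF Gm])
  note [measurable] = D
  define E where "E = {p \<in> space (?B \<Otimes>\<^sub>M ?B). snd (fst p) = 1 \<and> (fst (fst p), snd p) \<in> D}"
  have E[measurable]: "E \<in> sets (?B \<Otimes>\<^sub>M ?B)" unfolding E_def by measurable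
  have Eeq: "(\<lambda>\<omega>. (f \<omega>, G \<omega>)) -` E \<inter> space M = {\<omega> \<in> C. (H \<omega>, G \<omega>) \<in> D}"
    unfolding E_def f_def using C_sub by (auto simp: space_pair_measure indicator_def split: if_splits)
  have pm: "(\<lambda>\<omega>. (f \<omega>, G \<omega>)) \<in> M \<rightarrow>\<^sub>M ?B \<Otimes>\<^sub>M ?B" by measurable
  have "emeasure M {\<omega> \<in> C. (H \<omega>, G \<omega>) \<in> D} = emeasure (distr M (?B \<Otimes>\<^sub>M ?B) (\<lambda>\<omega>. (f \<omega>, G \<omega>))) E"
    unfolding Eeq[symmetric] by (rule emeasure_distr[OF pm E, symmetric])
  also have "\<dots> = emeasure (distr M ?B f \<Otimes>\<^sub>M distr M ?B G) E" unfolding joint ..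
  also have "\<dots> = (\<integral>\<^sup>+ y. emeasure (distr M ?B G) (Pair y -` E) \<partial>distr M ?B f)"
    by (rule B.emeasure_pair_measure_alt) (use E in \<open>simp cong: sets_pair_measure_cong\<close>)
  also have "\<dots> \<le> (\<integral>\<^sup>+ y. ennreal q * indicator {y. snd y = 1} y \<partial>distr M ?B f)"
  proof (rule nn_integral_mono)
    fix y :: "real \<times> real"
    show "emeasure (distr M ?B G) (Pair y -` E) \<le> ennreal q * indicator {y. snd y = 1} y"
    proof (cases "snd y = 1")
      case True
      have "Pair y -` E \<in> sets ?B" using sets_Pair1[OF E] .
      then have "emeasure (distr M ?B G) (Pair y -` E) = emeasure M (G -` (Pair y -` E) \<inter> space M)"
        by (rule emeasure_distr[OF Gm])
      also have "G -` (Pair y -` E) \<inter> space M = {\<omega> \<in> space M. (fst y, G \<omega>) \<in> D}"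
        unfolding E_def using True by (auto simp: space_pair_measure)
      also have "emeasure M \<dots> \<le> ennreal q"
        unfolding emeasure_eq_measure by (rule ennreal_leI[OF q])
      finally show ?thesis using True by simp
    next
      case False
      then have "Pair y -` E = {}" unfolding E_def by auto
      then show ?thesis by simp
    qed
  qed
  also have "\<dots> = ennreal q * emeasure (distr M ?B f) {y \<in> space ?B. snd y = 1}"
  proof -
    have "{y \<in> space ?B. snd y = 1} \<in> sets ?B" by measurable
    then show ?thesis by (simp add: space_pair_measure nn_integral_cmult_indicator)
  qed
  also have "emeasure (distr M ?B f) {y \<in> space ?B. snd y = 1} = emeasure M (f -` {y \<in> space ?B. snd y = 1} \<inter> space M)"
    by (rule emeasure_distr[OF fm]) measurable
  also have "f -` {y \<in> space ?B. snd y = 1} \<inter> space M = C"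
    unfolding f_def using C_sub by (auto simp: space_pair_measure indicator_def split: if_splits)
  also have "ennreal q * emeasure M C = ennreal (q * prob C)"
    unfolding emeasure_eq_measure using q0 by (simp add: ennreal_mult)
  finally show ?thesis unfolding emeasure_eq_measure using q0 by (subst (asm) ennreal_le_iff) auto
qed

section \<open>Waiting times and the first return to zero\<close>

lemma lindley_measurable_upto:
  assumes "\<And>k. k < n \<Longrightarrow> (\<lambda>\<omega>. x \<omega> k) \<in> borel_measurable F"
  shows "(\<lambda>\<omega>. lindley w (x \<omega>) n) \<in> borel_measurable F"
  using assms
proof (induction n)
  case (Suc n)
  have "(\<lambda>\<omega>. lindley w (x \<omega>) n) \<in> borel_measurable F" by (rule Suc.IH) (rule Suc.prems, simp)
  moreover have "(\<lambda>\<omega>. x \<omega> n) \<in> borel_measurable F" by (rule Suc.prems) simp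
  ultimately show ?case by simp
qed simp

lemma area_measurable_upto:
  assumes "\<And>k. k < n \<Longrightarrow> (\<lambda>\<omega>. x \<omega> k) \<in> borel_measurable F"
  shows "(\<lambda>\<omega>. area (x \<omega>) n) \<in> borel_measurable F"
  unfolding area_def by (intro borel_measurable_sum lindley_measurable_upto assms) auto

text \<open>
  From \<open>E W\<^sub>n\<^sub>+\<^sub>1\<^sup>2 \<le> E (W\<^sub>n + X\<^sub>n)\<^sup>2 = E W\<^sub>n\<^sup>2 + 2 \<mu> E W\<^sub>n + E X\<^sup>2\<close> with \<open>\<mu> < 0\<close> one obtains by
  telescoping a bound for the average of \<open>E W\<^sub>0, \<dots>, E W\<^sub>2\<^sub>n\<close>. It bounds \<open>E W\<^sub>n\<close> too, since the mean waiting
  time is nondecreasing: the queue that starts one step earlier cannot be emptier.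
\<close>

lemma iid_mean_waiting_time:
  assumes X: "iid_sequence M Q X" and sq: "integrable Q (\<lambda>x. x\<^sup>2)" and neg: "(\<integral>x. x \<partial>Q) < 0"
  shows "integrable M (\<lambda>\<omega>. lindley 0 (\<lambda>k. X k \<omega>) n)"
    and "(\<integral>\<omega>. lindley 0 (\<lambda>k. X k \<omega>) n \<partial>M) \<le> (\<integral>x. x\<^sup>2 \<partial>Q) / - (\<integral>x. x \<partial>Q)"
proof -
  interpret prob_space M using X unfolding iid_sequence_def by simp
  have Xm[measurable]: "X k \<in> borel_measurable M" for k by (rule iid_measurable[OF X])
  have Xsq: "integrable M (\<lambda>\<omega>. (X k \<omega>)\<^sup>2)" for k using sq iid_integrable(1)[OF X, of "\<lambda>x. x\<^sup>2"] by simp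
  have Xint: "integrable M (X k)" for k by (rule square_integrable_imp_integrable[OF Xm Xsq])
  define \<mu> where "\<mu> = (\<integral>x. x \<partial>Q)"
  define s where "s = (\<integral>x. x\<^sup>2 \<partial>Q)"
  have EX: "expectation (X k) = \<mu>" for k unfolding \<mu>_def using iid_integrable(2)[OF X, of "\<lambda>x. x"] by simp
  have EX2: "expectation (\<lambda>\<omega>. (X k \<omega>)\<^sup>2) = s" for k unfolding s_def using iid_integrable(2)[OF X, of "\<lambda>x. x\<^sup>2"] by simp
  have s0: "0 \<le> s" unfolding s_def by simp
  define W where "W n \<omega> = lindley 0 (\<lambda>k. X k \<omega>) n" for n \<omega>
  have W_Suc: "W (Suc n) \<omega> = max 0 (W n \<omega> + X n \<omega>)" for n \<omega> unfolding W_def by simp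
  have W0: "0 \<le> W n \<omega>" for n \<omega> unfolding W_def by (rule lindley_nonneg) simp
  have Wm[measurable]: "W n \<in> borel_measurable M" for n
    unfolding W_def by (rule lindley_measurable_upto) simp
  have Wsq: "integrable M (\<lambda>\<omega>. (W n \<omega>)\<^sup>2)" for n
  proof (induction n)
    case 0
    then show ?case unfolding W_def by simp
  next
    case (Suc n)
    have "integrable M (\<lambda>\<omega>. 2 * (W n \<omega>)\<^sup>2 + 2 * (X n \<omega>)\<^sup>2)" using Suc Xsq[of n] by simp
    then show ?case
    proof (rule Bochner_Integration.integrable_bound)
      show "AE \<omega> in M. norm ((W (Suc n) \<omega>)\<^sup>2) \<le> norm (2 * (W n \<omega>)\<^sup>2 + 2 * (X n \<omega>)\<^sup>2)"
      proof (rule AE_I2)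
        fix \<omega>
        have "(W (Suc n) \<omega>)\<^sup>2 \<le> (W n \<omega> + X n \<omega>)\<^sup>2" unfolding W_Suc by (simp add: max_def)
        also have "\<dots> \<le> 2 * (W n \<omega>)\<^sup>2 + 2 * (X n \<omega>)\<^sup>2"
          using zero_le_power2[of "W n \<omega> - X n \<omega>"] unfolding power2_sum power2_diff by linarith
        finally show "norm ((W (Suc n) \<omega>)\<^sup>2) \<le> norm (2 * (W n \<omega>)\<^sup>2 + 2 * (X n \<omega>)\<^sup>2)" by simp
      qed
    qed measurable
  qed
  have Wint: "integrable M (W n)" for n by (rule square_integrable_imp_integrable[OF Wm Wsq])
  have ind: "indep_var borel (W n) borel (X n)" for n
  proof (rule past_indep)
    show "indep_vars (\<lambda>_. borel) X UNIV" using X unfolding iid_sequence_def by simp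
    show "W n \<in> borel_measurable (past M X {..<n})" unfolding W_def
      by (rule lindley_measurable_upto) (rule past_coordinate, simp)
    show "X n \<in> borel_measurable (past M X {n})" by (rule past_coordinate) simp
  qed auto
  have step: "expectation (\<lambda>\<omega>. (W (Suc n) \<omega>)\<^sup>2) \<le> expectation (\<lambda>\<omega>. (W n \<omega>)\<^sup>2) + 2 * \<mu> * expectation (W n) + s" for n
  proof -
    have WX: "integrable M (\<lambda>\<omega>. W n \<omega> * X n \<omega>)" by (rule indep_var_integrable[OF ind Wint Xint])
    have EWX: "expectation (\<lambda>\<omega>. W n \<omega> * X n \<omega>) = expectation (W n) * \<mu>"
      using indep_var_lebesgue_integral[OF ind Wint Xint] EX by simp
    have eq: "(W n \<omega> + X n \<omega>)\<^sup>2 = (W n \<omega>)\<^sup>2 + (2 * (W n \<omega> * X n \<omega>) + (X n \<omega>)\<^sup>2)" for \<omega>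
      by (simp add: power2_sum)
    have "expectation (\<lambda>\<omega>. (W (Suc n) \<omega>)\<^sup>2) \<le> expectation (\<lambda>\<omega>. (W n \<omega> + X n \<omega>)\<^sup>2)"
    proof (rule integral_mono[OF Wsq])
      show "integrable M (\<lambda>\<omega>. (W n \<omega> + X n \<omega>)\<^sup>2)" unfolding eq using Wsq[of n] WX Xsq[of n] by simp
      show "(W (Suc n) \<omega>)\<^sup>2 \<le> (W n \<omega> + X n \<omega>)\<^sup>2" for \<omega> unfolding W_Suc by (simp add: max_def)
    qed
    also have "\<dots> = expectation (\<lambda>\<omega>. (W n \<omega>)\<^sup>2) + (2 * (expectation (W n) * \<mu>) + s)"
      unfolding eq using Wsq[of n] WX Xsq[of n] EX2 EWX by simp
    finally show ?thesis by (simp add: algebra_simps)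
  qed
  have tele: "expectation (\<lambda>\<omega>. (W n \<omega>)\<^sup>2) + 2 * (- \<mu>) * (\<Sum>i<n. expectation (W i)) \<le> real n * s" for n
  proof (induction n)
    case 0
    then show ?case unfolding W_def by simp
  next
    case (Suc n)
    then show ?case using step[of n] by (simp add: algebra_simps)
  qed
  \<comment> \<open>Compare with the queue that starts empty at time 1; its increments have the same law.\<close>
  have EW_mono1: "expectation (W n) \<le> expectation (W (Suc n))" for n
  proof -
    have "expectation (W n) = expectation (\<lambda>\<omega>. lindley 0 (\<lambda>k. X (1 + k) \<omega>) n)"
      unfolding W_def by (rule iid_same_integral[OF X iid_shift[OF X] lindley_measurable])
    also have "\<dots> \<le> expectation (W (Suc n))"
    proof (rule integral_mono_AE'[OF Wint])
      show "AE \<omega> in M. lindley 0 (\<lambda>k. X (1 + k) \<omega>) n \<le> W (Suc n) \<omega>"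
      proof (rule AE_I2)
        fix \<omega>
        have "lindley 0 (\<lambda>k. X k \<omega>) (1 + n) = lindley (lindley 0 (\<lambda>k. X k \<omega>) 1) (\<lambda>k. X (1 + k) \<omega>) n"
          by (rule lindley_shift)
        moreover have "lindley 0 (\<lambda>k. X k \<omega>) 1 = max 0 (X 0 \<omega>)"
          by (simp only: One_nat_def lindley.simps add_0)
        ultimately have "W (Suc n) \<omega> = lindley (max 0 (X 0 \<omega>)) (\<lambda>k. X (1 + k) \<omega>) n"
          unfolding W_def by (simp only: plus_1_eq_Suc)
        then show "lindley 0 (\<lambda>k. X (1 + k) \<omega>) n \<le> W (Suc n) \<omega>"
          by (simp only:) (rule lindley_mono, simp)
      qed
      show "AE \<omega> in M. 0 \<le> W (Suc n) \<omega>" by (rule AE_I2) (rule W0)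
    qed
    finally show ?thesis .
  qed
  have EW_mono: "expectation (W n) \<le> expectation (W m)" if "n \<le> m" for n m
    by (rule lift_Suc_mono_le[of "\<lambda>n. expectation (W n)", OF EW_mono1 that])
  have bound: "expectation (W n) \<le> s / - \<mu>"
  proof (cases "n = 0")
    case True
    then have "expectation (W n) = 0" unfolding W_def by simp
    moreover have "0 \<le> s / - \<mu>" by (rule divide_nonneg_pos[OF s0]) (use neg in \<open>simp add: \<mu>_def\<close>)
    ultimately show ?thesis by (simp only:)
  next
    case False
    have "real n * expectation (W n) = (\<Sum>i\<in>{n..<2 * n}. expectation (W n))" by simp
    also have "\<dots> \<le> (\<Sum>i\<in>{n..<2 * n}. expectation (W i))" by (intro sum_mono EW_mono) auto
    also have "\<dots> \<le> (\<Sum>i<2 * n. expectation (W i))"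
      by (intro sum_mono2) (auto intro!: Bochner_Integration.integral_nonneg W0)
    finally have "2 * (- \<mu>) * (real n * expectation (W n)) \<le> 2 * (- \<mu>) * (\<Sum>i<2 * n. expectation (W i))"
      by (rule mult_left_mono) (use neg in \<open>simp add: \<mu>_def\<close>)
    also have "\<dots> \<le> real (2 * n) * s"
    proof -
      have "0 \<le> expectation (\<lambda>\<omega>. (W (2 * n) \<omega>)\<^sup>2)" by (rule Bochner_Integration.integral_nonneg) simp
      then show ?thesis using tele[of "2 * n"] by linarith
    qed
    finally have "2 * (- \<mu>) * (real n * expectation (W n)) \<le> 2 * real n * s" by (simp only: of_nat_mult of_nat_numeral)
    moreover have "2 * (- \<mu>) * (real n * expectation (W n)) = 2 * (real n * (- \<mu> * expectation (W n)))" by (simp add: mult_ac)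
    ultimately have "real n * (- \<mu> * expectation (W n)) \<le> real n * s" by linarith
    then have "- \<mu> * expectation (W n) \<le> s" by (rule mult_left_le_imp_le) (use False in simp)
    moreover have "0 < - \<mu>" using neg unfolding \<mu>_def by simp
    ultimately show ?thesis by (simp only: pos_le_divide_eq mult.commute[of _ "- \<mu>"])
  qed
  show "integrable M (\<lambda>\<omega>. lindley 0 (\<lambda>k. X k \<omega>) n)" using Wint[of n] unfolding W_def .
  show "(\<integral>\<omega>. lindley 0 (\<lambda>k. X k \<omega>) n \<partial>M) \<le> (\<integral>x. x\<^sup>2 \<partial>Q) / - (\<integral>x. x \<partial>Q)"
    using bound unfolding W_def \<mu>_def s_def .
qed

lemma iid_waiting_time_tail:
  assumes X: "iid_sequence M Q X" and sq: "integrable Q (\<lambda>x. x\<^sup>2)" and neg: "(\<integral>x. x \<partial>Q) < 0" and w: "0 < w"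
  shows "measure M {\<omega> \<in> space M. w < lindley 0 (\<lambda>k. X k \<omega>) n} \<le> (\<integral>x. x\<^sup>2 \<partial>Q) / - (\<integral>x. x \<partial>Q) / w"
proof -
  interpret prob_space M using X unfolding iid_sequence_def by simp
  note W = iid_mean_waiting_time[OF X sq neg, of n]
  have [measurable]: "(\<lambda>\<omega>. lindley 0 (\<lambda>k. X k \<omega>) n) \<in> borel_measurable M"
    by (rule lindley_measurable_upto) (rule iid_measurable[OF X])
  have "measure M {\<omega> \<in> space M. w < lindley 0 (\<lambda>k. X k \<omega>) n} \<le> measure M {\<omega> \<in> space M. w \<le> lindley 0 (\<lambda>k. X k \<omega>) n}"
    by (rule finite_measure_mono) auto
  also have "\<dots> \<le> (\<integral>\<omega>. lindley 0 (\<lambda>k. X k \<omega>) n \<partial>M) / w"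
    by (rule integral_Markov_inequality_measure[OF W(1), where A = "{}"]) (use w in \<open>auto intro: lindley_nonneg\<close>)
  also have "\<dots> \<le> (\<integral>x. x\<^sup>2 \<partial>Q) / - (\<integral>x. x \<partial>Q) / w" by (rule divide_right_mono[OF W(2)]) (use w in simp)
  finally show ?thesis .
qed

text \<open>
  The walk exceeds \<open>-dn/4\<close>, where \<open>-d\<close> is its drift, only if the waiting time of the queue with
  increments \<open>X k + d/2\<close> exceeds \<open>dn/4\<close>, and that queue is still stable.
\<close>

lemma iid_walk_tail:
  assumes X: "iid_sequence M Q X" and sq: "integrable Q (\<lambda>x. x\<^sup>2)" and neg: "(\<integral>x. x \<partial>Q) < 0"
  obtains C d where "0 < C" "0 < d"
    "\<And>n. 0 < n \<Longrightarrow> measure M {\<omega> \<in> space M. - (d * real n) < (\<Sum>i<n. X i \<omega>)} \<le> C / real n"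
proof -
  interpret prob_space M using X unfolding iid_sequence_def by simp
  have Q: "Q = distr M borel (X 0)" using X unfolding iid_sequence_def by simp
  interpret Q: prob_space Q unfolding Q by (rule prob_space_distr) (rule iid_measurable[OF X])
  define a where "a = - (\<integral>x. x \<partial>Q) / 2"
  have a: "0 < a" using neg unfolding a_def by simp
  have sQ: "sets Q = sets borel" unfolding Q by simp
  have idm: "(\<lambda>x. x) \<in> borel_measurable Q" by (simp add: measurable_ident_sets sQ)
  have int: "integrable Q (\<lambda>x. x)" by (rule Q.square_integrable_imp_integrable[OF idm sq])
  let ?Q = "distr Q borel (\<lambda>x. x + a)"
  have Y: "iid_sequence M ?Q (\<lambda>k \<omega>. X k \<omega> + a)" by (rule iid_map[OF X]) measurable
  have m: "(\<lambda>x. x + a) \<in> borel_measurable Q" using idm by measurable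
  have "(\<integral>x. x \<partial>?Q) = (\<integral>x. x + a \<partial>Q)" by (rule integral_distr[OF m]) simp
  also have "\<dots> = - a" using int unfolding a_def by (simp add: Q.prob_space)
  finally have mean: "(\<integral>x. x \<partial>?Q) = - a" .
  have "integrable Q (\<lambda>x. (x + a)\<^sup>2)" unfolding power2_sum using sq int by simp
  then have sq': "integrable ?Q (\<lambda>x. x\<^sup>2)" by (subst integrable_distr_eq[OF m]) auto
  define C where "C = (\<integral>x. x\<^sup>2 \<partial>?Q) / a / (a / 2) + 1"
  have "0 \<le> (\<integral>x. x\<^sup>2 \<partial>?Q) / a / (a / 2)" using a by (intro divide_nonneg_pos Bochner_Integration.integral_nonneg) auto
  then have C: "0 < C" unfolding C_def by linarith
  have "measure M {\<omega> \<in> space M. - (a / 2 * real n) < (\<Sum>i<n. X i \<omega>)} \<le> C / real n" if n: "0 < n" for n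
  proof -
    have [measurable]: "(\<lambda>\<omega>. lindley 0 (\<lambda>k. X k \<omega> + a) n) \<in> borel_measurable M"
      by (rule lindley_measurable_upto) (rule iid_measurable[OF Y])
    have "measure M {\<omega> \<in> space M. - (a / 2 * real n) < (\<Sum>i<n. X i \<omega>)} \<le>
        measure M {\<omega> \<in> space M. a / 2 * real n < lindley 0 (\<lambda>k. X k \<omega> + a) n}"
    proof (rule finite_measure_mono)
      have "a / 2 * real n < lindley 0 (\<lambda>k. X k \<omega> + a) n" if "- (a / 2 * real n) < (\<Sum>i<n. X i \<omega>)" for \<omega>
        using lindley_ge_sum[of 0 "\<lambda>k. X k \<omega> + a" n] that by (simp add: sum.distrib mult.commute)
      then show "{\<omega> \<in> space M. - (a / 2 * real n) < (\<Sum>i<n. X i \<omega>)} \<subseteq> {\<omega> \<in> space M. a / 2 * real n < lindley 0 (\<lambda>k. X k \<omega> + a) n}"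
        by auto
    qed measurable
    also have "\<dots> \<le> (\<integral>x. x\<^sup>2 \<partial>?Q) / - (\<integral>x. x \<partial>?Q) / (a / 2 * real n)"
      by (rule iid_waiting_time_tail[OF Y sq']) (use a n in \<open>simp_all add: mean\<close>)
    also have "\<dots> = (\<integral>x. x\<^sup>2 \<partial>?Q) / a / (a / 2) / real n" unfolding mean by simp
    also have "\<dots> \<le> C / real n" unfolding C_def by (rule divide_right_mono) auto
    finally show ?thesis .
  qed
  then show thesis using C a by (intro that[of C "a / 2"]) auto
qed


text \<open>
  Wald's identity for the walk with increments \<open>X' k = max (X k) (- c)\<close>, where \<open>c\<close> is so large that
  the drift is still negative: up to its first return below zero this walk is nonnegative, and it
  undershoots by at most \<open>c\<close>, so the expected number of steps is at most \<open>c\<close> divided by the drift.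
\<close>

lemma iid_positive_walk_summable:
  assumes X: "iid_sequence M Q X" and int: "integrable Q (\<lambda>x. x)" and neg: "(\<integral>x. x \<partial>Q) < 0"
  shows "summable (\<lambda>n. measure M {\<omega> \<in> space M. \<forall>k\<in>{1..n}. 0 < (\<Sum>i<k. X i \<omega>)})"
proof -
  interpret prob_space M using X unfolding iid_sequence_def by simp
  have Q: "Q = distr M borel (X 0)" using X unfolding iid_sequence_def by simp
  interpret Q: prob_space Q unfolding Q by (rule prob_space_distr) (rule iid_measurable[OF X])
  have sQ: "sets Q = sets borel" unfolding Q by simp
  have idm[measurable]: "(\<lambda>x. x) \<in> borel_measurable Q" by (simp add: measurable_ident_sets sQ)
  have "(\<lambda>n. \<integral>x. max x (- real n) \<partial>Q) \<longlonglongrightarrow> (\<integral>x. x \<partial>Q)"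
  proof (rule integral_dominated_convergence[where w = "\<lambda>x. \<bar>x\<bar>"])
    show "integrable Q (\<lambda>x. \<bar>x\<bar>)" using int by simp
    show "AE x in Q. (\<lambda>n. max x (- real n)) \<longlonglongrightarrow> x"
    proof (rule AE_I2)
      fix x :: real
      obtain n0 where n0: "- x \<le> real n0" using real_arch_simple by blast
      have "\<forall>\<^sub>F n in sequentially. max x (- real n) = x"
        unfolding eventually_sequentially
      proof (intro exI allI impI)
        fix n assume "n0 \<le> n"
        then have "real n0 \<le> real n" by simp
        with n0 have "- real n \<le> x" by linarith
        then show "max x (- real n) = x" by simp
      qed
      then show "(\<lambda>n. max x (- real n)) \<longlonglongrightarrow> x" by (rule tendsto_eventually)
    qed
    show "AE x in Q. norm (max x (- real n)) \<le> \<bar>x\<bar>" for n by (rule AE_I2) (auto simp: max_def)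
  qed measurable
  from order_tendstoD(2)[OF this neg] obtain c0 where "(\<integral>x. max x (- real c0) \<partial>Q) < 0"
    unfolding eventually_sequentially by blast
  then obtain c where c0: "0 \<le> c" and mneg: "(\<integral>x. max x (- c) \<partial>Q) < 0"
    by (metis of_nat_0_le_iff)
  define m where "m = (\<integral>x. max x (- c) \<partial>Q)"
  define X' where "X' k \<omega> = max (X k \<omega>) (- c)" for k \<omega>
  have X': "iid_sequence M (distr Q borel (\<lambda>x. max x (- c))) X'"
    unfolding X'_def by (rule iid_map[OF X]) measurable
  have X'm[measurable]: "X' k \<in> borel_measurable M" for k by (rule iid_measurable[OF X'])
  have Xm[measurable]: "X k \<in> borel_measurable M" for k by (rule iid_measurable[OF X])
  have "integrable Q (\<lambda>x. max x (- c))"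
  proof (rule Bochner_Integration.integrable_bound[OF int])
    show "AE x in Q. norm (max x (- c)) \<le> norm x" using c0 by (intro AE_I2) (auto simp: max_def)
  qed measurable
  then have X'int: "integrable M (X' k)" for k
    unfolding X'_def using iid_integrable(1)[OF X, of "\<lambda>x. max x (- c)"] by simp
  have EX': "expectation (X' k) = m" for k
    unfolding X'_def m_def using iid_integrable(2)[OF X, of "\<lambda>x. max x (- c)"] by simp
  define S where "S k \<omega> = (\<Sum>i<k. X' i \<omega>)" for k \<omega>
  define G where "G n = {\<omega> \<in> space M. \<forall>k\<in>{1..n}. 0 < S k \<omega>}" for n
  have Gm[measurable]: "G n \<in> sets M" for n unfolding G_def S_def by measurable
  have Sm[measurable]: "S n \<in> borel_measurable M" for n unfolding S_def[abs_def] by measurable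
  have Sint: "integrable M (S n)" for n unfolding S_def[abs_def] using X'int by simp
  have SGint: "integrable M (\<lambda>\<omega>. f \<omega> * indicator (G n) \<omega>)" if "integrable M f" for f :: "'a \<Rightarrow> real" and n
    using integrable_mult_indicator[OF Gm that] by (simp add: mult.commute)
  have S0: "0 \<le> S n \<omega>" if "\<omega> \<in> G n" for n \<omega>
  proof (cases "n = 0")
    case True
    then show ?thesis unfolding S_def by simp
  next
    case False
    then have "0 < S n \<omega>" using that unfolding G_def by auto
    then show ?thesis by simp
  qed
  define e where "e n = expectation (\<lambda>\<omega>. S n \<omega> * indicator (G n) \<omega>)" for n
  have e0: "0 \<le> e n" for n unfolding e_def
  proof (rule Bochner_Integration.integral_nonneg)
    fix \<omega>
    show "0 \<le> S n \<omega> * indicator (G n) \<omega>"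
      using S0[of \<omega> n] by (simp add: indicator_def)
  qed
  have step: "e (Suc n) - c * (prob (G n) - prob (G (Suc n))) \<le> e n + m * prob (G n)" for n
  proof -
    have ind: "indep_var borel (\<lambda>\<omega>. indicator (G n) \<omega> :: real) borel (X' n)"
    proof (rule past_indep)
      show "indep_vars (\<lambda>_. borel) X' UNIV" using X' unfolding iid_sequence_def by simp
      show "X' n \<in> borel_measurable (past M X' {n})" by (rule past_coordinate) simp
      have Sp: "S k \<in> borel_measurable (past M X' {..<n})" if "k \<le> n" for k
        unfolding S_def[abs_def] using that by (intro borel_measurable_sum past_coordinate) auto
      have "G n = {\<omega> \<in> space (past M X' {..<n}). \<forall>k\<in>{1..n}. 0 < S k \<omega>}"
        unfolding G_def by simp
      also have "\<dots> \<in> sets (past M X' {..<n})"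
        by (intro sets.sets_Collect_finite_All borel_measurable_less borel_measurable_const Sp) auto
      finally show "(\<lambda>\<omega>. indicator (G n) \<omega> :: real) \<in> borel_measurable (past M X' {..<n})"
        by (rule borel_measurable_indicator)
    qed auto
    have I: "integrable M (\<lambda>\<omega>. indicator (G n) \<omega> :: real)" for n
      by (rule integrable_real_indicator) (auto simp: less_top[symmetric])
    have "expectation (\<lambda>\<omega>. S (Suc n) \<omega> * indicator (G n) \<omega>) = e n + expectation (\<lambda>\<omega>. indicator (G n) \<omega> * X' n \<omega>)"
      unfolding e_def using SGint[OF Sint[of n], of n] indep_var_integrable[OF ind I X'int]
      by (subst Bochner_Integration.integral_add[symmetric]) (auto simp: S_def algebra_simps)
    also have "expectation (\<lambda>\<omega>. indicator (G n) \<omega> * X' n \<omega>) = prob (G n) * m"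
      using indep_var_lebesgue_integral[OF ind I X'int] EX' by simp
    finally have a: "expectation (\<lambda>\<omega>. S (Suc n) \<omega> * indicator (G n) \<omega>) = e n + m * prob (G n)" by simp
    have "e (Suc n) - c * (prob (G n) - prob (G (Suc n))) =
        expectation (\<lambda>\<omega>. S (Suc n) \<omega> * indicator (G (Suc n)) \<omega> - c * (indicator (G n) \<omega> - indicator (G (Suc n)) \<omega>))"
      unfolding e_def using SGint[OF Sint[of "Suc n"], of "Suc n"] I by simp
    also have "\<dots> \<le> expectation (\<lambda>\<omega>. S (Suc n) \<omega> * indicator (G n) \<omega>)"
    proof (rule integral_mono)
      fix \<omega> assume \<omega>: "\<omega> \<in> space M"
      have sub: "\<omega> \<in> G (Suc n) \<Longrightarrow> \<omega> \<in> G n" unfolding G_def by auto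
      have "- c \<le> S (Suc n) \<omega>" if "\<omega> \<in> G n"
      proof -
        have "0 \<le> S n \<omega>" by (rule S0[OF that])
        moreover have "- c \<le> X' n \<omega>" unfolding X'_def by simp
        ultimately show ?thesis unfolding S_def by simp
      qed
      then show "S (Suc n) \<omega> * indicator (G (Suc n)) \<omega> - c * (indicator (G n) \<omega> - indicator (G (Suc n)) \<omega>) \<le> S (Suc n) \<omega> * indicator (G n) \<omega>"
        using sub by (auto simp: indicator_def)
    next
      show "integrable M (\<lambda>\<omega>. S (Suc n) \<omega> * indicator (G (Suc n)) \<omega> - c * (indicator (G n) \<omega> - indicator (G (Suc n)) \<omega>))"
        using SGint[OF Sint[of "Suc n"], of "Suc n"] I by simp
      show "integrable M (\<lambda>\<omega>. S (Suc n) \<omega> * indicator (G n) \<omega>)" by (rule SGint[OF Sint])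
    qed
    finally show ?thesis unfolding a .
  qed
  have tele: "e n + (- m) * (\<Sum>i<n. prob (G i)) \<le> c * (prob (G 0) - prob (G n))" for n
  proof (induction n)
    case 0
    show ?case unfolding e_def by (simp add: S_def)
  next
    case (Suc n)
    then show ?case using step[of n] by (simp add: algebra_simps)
  qed
  have "(\<Sum>i<n. prob (G i)) \<le> c / - m" for n
  proof -
    have "c * (prob (G 0) - prob (G n)) \<le> c * 1"
      using c0 by (intro mult_left_mono) (auto intro: order_trans[OF diff_left_mono[of 0]] simp: measure_nonneg)
    then have "(- m) * (\<Sum>i<n. prob (G i)) \<le> c" using tele[of n] e0[of n] by linarith
    moreover have "0 < - m" using mneg unfolding m_def by simp
    ultimately show ?thesis by (simp only: pos_le_divide_eq mult.commute[of _ "- m"])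
  qed
  then have "summable (\<lambda>n. prob (G n))"
    by (intro summableI_nonneg_bounded[of _ "c / - m"]) auto
  then show ?thesis
  proof (rule summable_comparison_test')
    fix n
    have "{\<omega> \<in> space M. \<forall>k\<in>{1..n}. 0 < (\<Sum>i<k. X i \<omega>)} \<subseteq> G n"
    proof safe
      fix \<omega> assume \<omega>: "\<omega> \<in> space M" "\<forall>k\<in>{1..n}. 0 < (\<Sum>i<k. X i \<omega>)"
      have "(\<Sum>i<k. X i \<omega>) \<le> S k \<omega>" for k unfolding S_def X'_def by (intro sum_mono) auto
      then show "\<omega> \<in> G n" using \<omega> unfolding G_def by (auto intro: less_le_trans)
    qed
    then show "norm (prob {\<omega> \<in> space M. \<forall>k\<in>{1..n}. 0 < (\<Sum>i<k. X i \<omega>)}) \<le> prob (G n)"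
      by (simp add: finite_measure_mono)
  qed
qed

text \<open>
  The waiting time is positive up to time \<open>n\<close> only if the walk is, so the return time has a finite mean
  and is almost surely at least 1. A return time of infinite mean would have the integral 0.
\<close>

lemma iid_first_return_mean_pos:
  assumes X: "iid_sequence M Q X" and int: "integrable Q (\<lambda>x. x)" and neg: "(\<integral>x. x \<partial>Q) < 0"
  shows "0 < (\<integral>\<omega>. real (Inf {k. 1 \<le> k \<and> lindley 0 (\<lambda>k. X k \<omega>) k = 0}) \<partial>M)"
proof -
  interpret prob_space M using X unfolding iid_sequence_def by simp
  define W where "W \<omega> k = lindley 0 (\<lambda>k. X k \<omega>) k" for \<omega> k
  have Xm[measurable]: "X k \<in> borel_measurable M" for k by (rule iid_measurable[OF X])
  have Wm[measurable]: "(\<lambda>\<omega>. W \<omega> k) \<in> borel_measurable M" for k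
    unfolding W_def by (rule lindley_measurable_upto) simp
  define \<tau> where "\<tau> \<omega> = Inf {k. 1 \<le> k \<and> W \<omega> k = 0}" for \<omega>
  define G where "G n = {\<omega> \<in> space M. \<forall>k\<in>{1..n}. 0 < (\<Sum>i<k. X i \<omega>)}" for n
  have Gm[measurable]: "G n \<in> sets M" for n unfolding G_def by measurable
  have sm: "summable (\<lambda>n. prob (G n))" unfolding G_def by (rule iid_positive_walk_summable[OF X int neg])
  have busy: "\<omega> \<in> G n" if "\<omega> \<in> space M" "\<And>k. 1 \<le> k \<Longrightarrow> k \<le> n \<Longrightarrow> W \<omega> k \<noteq> 0" for \<omega> n
  proof -
    have pos: "0 < W \<omega> k" if "1 \<le> k" "k \<le> n" for k
      using \<open>\<And>k. 1 \<le> k \<Longrightarrow> k \<le> n \<Longrightarrow> W \<omega> k \<noteq> 0\<close>[OF that] lindley_nonneg[of 0 "\<lambda>k. X k \<omega>" k] 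
      unfolding W_def by simp
    have "0 < (\<Sum>i<k. X i \<omega>)" if "1 \<le> k" "k \<le> n" for k
      using lindley_eq_sum[of k 0 "\<lambda>k. X k \<omega>"] pos that unfolding W_def by force
    then show ?thesis using \<open>\<omega> \<in> space M\<close> unfolding G_def by auto
  qed
  have \<tau>m[measurable]: "\<tau> \<in> measurable M (count_space UNIV)"
    unfolding \<tau>_def Inf_nat_def by measurable
  have tail: "{\<omega> \<in> space M. n < \<tau> \<omega>} \<subseteq> G n" for n
  proof safe
    fix \<omega> assume \<omega>: "\<omega> \<in> space M" "n < \<tau> \<omega>"
    show "\<omega> \<in> G n"
    proof (rule busy[OF \<omega>(1)])
      fix k assume k: "1 \<le> k" "k \<le> n"
      show "W \<omega> k \<noteq> 0"
      proof
        assume "W \<omega> k = 0"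
        then have "\<tau> \<omega> \<le> k" unfolding \<tau>_def using k by (intro cInf_lower) auto
        then show False using \<omega> k by simp
      qed
    qed
  qed
  have "(\<integral>\<^sup>+ \<omega>. of_nat (\<tau> \<omega>) \<partial>M) = (\<Sum>n. emeasure M {\<omega> \<in> space M. n < \<tau> \<omega>})"
    by (rule nn_integral_nat_function[OF \<tau>m])
  also have "\<dots> \<le> (\<Sum>n. ennreal (prob (G n)))"
    unfolding emeasure_eq_measure[symmetric] by (intro suminf_le emeasure_mono tail) auto
  also have "\<dots> = ennreal (\<Sum>n. prob (G n))" by (rule suminf_ennreal2) (auto simp: sm)
  finally have fin: "(\<integral>\<^sup>+ \<omega>. of_nat (\<tau> \<omega>) \<partial>M) < \<infinity>"
    by (rule le_less_trans) simp
  have \<tau>int: "integrable M (\<lambda>\<omega>. real (\<tau> \<omega>))"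
    by (rule integrableI_bounded) (use fin in \<open>auto simp: ennreal_of_nat_eq_real_of_nat\<close>)
  have ge1: "AE \<omega> in M. 1 \<le> real (\<tau> \<omega>)"
  proof -
    have "prob (\<Inter>n. G n) \<le> prob (G n)" for n by (rule finite_measure_mono) auto
    then have "prob (\<Inter>n. G n) \<le> 0"
      by (intro LIMSEQ_le_const[OF summable_LIMSEQ_zero[OF sm]]) auto
    then have "prob (\<Inter>n. G n) = 0" using measure_nonneg[of M "\<Inter>n. G n"] by linarith
    then have "AE \<omega> in M. \<omega> \<notin> (\<Inter>n. G n)" by (subst (asm) prob_eq_0) auto
    then show ?thesis using AE_space
    proof eventually_elim
      case (elim \<omega>)
      then obtain n where "\<omega> \<notin> G n" by blast
      then obtain k where k: "1 \<le> k" "W \<omega> k = 0" using busy[OF elim(2), of n] by blast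
      then have "\<tau> \<omega> \<in> {k. 1 \<le> k \<and> W \<omega> k = 0}" unfolding \<tau>_def by (intro Inf_nat_def1) auto
      then show ?case by simp
    qed
  qed
  have "1 = expectation (\<lambda>_. 1 :: real)" by (simp add: prob_space)
  also have "\<dots> \<le> expectation (\<lambda>\<omega>. real (\<tau> \<omega>))" by (rule integral_mono_AE[OF _ \<tau>int ge1]) simp
  finally show ?thesis unfolding \<tau>_def W_def by simp
qed

section \<open>Small distances force independent events\<close>

text \<open>
  After the queue has emptied, the areas in the block and those of the queue that is empty at the start
  of the block differ by a constant, on which \<open>w\<close> vanishes; the rest is the Cauchy--Schwarz inequality.
\<close>

lemma block_functional_close:
  fixes x g w :: "nat \<Rightarrow> real"
  assumes hit: "lindley 0 x t + (\<Sum>i<n. x (t + i)) \<le> 0"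
    and w0: "(\<Sum>i<K. w i) = 0" and wn: "\<And>i. i < n \<Longrightarrow> w i = 0"
    and ws: "(\<Sum>i<K. (w i)\<^sup>2) \<le> s" and R: "(\<Sum>i<K. (area x (t + i) - g (t + i))\<^sup>2) \<le> R"
  shows "\<bar>(\<Sum>i<K. w i * area (\<lambda>k. x (t + k)) i) - (\<Sum>i<K. w i * g (t + i))\<bar> \<le> sqrt (s * R)"
proof -
  define a where "a = area x (t + n) - area (\<lambda>k. x (t + k)) n"
  have "w i * area (\<lambda>k. x (t + k)) i = w i * area x (t + i) - a * w i" for i
  proof (cases "i < n")
    case False
    then have "area x (t + i) = area (\<lambda>k. x (t + k)) i + a"
      using area_block[OF hit, of i] unfolding a_def by simp
    then show ?thesis by (simp add: algebra_simps)
  qed (simp add: wn)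
  then have "(\<Sum>i<K. w i * area (\<lambda>k. x (t + k)) i) = (\<Sum>i<K. w i * area x (t + i)) - a * (\<Sum>i<K. w i)"
    by (simp add: sum_subtractf sum_distrib_left)
  then have eq: "(\<Sum>i<K. w i * area (\<lambda>k. x (t + k)) i) - (\<Sum>i<K. w i * g (t + i)) = (\<Sum>i<K. w i * (area x (t + i) - g (t + i)))"
    unfolding w0 by (simp add: sum_subtractf right_diff_distrib)
  have "(\<Sum>i<K. w i * (area x (t + i) - g (t + i)))\<^sup>2 \<le> (\<Sum>i<K. (w i)\<^sup>2) * (\<Sum>i<K. (area x (t + i) - g (t + i))\<^sup>2)"
    by (rule Cauchy_Schwarz_ineq_sum)
  also have "\<dots> \<le> s * R"
    by (intro mult_mono ws R sum_nonneg order_trans[OF _ ws]) auto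
  finally show ?thesis unfolding eq by (rule real_le_rsqrt[of "\<bar>_\<bar>", unfolded power2_abs])
qed

text \<open>
  Blocks of \<open>K\<close> consecutive increments start at the times \<open>T + j * K\<close>. If the queue is short at the
  start of a block and drains early in it, then the contrast \<open>\<Sum> w i * area i\<close> of the path over the
  block depends only on the increments of the block, while the competing path \<open>g\<close> is known before
  the first block. Closeness of the two paths therefore forces independent events, one for each block.
\<close>

lemma (in prob_space) small_ball_blocks:
  fixes V :: "'i \<Rightarrow> 'a \<Rightarrow> real" and e :: "nat \<Rightarrow> 'i" and w :: "nat \<Rightarrow> real"
  assumes V: "indep_vars (\<lambda>_. borel) V I" and e: "inj e" "range e \<subseteq> I"
    and X: "iid_sequence M Q (\<lambda>k. V (e k))"
    and w0: "(\<Sum>i<K. w i) = 0" and wn: "\<And>i. i < n \<Longrightarrow> w i = 0" and nK: "n \<le> K"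
    and ws: "(\<Sum>i<K. (w i)\<^sup>2) \<le> s" and \<rho>: "sqrt (s * R) \<le> \<rho>"
    and q: "\<And>r. prob {\<omega> \<in> space M. \<bar>(\<Sum>i<K. w i * area (\<lambda>k. V (e k) \<omega>) i) - r\<bar> \<le> \<rho> \<or> - v < (\<Sum>i<n. V (e i) \<omega>)} \<le> q"
    and B: "\<And>t. prob {\<omega> \<in> space M. v < lindley 0 (\<lambda>k. V (e k) \<omega>) t} \<le> B"
    and g: "\<And>i. T \<le> i \<Longrightarrow> i < T + N * K \<Longrightarrow> g i \<in> borel_measurable (past M V (I - e ` {T..}))"
  obtains E where "E \<in> events"
    "{\<omega> \<in> space M. (\<Sum>i = T..<T + N * K. (area (\<lambda>k. V (e k) \<omega>) i - g i \<omega>)\<^sup>2) \<le> R} \<subseteq> E"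
    "prob E \<le> q ^ N + real N * B"
proof -
  define X where "X \<omega> k = V (e k) \<omega>" for \<omega> k
  have Vm: "V i \<in> borel_measurable M" if "i \<in> I" for i using V that by (auto simp: indep_vars_def)
  have Xm[measurable]: "(\<lambda>\<omega>. X \<omega> k) \<in> borel_measurable M" for k unfolding X_def using e by (intro Vm) auto
  define P where "P t = past M V (I - e ` {t..})" for t
  have spP[simp]: "space (P t) = space M" for t unfolding P_def by simp
  have XP: "(\<lambda>\<omega>. X \<omega> k) \<in> borel_measurable (P t)" if "k < t" for k t
    unfolding X_def P_def using that e by (intro past_coordinate) (auto dest: injD)
  define F where "F x = (\<Sum>i<K. w i * area x i)" for x
  define S where "S x = (\<Sum>i<n. x i)" for x :: "nat \<Rightarrow> real"
  define t where "t j = T + j * K" for j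
  define H where "H j \<omega> = (\<Sum>i<K. w i * g (t j + i) \<omega>)" for j \<omega>
  \<comment> \<open>The event that block \<open>j\<close> is predicted by \<open>H j\<close> or drains too slowly.\<close>
  define A where "A j \<omega> \<longleftrightarrow> \<bar>F (\<lambda>k. X \<omega> (t j + k)) - H j \<omega>\<bar> \<le> \<rho> \<or> - v < S (\<lambda>k. X \<omega> (t j + k))" for j \<omega>
  define C where "C j = {\<omega> \<in> space M. \<forall>i\<in>{..<j}. A i \<omega>}" for j
  have Fm: "(\<lambda>\<omega>. F (\<lambda>k. X \<omega> (t j + k))) \<in> borel_measurable G" 
    and Sm: "(\<lambda>\<omega>. S (\<lambda>k. X \<omega> (t j + k))) \<in> borel_measurable G"
    if "\<And>k. t j \<le> k \<Longrightarrow> k < t (Suc j) \<Longrightarrow> (\<lambda>\<omega>. X \<omega> k) \<in> borel_measurable G" for j G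
  proof -
    have m: "(\<lambda>\<omega>. X \<omega> (t j + k)) \<in> borel_measurable G" if "k < K" for k
      using \<open>\<And>k. t j \<le> k \<Longrightarrow> k < t (Suc j) \<Longrightarrow> (\<lambda>\<omega>. X \<omega> k) \<in> borel_measurable G\<close>[of "t j + k"] that
      by (simp add: t_def)
    show "(\<lambda>\<omega>. F (\<lambda>k. X \<omega> (t j + k))) \<in> borel_measurable G" unfolding F_def
      by (intro borel_measurable_sum borel_measurable_times borel_measurable_const area_measurable_upto m) auto
    show "(\<lambda>\<omega>. S (\<lambda>k. X \<omega> (t j + k))) \<in> borel_measurable G" unfolding S_def
      using nK by (intro borel_measurable_sum m) auto
  qed
  have Hm: "H j \<in> borel_measurable (P l)" if "j < N" "T \<le> l" for j l
  proof -
    have "H j \<in> borel_measurable (past M V (I - e ` {T..}))"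
      unfolding H_def
    proof (intro borel_measurable_sum borel_measurable_times borel_measurable_const g)
      fix i assume "i \<in> {..<K}"
      then have "j * K + i < Suc j * K" by simp
      also have "\<dots> \<le> N * K" using that by (intro mult_right_mono) auto
      finally show "t j + i < T + N * K" unfolding t_def by simp
    qed (simp add: t_def)
    then show ?thesis
      by (rule past_mono_measurable) (use that in \<open>auto simp: P_def intro!: past_coordinate\<close>)
  qed
  have Am: "{\<omega> \<in> space M. A i \<omega>} \<in> sets G" 
    if G: "space G = space M" "\<And>k. t i \<le> k \<Longrightarrow> k < t (Suc i) \<Longrightarrow> (\<lambda>\<omega>. X \<omega> k) \<in> borel_measurable G" "H i \<in> borel_measurable G" for i G
  proof -
    note [measurable] = Fm[of i G, OF G(2)] Sm[of i G, OF G(2)] G(3)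
    have "{\<omega> \<in> space G. A i \<omega>} \<in> sets G" unfolding A_def by measurable
    then show ?thesis unfolding G(1) .
  qed
  have t_mono: "t i \<le> t j" if "i \<le> j" for i j unfolding t_def using that by (intro add_left_mono mult_right_mono) auto
  have CP: "C j \<in> sets (P (t j))" if "j \<le> N" for j
  proof -
    have "{\<omega> \<in> space (P (t j)). \<forall>i\<in>{..<j}. A i \<omega>} \<in> sets (P (t j))"
    proof (intro sets.sets_Collect_finite_All)
      fix i assume i: "i \<in> {..<j}"
      have "{\<omega> \<in> space M. A i \<omega>} \<in> sets (P (t j))"
      proof (rule Am)
        fix k assume "k < t (Suc i)"
        moreover have "t (Suc i) \<le> t j" using i by (intro t_mono) auto
        ultimately show "(\<lambda>\<omega>. X \<omega> k) \<in> borel_measurable (P (t j))" by (intro XP) auto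
      next
        show "H i \<in> borel_measurable (P (t j))" using i that by (intro Hm) (auto simp: t_def)
      qed simp
      then show "{\<omega> \<in> space (P (t j)). A i \<omega>} \<in> sets (P (t j))" by simp
    qed simp
    then show ?thesis unfolding C_def by simp
  qed
  have CM: "C j \<in> events" if "j \<le> N" for j
    using CP[OF that] past_least[of M M "I - e ` {t j..}" V] Vm unfolding P_def by auto
  have D: "{p \<in> space (borel \<Otimes>\<^sub>M (borel \<Otimes>\<^sub>M borel)). \<bar>fst (snd p) - fst p\<bar> \<le> \<rho> \<or> - v < snd (snd p)} \<in> sets (borel \<Otimes>\<^sub>M (borel \<Otimes>\<^sub>M (borel :: real measure)))"
    by measurable
  have q0: "0 \<le> q" using q[of 0] measure_nonneg order_trans by blast
  have Cq: "prob (C j) \<le> q ^ j" if "j \<le> N" for j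
    using that
  proof (induction j)
    case 0
    show ?case by (simp add: prob_le_1)
  next
    case (Suc j)
    let ?G = "\<lambda>\<omega>. (F (\<lambda>k. X \<omega> (t j + k)), S (\<lambda>k. X \<omega> (t j + k)))"
    let ?D = "{p \<in> space (borel \<Otimes>\<^sub>M (borel \<Otimes>\<^sub>M borel)). \<bar>fst (snd p) - fst p\<bar> \<le> \<rho> \<or> - v < snd (snd p)} :: (real \<times> real \<times> real) set"
    have "prob {\<omega> \<in> C j. (H j \<omega>, ?G \<omega>) \<in> ?D} \<le> q * prob (C j)"
    proof (rule past_conditional_bound[OF V])
      show "(I - e ` {t j..}) \<inter> e ` {t j..} = {}" "I - e ` {t j..} \<subseteq> I" "e ` {t j..} \<subseteq> I" using e by auto
      show "C j \<in> sets (past M V (I - e ` {t j..}))" using CP[of j] Suc.prems unfolding P_def by simp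
      show "H j \<in> borel_measurable (past M V (I - e ` {t j..}))"
        using Hm[of j "t j"] Suc.prems unfolding P_def t_def by simp
      have "(\<lambda>\<omega>. X \<omega> k) \<in> borel_measurable (past M V (e ` {t j..}))" if "t j \<le> k" for k
        unfolding X_def using that by (intro past_coordinate) auto
      then show "?G \<in> past M V (e ` {t j..}) \<rightarrow>\<^sub>M borel \<Otimes>\<^sub>M borel" by (intro measurable_Pair Fm Sm)
      show "?D \<in> sets (borel \<Otimes>\<^sub>M (borel \<Otimes>\<^sub>M borel))" by (rule D)
      fix h
      have pred: "Measurable.pred seq_space (\<lambda>x. \<bar>F x - h\<bar> \<le> \<rho> \<or> - v < S x)"
        unfolding F_def S_def by measurable
      have "prob {\<omega> \<in> space M. (h, ?G \<omega>) \<in> ?D} = prob {\<omega> \<in> space M. \<bar>F (\<lambda>k. V (e (t j + k)) \<omega>) - h\<bar> \<le> \<rho> \<or> - v < S (\<lambda>k. V (e (t j + k)) \<omega>)}"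
        by (simp add: space_pair_measure X_def)
      also have "\<dots> = prob {\<omega> \<in> space M. \<bar>F (\<lambda>k. V (e k) \<omega>) - h\<bar> \<le> \<rho> \<or> - v < S (\<lambda>k. V (e k) \<omega>)}"
        by (rule iid_same_law[OF iid_shift[OF X] X pred])
      also have "\<dots> \<le> q" using q[of h] unfolding F_def S_def .
      finally show "prob {\<omega> \<in> space M. (h, ?G \<omega>) \<in> ?D} \<le> q" .
    qed
    also have "{\<omega> \<in> C j. (H j \<omega>, ?G \<omega>) \<in> ?D} = C (Suc j)"
      unfolding C_def A_def by (auto simp: space_pair_measure less_Suc_eq)
    also have "q * prob (C j) \<le> q * q ^ j" using Suc q0 by (intro mult_left_mono) auto
    finally show ?case by simp
  qed
  define L where "L j = {\<omega> \<in> space M. v < lindley 0 (X \<omega>) (t j)}" for j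
  have Lm: "L j \<in> events" for j
  proof -
    have [measurable]: "(\<lambda>\<omega>. lindley 0 (X \<omega>) (t j)) \<in> borel_measurable M" by (rule lindley_measurable_upto) simp
    show ?thesis unfolding L_def by measurable
  qed
  have LB: "prob (L j) \<le> B" for j unfolding L_def X_def by (rule B)
  define E where "E = C N \<union> (\<Union>j<N. L j)"
  show thesis
  proof (rule that)
    show "E \<in> events" unfolding E_def using CM[of N] Lm by auto
    have "prob E \<le> prob (C N) + prob (\<Union>j<N. L j)"
      unfolding E_def using CM[of N] Lm by (intro measure_Un_le) auto
    also have "prob (\<Union>j<N. L j) \<le> (\<Sum>j<N. prob (L j))"
      using Lm by (intro finite_measure_subadditive_finite) auto
    also have "\<dots> \<le> (\<Sum>j<N. B)" by (intro sum_mono LB)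
    finally show "prob E \<le> q ^ N + real N * B" using Cq[of N] by simp
    show "{\<omega> \<in> space M. (\<Sum>i = T..<T + N * K. (area (\<lambda>k. V (e k) \<omega>) i - g i \<omega>)\<^sup>2) \<le> R} \<subseteq> E"
    proof safe
      fix \<omega> assume \<omega>: "\<omega> \<in> space M" and le: "(\<Sum>i = T..<T + N * K. (area (\<lambda>k. V (e k) \<omega>) i - g i \<omega>)\<^sup>2) \<le> R"
      show "\<omega> \<in> E"
      proof (cases "\<exists>j<N. \<omega> \<in> L j")
        case False
        have "A j \<omega>" if j: "j < N" for j
        proof (rule ccontr)
          assume neg: "\<not> A j \<omega>"
          have short: "lindley 0 (X \<omega>) (t j) \<le> v" using False j \<omega> unfolding L_def by auto
          have hit: "lindley 0 (X \<omega>) (t j) + (\<Sum>i<n. X \<omega> (t j + i)) \<le> 0"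
            using short neg unfolding A_def S_def by auto
          have "(\<Sum>i<K. (area (X \<omega>) (t j + i) - g (t j + i) \<omega>)\<^sup>2) = (\<Sum>i\<in>(\<lambda>i. t j + i) ` {..<K}. (area (X \<omega>) i - g i \<omega>)\<^sup>2)"
            by (subst sum.reindex) auto
          also have "\<dots> \<le> (\<Sum>i = T..<T + N * K. (area (X \<omega>) i - g i \<omega>)\<^sup>2)"
          proof (rule sum_mono2)
            show "(\<lambda>i. t j + i) ` {..<K} \<subseteq> {T..<T + N * K}"
            proof safe
              fix i assume "i < K"
              then have "j * K + i < Suc j * K" by simp
              also have "\<dots> \<le> N * K" using j by (intro mult_right_mono) auto
              finally show "t j + i \<in> {T..<T + N * K}" unfolding t_def by simp
            qed
          qed auto
          also have "\<dots> \<le> R" using le unfolding X_def .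
          finally have "(\<Sum>i<K. (area (X \<omega>) (t j + i) - g (t j + i) \<omega>)\<^sup>2) \<le> R" .
          from block_functional_close[OF hit w0 wn ws, where g = "\<lambda>i. g i \<omega>", OF _ this]
          have "\<bar>F (\<lambda>k. X \<omega> (t j + k)) - H j \<omega>\<bar> \<le> sqrt (s * R)"
            unfolding F_def H_def by simp
          then show False using neg \<rho> unfolding A_def by simp
        qed
        then show ?thesis using \<omega> unfolding E_def C_def by simp
      qed (auto simp: E_def)
    qed
  qed
qed

section \<open>Integrals of step paths\<close>

lemma abs_square_le: "\<bar>x\<bar> \<le> B \<Longrightarrow> \<bar>x\<^sup>2\<bar> \<le> B\<^sup>2" for x B :: real
  using abs_le_square_iff[of x B] by auto

lemma step_path_measurable:
  fixes Z :: "nat \<Rightarrow> real" and c d :: real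
  shows "(\<lambda>s. Z (nat \<lfloor>c * s + d\<rfloor>)) \<in> borel_measurable borel"
proof -
  have "(\<lambda>s. c * s + d) \<in> borel_measurable borel" by measurable
  from measurable_compose[OF this measurable_real_floor]
  have "(\<lambda>s. \<lfloor>c * s + d\<rfloor>) \<in> borel \<rightarrow>\<^sub>M count_space UNIV" .
  from measurable_compose[OF this, of "\<lambda>i. Z (nat i)" borel] show ?thesis by simp
qed

lemma bounded_set_integrable:
  fixes f :: "real \<Rightarrow> real"
  assumes f: "f \<in> borel_measurable borel" and S: "S \<in> sets borel" "emeasure lborel S < \<infinity>"
    and B: "\<And>s. s \<in> S \<Longrightarrow> \<bar>f s\<bar> \<le> B"
  shows "set_integrable lborel S f"
  unfolding set_integrable_def
proof (rule Bochner_Integration.integrable_bound[where f = "\<lambda>s. indicator S s * B"])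
  show "integrable lborel (\<lambda>s. indicator S s * B)"
    using S by (intro integrable_mult_left integrable_real_indicator) auto
  show "(\<lambda>s. indicator S s *\<^sub>R f s) \<in> borel_measurable lborel" using f S by measurable
  show "AE s in lborel. norm (indicator S s *\<^sub>R f s) \<le> norm (indicator S s * B)"
  proof (rule AE_I2)
    fix s show "norm (indicator S s *\<^sub>R f s) \<le> norm (indicator S s * B)"
      using B[of s] by (cases "s \<in> S") auto
  qed
qed

lemma emeasure_interval_finite:
  "emeasure lborel {a..b::real} < \<infinity>" "emeasure lborel {a..<b::real} < \<infinity>"
  by (cases "a \<le> b"; simp)+

lemma step_path_integral:
  fixes Z :: "nat \<Rightarrow> real" and c d :: real
  assumes S: "S \<in> sets borel" "emeasure lborel S < \<infinity>"
    and K: "\<And>s. s \<in> S \<Longrightarrow> 0 \<le> c * s + d \<and> c * s + d < real K"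
  shows "(LINT s:S|lborel. Z (nat \<lfloor>c * s + d\<rfloor>)) =
    (\<Sum>k<K. Z k * measure lborel (S \<inter> {s. real k \<le> c * s + d \<and> c * s + d < real k + 1}))"
proof -
  let ?I = "\<lambda>k. S \<inter> {s. real k \<le> c * s + d \<and> c * s + d < real k + 1}"
  have Im: "?I k \<in> sets borel" for k using S by measurable
  have Ifin: "emeasure lborel (?I k) < \<infinity>" for k
    using emeasure_mono[of "?I k" S lborel] S by (auto intro: le_less_trans)
  have "indicator S s *\<^sub>R Z (nat \<lfloor>c * s + d\<rfloor>) = (\<Sum>k<K. Z k * indicator (?I k) s)" for s
  proof (cases "s \<in> S")
    case True
    define j where "j = nat \<lfloor>c * s + d\<rfloor>"
    have "real j \<le> c * s + d" "c * s + d < real j + 1" using K[OF True] unfolding j_def by linarith+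
    moreover have j: "j < K" using calculation K[OF True] by linarith
    ultimately have "s \<in> ?I k \<longleftrightarrow> k = j" for k using True by auto
    then have "(\<Sum>k<K. Z k * indicator (?I k) s) = (\<Sum>k<K. if k = j then Z k else 0)"
      by (intro sum.cong) (auto simp: indicator_def)
    then show ?thesis using j True unfolding j_def[symmetric] by simp
  qed simp
  then have "(LINT s:S|lborel. Z (nat \<lfloor>c * s + d\<rfloor>)) = (\<integral>s. (\<Sum>k<K. Z k * indicator (?I k) s) \<partial>lborel)"
    unfolding set_lebesgue_integral_def by simp
  also have "\<dots> = (\<Sum>k<K. \<integral>s. Z k * indicator (?I k) s \<partial>lborel)"
    using Im Ifin by (intro Bochner_Integration.integral_sum integrable_mult_right integrable_real_indicator) auto
  also have "\<dots> = (\<Sum>k<K. Z k * measure lborel (?I k))"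
    using Im by (intro sum.cong) auto
  finally show ?thesis .
qed

text \<open>By Jensen's inequality on the unit intervals \<open>[i, i + 1)\<close>.\<close>

lemma integral_square_ge_sum:
  fixes f :: "real \<Rightarrow> real"
  assumes f: "f \<in> borel_measurable borel" and B: "\<And>s. s \<in> {0..t} \<Longrightarrow> \<bar>f s\<bar> \<le> B" and T: "real T1 \<le> t"
    and a: "\<And>i. i \<in> {T0..<T1} \<Longrightarrow> a i = (LINT s:{real i..<real i + 1}|lborel. f s)"
  shows "(\<Sum>i = T0..<T1. (a i)\<^sup>2) \<le> (LINT s:{0..t}|lborel. (f s)\<^sup>2)"
proof -
  let ?I = "\<lambda>i::nat. {real i..<real i + 1}"
  have sub: "?I i \<subseteq> {0..t}" if "i \<in> {T0..<T1}" for i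
  proof -
    have "real i + 1 \<le> real T1" using that by (simp add: nat_less_real_le)
    then show ?thesis using T by auto
  qed
  have f2: "(\<lambda>s. (f s)\<^sup>2) \<in> borel_measurable borel" using f by measurable
  have B2: "\<bar>(f s)\<^sup>2\<bar> \<le> B\<^sup>2" if "s \<in> {0..t}" for s
    using B[OF that] abs_le_square_iff[of "f s" B] by simp
  have int1: "integrable lborel (\<lambda>s. indicator (?I i) s * f s)" if "i \<in> {T0..<T1}" for i
  proof -
    have "set_integrable lborel (?I i) f"
      by (rule bounded_set_integrable[OF f _ emeasure_interval_finite(2) B]) (use sub[OF that] in auto)
    then show ?thesis unfolding set_integrable_def by simp
  qed
  have int2: "integrable lborel (\<lambda>s. indicator (?I i) s * (f s)\<^sup>2)" if "i \<in> {T0..<T1}" for i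
  proof -
    have "set_integrable lborel (?I i) (\<lambda>s. (f s)\<^sup>2)"
      by (rule bounded_set_integrable[OF f2 _ emeasure_interval_finite(2) B2]) (use sub[OF that] in auto)
    then show ?thesis unfolding set_integrable_def by simp
  qed
  have int0: "integrable lborel (\<lambda>s. indicator {0..t} s * (f s)\<^sup>2)"
  proof -
    have "set_integrable lborel {0..t} (\<lambda>s. (f s)\<^sup>2)"
      by (rule bounded_set_integrable[OF f2 _ emeasure_interval_finite(1) B2]) auto
    then show ?thesis unfolding set_integrable_def by simp
  qed
  have intI: "integrable lborel (\<lambda>s. indicator (?I i) s :: real)" for i
    by (rule integrable_real_indicator) auto
  have jensen: "(a i)\<^sup>2 \<le> (\<integral>s. indicator (?I i) s * (f s)\<^sup>2 \<partial>lborel)" if i: "i \<in> {T0..<T1}" for i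
  proof -
    have ai: "(\<integral>s. indicator (?I i) s * f s \<partial>lborel) = a i" using a[OF i] unfolding set_lebesgue_integral_def by simp
    have l: "(\<integral>s. indicator (?I i) s \<partial>lborel) = (1::real)" by simp
    have eq: "indicator (?I i) s * (f s - a i)\<^sup>2 = indicator (?I i) s * (f s)\<^sup>2 - 2 * a i * (indicator (?I i) s * f s) + (a i)\<^sup>2 * indicator (?I i) s" for s
      by (simp add: power2_diff algebra_simps)
    have "0 \<le> (\<integral>s. indicator (?I i) s * (f s - a i)\<^sup>2 \<partial>lborel)" by (rule Bochner_Integration.integral_nonneg) simp
    also have "\<dots> = (\<integral>s. indicator (?I i) s * (f s)\<^sup>2 \<partial>lborel) - 2 * a i * a i + (a i)\<^sup>2 * 1"
      unfolding eq using int1[OF i] int2[OF i] intI[of i] ai l by simp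
    finally show ?thesis by (simp add: power2_eq_square)
  qed
  have "(\<Sum>i = T0..<T1. (a i)\<^sup>2) \<le> (\<Sum>i = T0..<T1. \<integral>s. indicator (?I i) s * (f s)\<^sup>2 \<partial>lborel)"
    by (intro sum_mono jensen)
  also have "\<dots> = (\<integral>s. (\<Sum>i = T0..<T1. indicator (?I i) s * (f s)\<^sup>2) \<partial>lborel)"
    using int2 by (intro Bochner_Integration.integral_sum[symmetric]) auto
  also have "\<dots> \<le> (\<integral>s. indicator {0..t} s * (f s)\<^sup>2 \<partial>lborel)"
  proof (rule integral_mono)
    fix s
    have "(\<Sum>i = T0..<T1. indicator (?I i) s :: real) \<le> indicator {0..t} s"
    proof (cases "\<exists>i\<in>{T0..<T1}. s \<in> ?I i")
      case True
      then obtain i where i: "i \<in> {T0..<T1}" "s \<in> ?I i" by blast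
      have "indicator (?I j) s = (if j = i then 1 else 0 :: real)" for j
      proof (cases "j = i")
        case False
        then have "real j + 1 \<le> real i \<or> real i + 1 \<le> real j" by (auto simp: nat_less_real_le neq_iff)
        then show ?thesis using i(2) False by auto
      qed (use i in simp)
      then have "(\<Sum>j = T0..<T1. indicator (?I j) s :: real) = 1" using i(1) by simp
      moreover have "s \<in> {0..t}" using sub[OF i(1)] i(2) by blast
      ultimately show ?thesis by simp
    next
      case False
      then have "(\<Sum>i = T0..<T1. indicator (?I i) s :: real) = 0" by (intro sum.neutral) auto
      then show ?thesis by simp
    qed
    then show "(\<Sum>i = T0..<T1. indicator (?I i) s * (f s)\<^sup>2) \<le> indicator {0..t} s * (f s)\<^sup>2"
      unfolding sum_distrib_right[symmetric] by (rule mult_right_mono) simp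
  next
    show "integrable lborel (\<lambda>s. \<Sum>i = T0..<T1. indicator (?I i) s * (f s)\<^sup>2)"
      using int2 by (intro Bochner_Integration.integrable_sum) auto
  qed (rule int0)
  also have "\<dots> = (LINT s:{0..t}|lborel. (f s)\<^sup>2)" unfolding set_lebesgue_integral_def by simp
  finally show ?thesis .
qed

lemma unit_interval_integral_const:
  "(LINT s:{real i..<real i + 1}|lborel. Z (nat \<lfloor>s\<rfloor>)) = (Z i :: real)"
proof -
  have eq: "indicator {real i..<real i + 1} s *\<^sub>R Z (nat \<lfloor>s\<rfloor>) = indicator {real i..<real i + 1} s * Z i" for s
  proof (cases "s \<in> {real i..<real i + 1}")
    case True
    then have "\<lfloor>s\<rfloor> = int i" by (auto simp: floor_eq_iff)
    then show ?thesis by simp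
  qed simp
  show ?thesis unfolding set_lebesgue_integral_def eq by simp
qed

lemma step_path_bounded:
  fixes Z :: "nat \<Rightarrow> real"
  assumes "0 \<le> c" "c \<le> 1"
  shows "\<exists>B. \<forall>s\<in>{0..t}. \<bar>Z (nat \<lfloor>c * s\<rfloor>)\<bar> \<le> B"
proof (intro exI ballI)
  fix s assume s: "s \<in> {0..t}"
  then have "c * s \<le> t" using assms mult_left_le_one_le[of s c] by auto
  then have "nat \<lfloor>c * s\<rfloor> \<le> nat \<lfloor>t\<rfloor>" by (intro nat_mono floor_mono)
  then show "\<bar>Z (nat \<lfloor>c * s\<rfloor>)\<bar> \<le> (\<Sum>k\<le>nat \<lfloor>t\<rfloor>. \<bar>Z k\<bar>)"
    by (intro member_le_sum[where f = "\<lambda>k. \<bar>Z k\<bar>"]) auto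
qed

section \<open>Lower bounds for the three estimators\<close>

text \<open>
  Two of the \<open>m\<close> terms suffice, as \<open>(a - z)\<^sup>2 + (b - z)\<^sup>2 \<ge> (a - b)\<^sup>2 / 2\<close>.
\<close>

lemma Z2_sec_lower_bound:
  fixes Z :: "nat \<Rightarrow> nat \<Rightarrow> real"
  assumes m: "2 \<le> m" and t: "0 < t" and n: "real n \<le> t"
  shows "(\<Sum>i<n. (Z 1 i - Z 2 i)\<^sup>2) / (2 * (real m - 1)) \<le> t * Z2_sec m (\<lambda>i s. Z i (nat \<lfloor>s\<rfloor>)) t"
proof -
  define z where "z i s = Z i (nat \<lfloor>s\<rfloor>)" for i and s :: real
  define zb where "zb s = 1 / real m * (\<Sum>j = 1..m. z j s)" for s
  have zm: "z i \<in> borel_measurable borel" for i unfolding z_def using step_path_measurable[of "Z i" 1 0] by simp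
  have zbm: "zb \<in> borel_measurable borel" unfolding zb_def using zm by measurable
  have "\<forall>i. \<exists>B. \<forall>s\<in>{0..t}. \<bar>z i s\<bar> \<le> B"
    unfolding z_def using step_path_bounded[of 1 t] by simp
  then obtain Bz where "\<forall>i. \<forall>s\<in>{0..t}. \<bar>z i s\<bar> \<le> Bz i" by metis
  then have Bz: "\<And>i s. s \<in> {0..t} \<Longrightarrow> \<bar>z i s\<bar> \<le> Bz i" by blast
  have Bb: "\<bar>zb s\<bar> \<le> (\<Sum>j = 1..m. Bz j)" if s: "s \<in> {0..t}" for s
  proof -
    have "\<bar>zb s\<bar> = 1 / real m * \<bar>\<Sum>j = 1..m. z j s\<bar>" unfolding zb_def by (simp add: abs_mult)
    also have "\<dots> \<le> 1 * \<bar>\<Sum>j = 1..m. z j s\<bar>" using m by (intro mult_right_mono) auto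
    also have "\<dots> \<le> (\<Sum>j = 1..m. \<bar>z j s\<bar>)" using sum_abs by simp
    also have "\<dots> \<le> (\<Sum>j = 1..m. Bz j)" by (intro sum_mono Bz s)
    finally show ?thesis .
  qed
  have sm: "(\<lambda>s. (z i s - zb s)\<^sup>2) \<in> borel_measurable borel" for i using zm zbm by measurable
  have int: "set_integrable lborel {0..t} (\<lambda>s. (z i s - zb s)\<^sup>2)" for i
  proof (rule bounded_set_integrable[OF sm, where B = "(Bz i + (\<Sum>j = 1..m. Bz j))\<^sup>2"])
    fix s assume s: "s \<in> {0..t}"
    have "\<bar>z i s - zb s\<bar> \<le> Bz i + (\<Sum>j = 1..m. Bz j)" using Bz[OF s, of i] Bb[OF s] by linarith
    then show "\<bar>(z i s - zb s)\<^sup>2\<bar> \<le> (Bz i + (\<Sum>j = 1..m. Bz j))\<^sup>2" by (rule abs_square_le)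
  qed (auto simp: emeasure_interval_finite[unfolded infinity_ennreal_def])
  have m1: "0 < real m - 1" using m by simp
  define D where "D i = (LINT s:{0..t}|lborel. (z i s - zb s)\<^sup>2)" for i
  have D0: "0 \<le> D i" for i unfolding D_def set_lebesgue_integral_def by (intro Bochner_Integration.integral_nonneg) simp
  have "t * Z2_sec m z t = (\<Sum>i = 1..m. D i) / (real m - 1)"
    unfolding Z2_sec_def D_def zb_def using t by (simp add: sum_distrib_left[symmetric] sum_divide_distrib[symmetric])
  moreover have "D 1 + D 2 \<le> (\<Sum>i = 1..m. D i)"
  proof -
    have "(\<Sum>i\<in>{1, 2}. D i) \<le> (\<Sum>i = 1..m. D i)" using m D0 by (intro sum_mono2) auto
    then show ?thesis by simp
  qed
  moreover have "(\<Sum>i<n. (Z 1 i - Z 2 i)\<^sup>2) / 2 \<le> D 1 + D 2"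
  proof -
    have dm: "(\<lambda>s. z 1 s - z 2 s) \<in> borel_measurable borel" using zm by measurable
    have "(\<Sum>i = 0..<n. (Z 1 i - Z 2 i)\<^sup>2) \<le> (LINT s:{0..t}|lborel. (z 1 s - z 2 s)\<^sup>2)"
    proof (rule integral_square_ge_sum[OF dm _ n, where B = "Bz 1 + Bz 2"])
      show "\<bar>z 1 s - z 2 s\<bar> \<le> Bz 1 + Bz 2" if "s \<in> {0..t}" for s
        using Bz[OF that, of 1] Bz[OF that, of 2] by linarith
      show "Z 1 i - Z 2 i = (LINT s:{real i..<real i + 1}|lborel. z 1 s - z 2 s)" for i
        unfolding z_def using unit_interval_integral_const[of i "\<lambda>k. Z 1 k - Z 2 k"] by simp
    qed
    also have "\<dots> \<le> (LINT s:{0..t}|lborel. 2 * ((z 1 s - zb s)\<^sup>2 + (z 2 s - zb s)\<^sup>2))"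
    proof (rule set_integral_mono)
      have "\<bar>(z 1 s - z 2 s)\<^sup>2\<bar> \<le> (Bz 1 + Bz 2)\<^sup>2" if "s \<in> {0..t}" for s
      proof -
        have "\<bar>z 1 s - z 2 s\<bar> \<le> Bz 1 + Bz 2" using Bz[OF that, of 1] Bz[OF that, of 2] by linarith
        then show ?thesis by (rule abs_square_le)
      qed
      then show "set_integrable lborel {0..t} (\<lambda>s. (z 1 s - z 2 s)\<^sup>2)"
        using dm by (intro bounded_set_integrable[where B = "(Bz 1 + Bz 2)\<^sup>2"] emeasure_interval_finite) auto
      show "set_integrable lborel {0..t} (\<lambda>s. 2 * ((z 1 s - zb s)\<^sup>2 + (z 2 s - zb s)\<^sup>2))"
        using int[of 1] int[of 2] by simp
      fix s
      have "0 \<le> ((z 1 s - zb s) + (z 2 s - zb s))\<^sup>2" by simp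
      moreover have "(z 1 s - z 2 s)\<^sup>2 = 2 * ((z 1 s - zb s)\<^sup>2 + (z 2 s - zb s)\<^sup>2) - ((z 1 s - zb s) + (z 2 s - zb s))\<^sup>2"
        by algebra
      ultimately show "(z 1 s - z 2 s)\<^sup>2 \<le> 2 * ((z 1 s - zb s)\<^sup>2 + (z 2 s - zb s)\<^sup>2)" by linarith
    qed
    also have "\<dots> = 2 * (D 1 + D 2)" unfolding D_def using int[of 1] int[of 2] by simp
    finally show ?thesis by (simp add: atLeast0LessThan)
  qed
  ultimately have "(\<Sum>i<n. (Z 1 i - Z 2 i)\<^sup>2) / 2 / (real m - 1) \<le> t * Z2_sec m z t"
    using m1 by (simp only: divide_right_mono less_imp_le order_trans)
  then show ?thesis unfolding z_def by simp
qed

text \<open>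
  Only the last batch is kept. It compares \<open>z s\<close> with the value of the path at the earlier time \<open>c * s\<close>.
\<close>

lemma Z2_bm_lower_bound:
  fixes Z :: "nat \<Rightarrow> real"
  assumes m: "2 \<le> m" and t: "0 < t" and n: "real n \<le> t"
  defines "c \<equiv> 1 - 1 / real m"
  shows "c\<^sup>2 / (real m - 1) * (\<Sum>i = T0..<n. (Z i - (LINT s:{real i..<real i + 1}|lborel. Z (nat \<lfloor>c * s\<rfloor>)) / c)\<^sup>2)
    \<le> t * Z2_bm m (\<lambda>s. Z (nat \<lfloor>s\<rfloor>)) t"
proof -
  have m0: "0 < real m" and m1: "0 < real m - 1" using m by auto
  have c: "0 < c" "c \<le> 1" unfolding c_def using m by auto
  define z where "z s = Z (nat \<lfloor>s\<rfloor>)" for s :: real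
  define f where "f k s = z (real k / real m * s) - z ((real k - 1) / real m * s) - 1 / real m * z s" for k :: nat and s
  define D where "D k = (LINT s:{0..t}|lborel. (f k s)\<^sup>2)" for k
  have D0: "0 \<le> D i" for i unfolding D_def set_lebesgue_integral_def by (intro Bochner_Integration.integral_nonneg) simp
  have "t * Z2_bm m z t = (\<Sum>i = 1..m. D i) / (real m - 1)"
    unfolding Z2_bm_def D_def f_def using t by (simp add: sum_distrib_left[symmetric] sum_divide_distrib[symmetric])
  moreover have "D m \<le> (\<Sum>i = 1..m. D i)" using m D0 by (intro member_le_sum) auto
  moreover have "c\<^sup>2 * (\<Sum>i = T0..<n. (Z i - (LINT s:{real i..<real i + 1}|lborel. Z (nat \<lfloor>c * s\<rfloor>)) / c)\<^sup>2) \<le> D m"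
  proof -
    define G where "G i = (LINT s:{real i..<real i + 1}|lborel. Z (nat \<lfloor>c * s\<rfloor>))" for i :: nat
    have fm: "f m = (\<lambda>s. c * z s - Z (nat \<lfloor>c * s\<rfloor>))"
      unfolding f_def z_def c_def using m0 by (auto simp: fun_eq_iff algebra_simps diff_divide_distrib)
    have zm: "z \<in> borel_measurable borel" unfolding z_def using step_path_measurable[of Z 1 0] by simp
    have Zc: "(\<lambda>s. Z (nat \<lfloor>c * s\<rfloor>)) \<in> borel_measurable borel" using step_path_measurable[of Z c 0] by simp
    have "\<exists>B. \<forall>s\<in>{0..t}. \<bar>z s\<bar> \<le> B"
      using step_path_bounded[of 1 t Z] unfolding z_def by simp
    then obtain B1 where B1: "\<And>s. s \<in> {0..t} \<Longrightarrow> \<bar>z s\<bar> \<le> B1" by blast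
    have "\<exists>B. \<forall>s\<in>{0..t}. \<bar>Z (nat \<lfloor>c * s\<rfloor>)\<bar> \<le> B"
      using step_path_bounded[of c t Z] c by simp
    then obtain B2 where B2: "\<And>s. s \<in> {0..t} \<Longrightarrow> \<bar>Z (nat \<lfloor>c * s\<rfloor>)\<bar> \<le> B2" by blast
    have "(\<Sum>i = T0..<n. (c * Z i - G i)\<^sup>2) \<le> D m"
      unfolding D_def
    proof (rule integral_square_ge_sum[OF _ _ n, where B = "c * B1 + B2"])
      show "f m \<in> borel_measurable borel" unfolding fm using zm Zc by measurable
      show "\<bar>f m s\<bar> \<le> c * B1 + B2" if s: "s \<in> {0..t}" for s
      proof -
        have "\<bar>c * z s\<bar> \<le> c * B1" using B1[OF s] c by (simp add: abs_mult)
        then show ?thesis unfolding fm using B2[OF s] by linarith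
      qed
      fix i assume i: "i \<in> {T0..<n}"
      have sub: "{real i..<real i + 1} \<subseteq> {0..t}"
      proof -
        have "real i + 1 \<le> real n" using i by (simp add: nat_less_real_le)
        then show ?thesis using n by auto
      qed
      have i1: "set_integrable lborel {real i..<real i + 1} z"
        by (rule bounded_set_integrable[OF zm _ emeasure_interval_finite(2) B1]) (use sub in auto)
      have i2: "set_integrable lborel {real i..<real i + 1} (\<lambda>s. Z (nat \<lfloor>c * s\<rfloor>))"
        by (rule bounded_set_integrable[OF Zc _ emeasure_interval_finite(2) B2]) (use sub in auto)
      show "c * Z i - G i = (LINT s:{real i..<real i + 1}|lborel. f m s)"
        unfolding fm using i1 i2 unit_interval_integral_const[of i Z] unfolding G_def z_def
        by (subst set_integral_diff(2)) auto
    qed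
    also have "(\<Sum>i = T0..<n. (c * Z i - G i)\<^sup>2) = c\<^sup>2 * (\<Sum>i = T0..<n. (Z i - G i / c)\<^sup>2)"
      unfolding sum_distrib_left power_mult_distrib[symmetric] using c by (simp add: right_diff_distrib)
    finally show ?thesis unfolding G_def .
  qed
  ultimately have "c\<^sup>2 * (\<Sum>i = T0..<n. (Z i - (LINT s:{real i..<real i + 1}|lborel. Z (nat \<lfloor>c * s\<rfloor>)) / c)\<^sup>2) / (real m - 1) \<le> t * Z2_bm m z t"
    using m1 by (simp only: divide_right_mono less_imp_le order_trans)
  then show ?thesis unfolding z_def by simp
qed

lemma sum_squares_half:
  "(\<Sum>i<n. (real i + 1 / 2)\<^sup>2) = real n * (4 * (real n)\<^sup>2 - 1) / 12"
  by (induction n) (simp_all add: field_simps power2_eq_square)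

text \<open>
  The slope \<open>b\<close> may depend on the whole path. If the line of slope \<open>b\<close> is close to the path up to \<open>T\<close>, then
  \<open>b\<close> is close to the least squares slope \<open>\<beta>\<close> of the path up to \<open>T\<close>, which may take its place after \<open>T\<close>.
\<close>

lemma regression_slope_bound:
  fixes Z h :: "nat \<Rightarrow> real" and T n :: nat and b \<beta> :: real
  defines "h \<equiv> \<lambda>i. real i + 1 / 2"
  defines "\<beta> \<equiv> (\<Sum>i<T. h i * Z i) / (\<Sum>i<T. (h i)\<^sup>2)"
  assumes T: "0 < T" and n: "n \<le> 3 * T" "T \<le> n"
  shows "(\<Sum>i = T..<n. (Z i - \<beta> * h i)\<^sup>2) \<le> 82 * (\<Sum>i<n. (Z i - b * h i)\<^sup>2)"
proof -
  define H where "H = (\<Sum>i<T. (h i)\<^sup>2)"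
  define Q where "Q = (\<Sum>i<n. (Z i - b * h i)\<^sup>2)"
  have H_eq: "H = real T * (4 * (real T)\<^sup>2 - 1) / 12" unfolding H_def h_def by (rule sum_squares_half)
  have T1: "1 \<le> real T" using T by simp
  then have TT: "1 \<le> (real T)\<^sup>2" by simp
  then have "0 < 4 * (real T)\<^sup>2 - 1" by linarith
  then have "0 < real T * (4 * (real T)\<^sup>2 - 1)" using T1 by (intro mult_pos_pos) auto
  then have H0: "0 < H" unfolding H_eq by simp
  have Hn: "(\<Sum>i<n. (h i)\<^sup>2) \<le> 40 * H"
  proof -
    have "(\<Sum>i<n. (h i)\<^sup>2) \<le> (\<Sum>i<3 * T. (h i)\<^sup>2)" using n by (intro sum_mono2) auto
    also have "\<dots> = real (3 * T) * (4 * (real (3 * T))\<^sup>2 - 1) / 12" unfolding h_def by (rule sum_squares_half)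
    also have "\<dots> \<le> 40 * H"
    proof -
      define a where "a = (real T)\<^sup>2"
      have "real T * ((36 * a - 1) * 3 / 12) \<le> real T * (40 * (4 * a - 1) / 12)"
        by (rule mult_left_mono) (use TT in \<open>simp_all add: a_def\<close>)
      moreover have "real (3 * T) * (4 * (real (3 * T))\<^sup>2 - 1) / 12 = real T * ((36 * a - 1) * 3 / 12)"
        unfolding a_def by (simp add: power2_eq_square)
      moreover have "40 * H = real T * (40 * (4 * a - 1) / 12)" unfolding H_eq a_def by simp
      ultimately show ?thesis by (simp only:)
    qed
    finally show ?thesis .
  qed
  have QT: "(\<Sum>i<T. (Z i - b * h i)\<^sup>2) \<le> Q" unfolding Q_def using n by (intro sum_mono2) auto
  have "(\<beta> - b) * H = (\<Sum>i<T. h i * (Z i - b * h i))"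
  proof -
    have "\<beta> * H = (\<Sum>i<T. h i * Z i)" unfolding \<beta>_def H_def[symmetric] using H0 by simp
    then show ?thesis unfolding H_def by (simp add: left_diff_distrib right_diff_distrib sum_subtractf sum_distrib_left power2_eq_square mult_ac)
  qed
  then have "((\<beta> - b) * H)\<^sup>2 \<le> H * (\<Sum>i<T. (Z i - b * h i)\<^sup>2)"
    unfolding H_def using Cauchy_Schwarz_ineq_sum[of h "\<lambda>i. Z i - b * h i" "{..<T}"] by simp
  also have "\<dots> \<le> H * Q" using H0 QT by (intro mult_left_mono) auto
  finally have "H * ((\<beta> - b)\<^sup>2 * H) \<le> H * Q" by (simp add: power2_eq_square mult_ac)
  then have slope: "(\<beta> - b)\<^sup>2 * H \<le> Q" using H0 by simp
  have "(\<Sum>i = T..<n. (Z i - \<beta> * h i)\<^sup>2) \<le> (\<Sum>i<n. (Z i - \<beta> * h i)\<^sup>2)"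
    by (intro sum_mono2) auto
  also have "\<dots> \<le> (\<Sum>i<n. 2 * (Z i - b * h i)\<^sup>2 + 2 * (\<beta> - b)\<^sup>2 * (h i)\<^sup>2)"
  proof (rule sum_mono)
    fix i
    have "0 \<le> ((Z i - b * h i) + (\<beta> - b) * h i)\<^sup>2" by simp
    moreover have "(Z i - \<beta> * h i)\<^sup>2 = 2 * (Z i - b * h i)\<^sup>2 + 2 * (\<beta> - b)\<^sup>2 * (h i)\<^sup>2 - ((Z i - b * h i) + (\<beta> - b) * h i)\<^sup>2"
      by algebra
    ultimately show "(Z i - \<beta> * h i)\<^sup>2 \<le> 2 * (Z i - b * h i)\<^sup>2 + 2 * (\<beta> - b)\<^sup>2 * (h i)\<^sup>2" by linarith
  qed
  also have "\<dots> = 2 * Q + 2 * (\<beta> - b)\<^sup>2 * (\<Sum>i<n. (h i)\<^sup>2)"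
    unfolding Q_def by (simp add: sum.distrib sum_distrib_left)
  also have "\<dots> \<le> 2 * Q + 2 * (\<beta> - b)\<^sup>2 * (40 * H)" using Hn by (intro add_left_mono mult_left_mono) auto
  also have "\<dots> \<le> 82 * Q" using slope by simp
  finally show ?thesis unfolding Q_def .
qed

lemma Z2_rs_inner_integrable:
  fixes Z :: "nat \<Rightarrow> real"
  shows "set_integrable lborel {0..t} (Z2_rs_inner (\<lambda>s. Z (nat \<lfloor>s\<rfloor>)))"
proof (cases "0 \<le> t")
  case True
  define z where "z s = Z (nat \<lfloor>s\<rfloor>)" for s :: real
  have zm[measurable]: "z \<in> borel_measurable borel" unfolding z_def using step_path_measurable[of Z 1 0] by simp
  have "\<exists>B. \<forall>s\<in>{0..t}. \<bar>z s\<bar> \<le> B"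
    using step_path_bounded[of 1 t Z] unfolding z_def by simp
  then obtain B where B: "\<And>s. s \<in> {0..t} \<Longrightarrow> \<bar>z s\<bar> \<le> B" by blast
  have eq: "Z2_rs_inner z u = (if u \<le> 0 then 0 else 1 / u * (\<integral>s. (if 0 \<le> s \<and> s \<le> u then (z s - s / u * z u)\<^sup>2 else 0) \<partial>lborel))" for u
    unfolding Z2_rs_inner_def set_lebesgue_integral_def
    by (auto intro!: Bochner_Integration.integral_cong simp: indicator_def)
  have "(\<lambda>p::real \<times> real. if 0 \<le> snd p \<and> snd p \<le> fst p then (z (snd p) - snd p / fst p * z (fst p))\<^sup>2 else 0) \<in> borel_measurable (borel \<Otimes>\<^sub>M borel)"
    by measurable
  moreover have "sets (borel \<Otimes>\<^sub>M borel :: (real \<times> real) measure) = sets (borel \<Otimes>\<^sub>M lborel)"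
    by (intro sets_pair_measure_cong) auto
  ultimately have "(\<lambda>p::real \<times> real. if 0 \<le> snd p \<and> snd p \<le> fst p then (z (snd p) - snd p / fst p * z (fst p))\<^sup>2 else 0) \<in> borel_measurable (borel \<Otimes>\<^sub>M lborel)"
    using measurable_cong_sets by blast
  then have [measurable]: "(\<lambda>u. \<integral>s. (if 0 \<le> s \<and> s \<le> u then (z s - s / u * z u)\<^sup>2 else 0) \<partial>lborel) \<in> borel_measurable borel"
    by (intro lborel.borel_measurable_lebesgue_integral) (simp add: split_beta')
  have meas: "Z2_rs_inner z \<in> borel_measurable borel"
    unfolding eq[abs_def] by measurable
  have "set_integrable lborel {0..t} (Z2_rs_inner z)"
  proof (rule bounded_set_integrable[OF meas _ emeasure_interval_finite(1)])
    fix u assume u: "u \<in> {0..t}"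
    show "\<bar>Z2_rs_inner z u\<bar> \<le> (2 * B)\<^sup>2"
    proof (cases "u \<le> 0")
      case False
      have b: "\<bar>(z s - s / u * z u)\<^sup>2\<bar> \<le> (2 * B)\<^sup>2" if s: "s \<in> {0..u}" for s
      proof -
        define v where "v = s / u * z u"
        have "\<bar>v\<bar> \<le> 1 * B"
          unfolding abs_mult v_def using s u False B[OF u] by (intro mult_mono) auto
        moreover have "\<bar>z s\<bar> \<le> B" using s u by (intro B) auto
        ultimately have "\<bar>z s - s / u * z u\<bar> \<le> 2 * B" unfolding v_def[symmetric] by linarith
        then show ?thesis by (rule abs_square_le)
      qed
      have m: "(\<lambda>s. (z s - s / u * z u)\<^sup>2) \<in> borel_measurable borel" by measurable
      have int: "set_integrable lborel {0..u} (\<lambda>s. (z s - s / u * z u)\<^sup>2)"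
        by (rule bounded_set_integrable[OF m _ emeasure_interval_finite(1) b]) auto
      have "set_integrable lborel {0..u} (\<lambda>s. (2 * B)\<^sup>2)"
        by (rule bounded_set_integrable[OF _ _ emeasure_interval_finite(1) order_refl]) auto
      from set_integral_mono[OF int this] b
      have "(LINT s:{0..u}|lborel. (z s - s / u * z u)\<^sup>2) \<le> (LINT s:{0..u}|lborel. (2 * B)\<^sup>2)" by fastforce
      also have "\<dots> = u * (2 * B)\<^sup>2" using False by (simp add: set_lebesgue_integral_def)
      finally have "1 / u * (LINT s:{0..u}|lborel. (z s - s / u * z u)\<^sup>2) \<le> 1 / u * (u * (2 * B)\<^sup>2)"
        using False by (intro mult_left_mono) auto
      moreover have "0 \<le> 1 / u * (LINT s:{0..u}|lborel. (z s - s / u * z u)\<^sup>2)"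
        unfolding set_lebesgue_integral_def using False by (intro mult_nonneg_nonneg Bochner_Integration.integral_nonneg) auto
      ultimately show ?thesis using False unfolding Z2_rs_inner_def by simp
    qed (simp add: Z2_rs_inner_def)
  qed auto
  then show ?thesis unfolding z_def .
qed (simp add: set_integrable_def)

text \<open>
  For \<open>u\<close> between \<open>N / 2\<close> and \<open>N\<close> the inner process measures a distance to a line on \<open>[0, u]\<close>, which contains
  the unit intervals up to \<open>n\<close>; the number \<open>i + 1/2\<close> is the mean of the identity on \<open>[i, i + 1)\<close>.
  The constant is \<open>164 = 2 * 82\<close>, where 82 is the loss of replacing the slope and 2 that of
  averaging over half of \<open>[0, N]\<close>.
\<close>

lemma Z2_rs_lower_bound:
  fixes Z h :: "nat \<Rightarrow> real" and n T :: nat and N t :: real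
  defines "h \<equiv> \<lambda>i. real i + 1 / 2"
  assumes N: "0 < N" "N \<le> t" and n: "real n \<le> N / 2" and T: "0 < T" "n \<le> 3 * T" "T \<le> n"
  shows "1 / 164 * (\<Sum>i = T..<n. (Z i - (\<Sum>i<T. h i * Z i) / (\<Sum>i<T. (h i)\<^sup>2) * h i)\<^sup>2)
    \<le> t * Z2_rs (\<lambda>s. Z (nat \<lfloor>s\<rfloor>)) t"
proof -
  define S where "S = (\<Sum>i = T..<n. (Z i - (\<Sum>i<T. h i * Z i) / (\<Sum>i<T. (h i)\<^sup>2) * h i)\<^sup>2)"
  have S0: "0 \<le> S" unfolding S_def by (intro sum_nonneg) simp
  define z where "z s = Z (nat \<lfloor>s\<rfloor>)" for s :: real
  have zm[measurable]: "z \<in> borel_measurable borel" unfolding z_def using step_path_measurable[of Z 1 0] by simp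
  have inner: "S / 82 / N \<le> Z2_rs_inner z u" if u: "N / 2 \<le> u" "u \<le> N" for u
  proof -
    have u0: "0 < u" using u N by simp
    define b where "b = z u / u"
    have "\<exists>B. \<forall>s\<in>{0..u}. \<bar>z s\<bar> \<le> B"
      using step_path_bounded[of 1 u Z] unfolding z_def by simp
    then obtain B where B: "\<And>s. s \<in> {0..u} \<Longrightarrow> \<bar>z s\<bar> \<le> B" by blast
    have "S / 82 \<le> (\<Sum>i<n. (Z i - b * h i)\<^sup>2)"
      using regression_slope_bound[OF T, of Z b] unfolding S_def h_def by simp
    also have "\<dots> = (\<Sum>i = 0..<n. (Z i - b * h i)\<^sup>2)" by (simp add: atLeast0LessThan)
    also have "\<dots> \<le> (LINT s:{0..u}|lborel. (z s - b * s)\<^sup>2)"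
    proof (rule integral_square_ge_sum[where B = "B + \<bar>b\<bar> * u"])
      show "(\<lambda>s. z s - b * s) \<in> borel_measurable borel" by measurable
      show "real n \<le> u" using n u by simp
      show "\<bar>z s - b * s\<bar> \<le> B + \<bar>b\<bar> * u" if "s \<in> {0..u}" for s
      proof -
        have "\<bar>b * s\<bar> \<le> \<bar>b\<bar> * u" unfolding abs_mult using that by (intro mult_left_mono) auto
        then show ?thesis using B[OF that] by linarith
      qed
      fix i assume i: "i \<in> {0..<n}"
      have sub: "{real i..<real i + 1} \<subseteq> {0..u}"
      proof -
        have "real i + 1 \<le> real n" using i by (simp add: nat_less_real_le)
        then show ?thesis using n u by auto
      qed
      have i1: "set_integrable lborel {real i..<real i + 1} z"
        by (rule bounded_set_integrable[OF zm _ emeasure_interval_finite(2) B]) (use sub in auto)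
      have idm: "(\<lambda>s::real. s) \<in> borel_measurable borel" by simp
      have i2: "set_integrable lborel {real i..<real i + 1} (\<lambda>s. s)"
        by (rule bounded_set_integrable[OF idm _ emeasure_interval_finite(2), where B = "real i + 1"]) auto
      have hI: "(LINT s:{real i..<real i + 1}|lborel. s) = h i"
      proof -
        have "(LINT s:{real i..<real i + 1}|lborel. s) = (\<integral>s. s ^ 1 * indicator {real i..real i + 1} s \<partial>lborel)"
          unfolding set_lebesgue_integral_def
        proof (rule integral_cong_AE)
          show "AE s in lborel. indicator {real i..<real i + 1} s *\<^sub>R s = s ^ 1 * indicator {real i..real i + 1} s"
            using AE_lborel_singleton[of "real i + 1"] by eventually_elim (auto simp: indicator_def)
        qed auto
        also have "\<dots> = ((real i + 1) ^ Suc 1 - real i ^ Suc 1) / real (Suc 1)"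
          by (rule integral_power) simp
        also have "\<dots> = h i" unfolding h_def by (simp add: power2_eq_square field_simps)
        finally show ?thesis .
      qed
      show "Z i - b * h i = (LINT s:{real i..<real i + 1}|lborel. z s - b * s)"
        using i1 i2 unit_interval_integral_const[of i Z] hI unfolding z_def[symmetric]
        by (subst set_integral_diff(2)) auto
    qed
    also have "\<dots> = u * Z2_rs_inner z u" unfolding Z2_rs_inner_def b_def using u0 by (simp add: mult.commute)
    finally have le: "S / 82 \<le> u * Z2_rs_inner z u" .
    then have "0 \<le> u * Z2_rs_inner z u" using S0 by linarith
    then have "0 \<le> Z2_rs_inner z u" using u0 by (simp add: zero_le_mult_iff)
    then have "u * Z2_rs_inner z u \<le> N * Z2_rs_inner z u" using u by (intro mult_right_mono)
    with le have "S / 82 \<le> N * Z2_rs_inner z u" by linarith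
    then show ?thesis using N by (simp only: pos_divide_le_eq mult.commute)
  qed
  have nonneg: "0 \<le> Z2_rs_inner z u" for u
    unfolding Z2_rs_inner_def set_lebesgue_integral_def by (auto intro!: mult_nonneg_nonneg Bochner_Integration.integral_nonneg)
  have int: "set_integrable lborel {0..t} (Z2_rs_inner z)" unfolding z_def by (rule Z2_rs_inner_integrable)
  have "S / 164 = (\<integral>u. indicator {N / 2..N} u * (S / 82 / N) \<partial>lborel)"
    using N by (simp add: field_simps)
  also have "\<dots> \<le> (\<integral>u. indicator {0..t} u * Z2_rs_inner z u \<partial>lborel)"
  proof (rule integral_mono)
    show "integrable lborel (\<lambda>u. indicator {N / 2..N} u * (S / 82 / N))"
      by (intro integrable_mult_left integrable_real_indicator) (use N in auto)
    show "integrable lborel (\<lambda>u. indicator {0..t} u * Z2_rs_inner z u)"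
      using int unfolding set_integrable_def by simp
    fix u
    show "indicator {N / 2..N} u * (S / 82 / N) \<le> indicator {0..t} u * Z2_rs_inner z u"
    proof (cases "u \<in> {N / 2..N}")
      case True
      then have "u \<in> {0..t}" using N by auto
      then show ?thesis using inner[of u] True by simp
    next
      case False
      then have "indicator {N / 2..N} u * (S / 82 / N) = 0" by simp
      then show ?thesis using nonneg[of u] by (simp only:) simp
    qed
  qed
  also have "\<dots> = t * Z2_rs z t" unfolding Z2_rs_def set_lebesgue_integral_def using N by simp
  finally show ?thesis unfolding S_def z_def by simp
qed

section \<open>The increments of the queue\<close>

text \<open>
  Along \<open>x\<^sub>0, 2x\<^sub>0, 4x\<^sub>0, \<dots>\<close> the tail decays geometrically with a ratio below \<open>1/4\<close>, as \<open>\<alpha> > 2\<close>.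
\<close>

lemma regularly_varying_tail_second_moment:
  assumes M: "prob_space M" and U[measurable]: "U \<in> borel_measurable M" and nn: "AE \<omega> in M. 0 \<le> U \<omega>"
    and rv: "regularly_varying (\<lambda>x. measure M {\<omega> \<in> space M. x < U \<omega>}) (- \<alpha>)" and \<alpha>: "2 < \<alpha>"
  shows "integrable M (\<lambda>\<omega>. (U \<omega>)\<^sup>2)"
proof -
  interpret prob_space M by (rule M)
  define f where "f x = prob {\<omega> \<in> space M. x < U \<omega>}" for x
  have "(2::real) powr (- \<alpha>) < 2 powr (- 2)" using \<alpha> by (intro powr_less_mono) auto
  also have "(2::real) powr (- 2) = 1 / 4" by (simp add: powr_minus powr_numeral)
  finally obtain r where r: "2 powr (- \<alpha>) < r" "r < 1 / 4" using dense by blast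
  have r0: "0 < r" using r(1) powr_gt_zero[of 2 "- \<alpha>"] by linarith
  have lim: "((\<lambda>x. f (2 * x) / f x) \<longlongrightarrow> 2 powr (- \<alpha>)) at_top" and pos: "\<exists>X. \<forall>x\<ge>X. 0 < f x"
    using rv unfolding regularly_varying_def f_def by auto
  have "\<forall>\<^sub>F x in at_top. f (2 * x) / f x < r \<and> 0 < f x"
    by (rule eventually_conj[OF order_tendstoD(2)[OF lim r(1)]]) (use pos in \<open>simp add: eventually_at_top_linorder\<close>)
  then obtain x1 where x1: "\<And>x. x1 \<le> x \<Longrightarrow> f (2 * x) / f x < r \<and> 0 < f x"
    unfolding eventually_at_top_linorder by blast
  define x0 where "x0 = max 1 x1"
  have x0: "1 \<le> x0" unfolding x0_def by simp
  have step: "f (2 * x) \<le> r * f x" if "x0 \<le> x" for x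
  proof -
    have "f (2 * x) / f x < r" and b: "0 < f x" using x1[of x] that unfolding x0_def by auto
    then show ?thesis using pos_divide_less_eq[OF b, of "f (2 * x)" r] by simp
  qed
  have geom: "f (2 ^ j * x0) \<le> r ^ j" for j
  proof (induction j)
    case 0
    show ?case unfolding f_def by (simp add: prob_le_1)
  next
    case (Suc j)
    have "x0 \<le> 2 ^ j * x0" using x0 by simp
    from step[OF this] have "f (2 ^ Suc j * x0) \<le> r * f (2 ^ j * x0)" by (simp add: mult.assoc)
    also have "\<dots> \<le> r * r ^ j" using Suc r0 by (intro mult_left_mono) auto
    finally show ?case by simp
  qed
  let ?g = "\<lambda>j \<omega>. ennreal ((2 ^ Suc j * x0)\<^sup>2) * indicator {\<omega> \<in> space M. 2 ^ j * x0 < U \<omega>} \<omega>"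
  have pt: "ennreal ((U \<omega>)\<^sup>2) \<le> ennreal (x0\<^sup>2) + (\<Sum>j. ?g j \<omega>)" if \<omega>: "\<omega> \<in> space M" "0 \<le> U \<omega>" for \<omega>
  proof (cases "U \<omega> \<le> x0")
    case True
    then have "(U \<omega>)\<^sup>2 \<le> x0\<^sup>2" using \<omega> by (intro power_mono) auto
    then have "ennreal ((U \<omega>)\<^sup>2) \<le> ennreal (x0\<^sup>2)" by (rule ennreal_leI)
    then show ?thesis by (simp add: add_increasing2)
  next
    case False
    have "\<exists>j. U \<omega> \<le> 2 ^ j * x0"
    proof -
      obtain j where "U \<omega> < 2 ^ j" using real_arch_pow[of 2 "U \<omega>"] by auto
      also have "2 ^ j \<le> 2 ^ j * x0" using x0 by simp
      finally show ?thesis by (intro exI[of _ j]) simp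
    qed
    then obtain j where j: "U \<omega> \<le> 2 ^ j * x0" "\<And>i. i < j \<Longrightarrow> \<not> U \<omega> \<le> 2 ^ i * x0"
      using exists_least_iff[of "\<lambda>j. U \<omega> \<le> 2 ^ j * x0"] by blast
    have "j \<noteq> 0" using j(1) False by (cases j) auto
    then obtain i where i: "j = Suc i" by (cases j) auto
    have "(U \<omega>)\<^sup>2 \<le> (2 ^ Suc i * x0)\<^sup>2" using j(1) \<omega> unfolding i by (intro power_mono) auto
    then have "ennreal ((U \<omega>)\<^sup>2) \<le> ?g i \<omega>" using j(2)[of i] \<omega> unfolding i by (simp add: ennreal_leI)
    also have "\<dots> = (\<Sum>j\<in>{i}. ?g j \<omega>)"
      by (simp only: sum.empty sum.insert finite.emptyI empty_iff add_0_right not_False_eq_True)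
    also have "\<dots> \<le> (\<Sum>j. ?g j \<omega>)" by (rule sum_le_suminf) auto
    finally show ?thesis by (simp add: add_increasing)
  qed
  have "(\<integral>\<^sup>+\<omega>. ennreal ((U \<omega>)\<^sup>2) \<partial>M) \<le> (\<integral>\<^sup>+\<omega>. ennreal (x0\<^sup>2) + (\<Sum>j. ?g j \<omega>) \<partial>M)"
  proof (rule nn_integral_mono_AE)
    show "AE \<omega> in M. ennreal ((U \<omega>)\<^sup>2) \<le> ennreal (x0\<^sup>2) + (\<Sum>j. ?g j \<omega>)"
      using nn AE_space
    proof eventually_elim
      case (elim \<omega>)
      show ?case by (rule pt[OF elim(2,1)])
    qed
  qed
  also have "\<dots> = ennreal (x0\<^sup>2) + (\<integral>\<^sup>+\<omega>. (\<Sum>j. ?g j \<omega>) \<partial>M)"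
    by (subst nn_integral_add) (auto simp: emeasure_space_1)
  also have "(\<integral>\<^sup>+\<omega>. (\<Sum>j. ?g j \<omega>) \<partial>M) = (\<Sum>j. \<integral>\<^sup>+\<omega>. ?g j \<omega> \<partial>M)" by (rule nn_integral_suminf) measurable
  also have "\<dots> \<le> (\<Sum>j. ennreal (4 * x0\<^sup>2 * (4 * r) ^ j))"
  proof (intro suminf_le allI)
    fix j
    have "(\<integral>\<^sup>+\<omega>. ?g j \<omega> \<partial>M) = ennreal ((2 ^ Suc j * x0)\<^sup>2) * ennreal (f (2 ^ j * x0))"
      unfolding f_def by (subst nn_integral_cmult_indicator) (auto simp: emeasure_eq_measure)
    also have "\<dots> = ennreal ((2 ^ Suc j * x0)\<^sup>2 * f (2 ^ j * x0))" by (rule ennreal_mult[symmetric]) (auto simp: f_def)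
    also have "\<dots> \<le> ennreal ((2 ^ Suc j * x0)\<^sup>2 * r ^ j)" by (intro ennreal_leI mult_left_mono geom) auto
    also have "(2 ^ Suc j * x0)\<^sup>2 * r ^ j = 4 * x0\<^sup>2 * (4 * r) ^ j"
    proof -
      have "((2::real) ^ j)\<^sup>2 = 4 ^ j" by (simp add: power_mult[symmetric] mult.commute[of j 2] power_mult)
      then show ?thesis by (simp add: power_mult_distrib)
    qed
    finally show "(\<integral>\<^sup>+\<omega>. ?g j \<omega> \<partial>M) \<le> ennreal (4 * x0\<^sup>2 * (4 * r) ^ j)" .
  qed auto
  also have "\<dots> = ennreal (\<Sum>j. 4 * x0\<^sup>2 * (4 * r) ^ j)"
    using r r0 by (intro suminf_ennreal2 summable_mult summable_geometric) auto
  also have "ennreal (x0\<^sup>2) + ennreal (\<Sum>j. 4 * x0\<^sup>2 * (4 * r) ^ j) < \<infinity>"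
    unfolding infinity_ennreal_def less_top[symmetric] by (simp add: ennreal_add_eq_top)
  finally have "(\<integral>\<^sup>+\<omega>. ennreal ((U \<omega>)\<^sup>2) \<partial>M) < \<infinity>" by simp
  then show ?thesis by (intro integrableI_bounded) auto
qed

lemma delay_eq_lindley: "delay A U n \<omega> = lindley 0 (\<lambda>k. U k \<omega> - A (Suc k) \<omega>) n"
  by (induction n) (simp_all add: algebra_simps)

lemma Z1_eq_area: "Z1 A U \<omega> t = area (\<lambda>k. U k \<omega> - A (Suc k) \<omega>) (nat \<lfloor>t\<rfloor>)"
  unfolding Z1_def area_def delay_eq_lindley ..

text \<open>
  The queue depends on its input only through the differences of service and inter-arrival times. Their
  law \<open>Q\<close> is written in terms of the law of \<open>U 0\<close>, so that copies of the queue have the same \<open>Q\<close>.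
\<close>

lemma mg1_queue_increments:
  assumes q: "mg1_queue M lamA muU \<alpha> A U" and \<alpha>: "2 < \<alpha>"
  defines "Q \<equiv> distr (distr M borel (U 0) \<Otimes>\<^sub>M density lborel (exponential_density lamA)) borel (\<lambda>(u, a). u - a)"
  shows "iid_sequence M Q (\<lambda>k \<omega>. U k \<omega> - A (Suc k) \<omega>)" "integrable Q (\<lambda>x. x\<^sup>2)" "integrable Q (\<lambda>x. x)" "(\<integral>x. x \<partial>Q) < 0"
proof -
  interpret prob_space M using q unfolding mg1_queue_def by simp
  have ind: "indep_vars (\<lambda>_. borel) (case_sum A U) queue_index"
    and lam: "0 < lamA" and A: "\<And>n. 1 \<le> n \<Longrightarrow> distributed M lborel (A n) (exponential_density lamA)"
    and Ud: "\<And>n. distr M borel (U n) = distr M borel (U 0)" and Unn: "AE \<omega> in M. 0 \<le> U 0 \<omega>"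
    and Uint: "integrable M (U 0)" and EU: "expectation (U 0) = muU"
    and rv: "regularly_varying (\<lambda>x. prob {\<omega> \<in> space M. x < U 0 \<omega>}) (- \<alpha>)" and light: "muU < 1 / lamA"
    using q unfolding mg1_queue_def by auto
  have Um[measurable]: "U n \<in> borel_measurable M" for n
  proof -
    have "Inr n \<in> queue_index" unfolding queue_index_def by auto
    then have "case_sum A U (Inr n) \<in> borel_measurable M" using ind unfolding indep_vars_def by blast
    then show ?thesis by simp
  qed
  have Am[measurable]: "A (Suc n) \<in> borel_measurable M" for n
    using distributed_measurable[OF A[of "Suc n"]] by simp
  define X where "X k \<omega> = U k \<omega> - A (Suc k) \<omega>" for k \<omega>
  have [measurable]: "X k \<in> borel_measurable M" for k unfolding X_def[abs_def] by measurable
  define Kf :: "nat \<Rightarrow> (nat + nat) set" where "Kf k = {Inr k, Inl (Suc k)}" for k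
  have "indep_vars (\<lambda>_. borel) (\<lambda>k \<omega>. (\<lambda>x. x (Inr k) - x (Inl (Suc k))) (\<lambda>i\<in>Kf k. case_sum A U i \<omega>)) UNIV"
    by (rule indep_vars_blocks[OF ind]) (auto simp: Kf_def queue_index_def disjoint_family_on_def)
  then have Xind: "indep_vars (\<lambda>_. borel) X UNIV" unfolding X_def Kf_def by simp
  have Xd: "distr M borel (X k) = Q" for k
  proof -
    have "indep_var borel ((\<lambda>x. x (Inr k)) \<circ> (\<lambda>\<omega>. \<lambda>i\<in>{Inr k}. case_sum A U i \<omega>)) borel
        ((\<lambda>x. x (Inl (Suc k))) \<circ> (\<lambda>\<omega>. \<lambda>i\<in>{Inl (Suc k)}. case_sum A U i \<omega>))"
      by (rule indep_var_compose[OF indep_var_restrict[OF ind]]) (auto simp: queue_index_def)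
    then have "indep_var borel (U k) borel (A (Suc k))" by (simp add: comp_def)
    then have joint: "distr M borel (U k) \<Otimes>\<^sub>M distr M borel (A (Suc k)) = distr M (borel \<Otimes>\<^sub>M borel) (\<lambda>\<omega>. (U k \<omega>, A (Suc k) \<omega>))"
      unfolding indep_var_distribution_eq by simp
    have dA: "distr M lborel (A (Suc k)) = density lborel (exponential_density lamA)"
      by (rule distributed_distr_eq_density[OF A]) simp
    have dA': "distr M borel (A (Suc k)) = distr M lborel (A (Suc k))" by (rule distr_cong) auto
    have "Q = distr (distr M (borel \<Otimes>\<^sub>M borel) (\<lambda>\<omega>. (U k \<omega>, A (Suc k) \<omega>))) borel (\<lambda>(u, a). u - a)"
      unfolding Q_def joint[symmetric] Ud[of k] dA' dA ..
    also have "\<dots> = distr M borel (X k)"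
      unfolding X_def by (subst distr_distr) (auto simp: comp_def)
    finally show ?thesis by simp
  qed
  show iid: "iid_sequence M Q (\<lambda>k \<omega>. U k \<omega> - A (Suc k) \<omega>)"
    using Xind Xd unfolding iid_sequence_def X_def by (auto simp: prob_space_axioms)
  have U2: "integrable M (\<lambda>\<omega>. (U 0 \<omega>)\<^sup>2)"
    by (rule regularly_varying_tail_second_moment[OF prob_space_axioms Um Unn rv \<alpha>])
  have A1: "distributed M lborel (A (Suc 0)) (exponential_density lamA)" by (rule A) simp
  have A2: "integrable M (\<lambda>\<omega>. (A (Suc 0) \<omega>)\<^sup>2)" and A1i: "integrable M (A (Suc 0))"
    using erlang_ith_moment_integrable[OF lam A1, of 2] erlang_ith_moment_integrable[OF lam A1, of 1] by auto
  have EA: "expectation (A (Suc 0)) = 1 / lamA" by (rule exponential_distributed_expectation[OF lam A1])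
  have "integrable M (\<lambda>\<omega>. 2 * (U 0 \<omega>)\<^sup>2 + 2 * (A (Suc 0) \<omega>)\<^sup>2)" using U2 A2 by simp
  then have "integrable M (\<lambda>\<omega>. (X 0 \<omega>)\<^sup>2)"
  proof (rule Bochner_Integration.integrable_bound)
    show "AE \<omega> in M. norm ((X 0 \<omega>)\<^sup>2) \<le> norm (2 * (U 0 \<omega>)\<^sup>2 + 2 * (A (Suc 0) \<omega>)\<^sup>2)"
    proof (rule AE_I2)
      fix \<omega>
      have "(X 0 \<omega>)\<^sup>2 \<le> 2 * (U 0 \<omega>)\<^sup>2 + 2 * (A (Suc 0) \<omega>)\<^sup>2"
        using zero_le_power2[of "U 0 \<omega> + A (Suc 0) \<omega>"] unfolding X_def power2_sum power2_diff by linarith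
      then show "norm ((X 0 \<omega>)\<^sup>2) \<le> norm (2 * (U 0 \<omega>)\<^sup>2 + 2 * (A (Suc 0) \<omega>)\<^sup>2)" by simp
    qed
  qed measurable
  moreover have "(\<lambda>x::real. x\<^sup>2) \<in> borel_measurable borel" by simp
  ultimately show "integrable Q (\<lambda>x. x\<^sup>2)" using iid_integrable(1)[OF iid, of "\<lambda>x. x\<^sup>2" 0] unfolding X_def by blast
  have id: "(\<lambda>x::real. x) \<in> borel_measurable borel" by simp
  show "integrable Q (\<lambda>x. x)"
    unfolding iid_integrable(1)[OF iid id, symmetric, where k = 0] using Uint A1i by (rule Bochner_Integration.integrable_diff)
  have "(\<integral>x. x \<partial>Q) = expectation (\<lambda>\<omega>. U 0 \<omega> - A (Suc 0) \<omega>)" by (rule iid_integrable(2)[OF iid id, symmetric])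
  also have "\<dots> = muU - 1 / lamA" unfolding EU[symmetric] EA[symmetric] by (rule Bochner_Integration.integral_diff[OF Uint A1i])
  finally show "(\<integral>x. x \<partial>Q) < 0" using light by simp
qed

lemma mg1_copies_increments:
  assumes c: "independent_mg1_copies M lamA muU \<alpha> U m Ac Uc" and \<alpha>: "2 < \<alpha>" and m: "2 \<le> m"
  defines "Q \<equiv> distr (distr M borel (U 0) \<Otimes>\<^sub>M density lborel (exponential_density lamA)) borel (\<lambda>(u, a). u - a)"
  shows "iid_sequence M Q (\<lambda>k \<omega>. Uc 1 k \<omega> - Ac 1 (Suc k) \<omega>)"
    and "prob_space.indep_vars M (\<lambda>_. borel) (\<lambda>(i, k) \<omega>. Uc i k \<omega> - Ac i (Suc k) \<omega>) ({1..m} \<times> UNIV)"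
proof -
  have q: "mg1_queue M lamA muU \<alpha> (Ac 1) (Uc 1)" and d: "distr M borel (Uc 1 0) = distr M borel (U 0)"
    using c m unfolding independent_mg1_copies_def by auto
  show "iid_sequence M Q (\<lambda>k \<omega>. Uc 1 k \<omega> - Ac 1 (Suc k) \<omega>)"
    using mg1_queue_increments(1)[OF q \<alpha>] unfolding d Q_def .
  interpret prob_space M using q unfolding mg1_queue_def by simp
  have ind: "indep_vars (\<lambda>_. borel) (\<lambda>(i, k). case_sum (Ac i) (Uc i) k) ({1..m} \<times> queue_index)"
    using c unfolding independent_mg1_copies_def by simp
  define Kf :: "nat \<times> nat \<Rightarrow> (nat \<times> (nat + nat)) set" where "Kf p = {(fst p, Inr (snd p)), (fst p, Inl (Suc (snd p)))}" for p
  have "indep_vars (\<lambda>_. borel) (\<lambda>p \<omega>. (\<lambda>x. x (fst p, Inr (snd p)) - x (fst p, Inl (Suc (snd p)))) (\<lambda>i\<in>Kf p. (case i of (i, k) \<Rightarrow> case_sum (Ac i) (Uc i) k) \<omega>)) ({1..m} \<times> UNIV)"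
    by (rule indep_vars_blocks[OF ind]) (auto simp: Kf_def queue_index_def disjoint_family_on_def)
  then show "indep_vars (\<lambda>_. borel) (\<lambda>(i, k) \<omega>. Uc i k \<omega> - Ac i (Suc k) \<omega>) ({1..m} \<times> UNIV)"
    unfolding Kf_def by (simp add: case_prod_beta')
qed

section \<open>The contrast of a block\<close>

text \<open>The time in \<open>[1, 1 + h]\<close> that the path \<open>s \<mapsto> y * s + d\<close> spends in \<open>[k, k + 1)\<close>.\<close>

definition occupation :: "real \<Rightarrow> real \<Rightarrow> real \<Rightarrow> nat \<Rightarrow> real" where
  "occupation y d h k = measure lborel ({1..1 + h} \<inter> {s. real k \<le> y * s + d \<and> y * s + d < real k + 1})"

text \<open>
  The weights with which the averaged increment of \<open>s \<mapsto> Z (nat \<lfloor>y * s\<rfloor>)\<close> depends on \<open>Z 0, Z 1, \<dots>\<close>. They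
  vanish before \<open>y\<close>, which gives the queue time to empty, and after \<open>3 * y\<close>, and they sum to 0.
\<close>

definition contrast_weight :: "real \<Rightarrow> real \<Rightarrow> nat \<Rightarrow> real" where
  "contrast_weight y h k = occupation y y h k - occupation y 0 h k"

definition contrast_length :: "real \<Rightarrow> nat" where
  "contrast_length y = Suc (nat \<lceil>3 * y\<rceil>)"

lemma step_path_window_integral:
  fixes Z :: "nat \<Rightarrow> real"
  assumes "0 < y" "0 \<le> h" "h \<le> 1" "0 \<le> d" "d \<le> y"
  shows "(LINT s:{1..1 + h}|lborel. Z (nat \<lfloor>y * s + d\<rfloor>)) = (\<Sum>k<contrast_length y. Z k * occupation y d h k)"
  unfolding occupation_def
proof (rule step_path_integral)
  fix s assume s: "s \<in> {1..1 + h}"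
  have "y * s \<le> y * 2" using s assms by (intro mult_left_mono) auto
  moreover have "3 * y < real (contrast_length y)" unfolding contrast_length_def by linarith
  moreover have "0 \<le> y * s" using s assms by simp
  ultimately show "0 \<le> y * s + d \<and> y * s + d < real (contrast_length y)" using assms by linarith
qed (auto simp: emeasure_interval_finite[unfolded infinity_ennreal_def])

lemma occupation_bounds:
  assumes y: "0 < y"
  shows "0 \<le> occupation y d h k" "occupation y d h k \<le> 1 / y"
proof -
  show "0 \<le> occupation y d h k" unfolding occupation_def by simp
  have sub: "{1..1 + h} \<inter> {s. real k \<le> y * s + d \<and> y * s + d < real k + 1} \<subseteq> {(real k - d) / y..(real k - d) / y + 1 / y}"
  proof safe
    fix s assume s: "real k \<le> y * s + d" "y * s + d < real k + 1"
    have "(real k - d) / y \<le> s" using s y by (simp add: pos_divide_le_eq mult.commute)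
    moreover have "s \<le> (real k - d + 1) / y" using s y by (simp add: pos_le_divide_eq mult.commute)
    ultimately show "s \<in> {(real k - d) / y..(real k - d) / y + 1 / y}" by (simp add: add_divide_distrib)
  qed
  have "occupation y d h k \<le> measure lborel {(real k - d) / y..(real k - d) / y + 1 / y}"
    unfolding occupation_def using emeasure_interval_finite(1)[of "(real k - d) / y" "(real k - d) / y + 1 / y"]
    by (intro measure_mono_fmeasurable[OF sub] fmeasurableI) auto
  also have "\<dots> = 1 / y" using y by simp
  finally show "occupation y d h k \<le> 1 / y" .
qed

lemma occupation_sum:
  assumes "0 < y" "0 \<le> h" "h \<le> 1" "0 \<le> d" "d \<le> y"
  shows "(\<Sum>k<contrast_length y. occupation y d h k) = h"
  using step_path_window_integral[OF assms, of "\<lambda>_. 1"] assms by (simp add: set_lebesgue_integral_def)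

lemma contrast_weight_sum:
  assumes "0 < y" "0 \<le> h" "h \<le> 1"
  shows "(\<Sum>k<contrast_length y. contrast_weight y h k) = 0"
  unfolding contrast_weight_def sum_subtractf using assms by (simp add: occupation_sum)

lemma contrast_weight_early:
  assumes y: "0 < y" and k: "k < nat \<lfloor>y\<rfloor>"
  shows "contrast_weight y h k = 0"
proof -
  have ky: "real k + 1 \<le> y" using k y by linarith
  have emp: "{1..1 + h} \<inter> {s. real k \<le> y * s + d \<and> y * s + d < real k + 1} = {}" if "0 \<le> d" for d
  proof safe
    fix s assume s: "s \<in> {1..1 + h}" "y * s + d < real k + 1"
    define p where "p = y * s"
    have "y \<le> p" unfolding p_def using s y by simp
    then have False using s(2) ky that unfolding p_def[symmetric] by linarith
    then show "s \<in> {}" ..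
  qed
  show ?thesis unfolding contrast_weight_def occupation_def emp[OF less_imp_le[OF y]] emp[OF order_refl] by simp
qed

lemma contrast_weight_square_sum:
  assumes y: "0 < y" "0 \<le> h" "h \<le> 1"
  shows "(\<Sum>k<contrast_length y. (contrast_weight y h k)\<^sup>2) \<le> 2 / y"
    and "(\<Sum>k<contrast_length y. \<bar>contrast_weight y h k\<bar>) \<le> 2"
proof -
  have abs_le: "\<bar>contrast_weight y h k\<bar> \<le> occupation y y h k + occupation y 0 h k" for k
    unfolding contrast_weight_def using occupation_bounds[OF y(1), of y h k] occupation_bounds[OF y(1), of 0 h k] by linarith
  have abs_le': "\<bar>contrast_weight y h k\<bar> \<le> 1 / y" for k
    unfolding contrast_weight_def using occupation_bounds[OF y(1), of y h k] occupation_bounds[OF y(1), of 0 h k] by linarith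
  have "(\<Sum>k<contrast_length y. \<bar>contrast_weight y h k\<bar>) \<le> (\<Sum>k<contrast_length y. occupation y y h k + occupation y 0 h k)"
    by (intro sum_mono abs_le)
  also have "\<dots> = 2 * h" unfolding sum.distrib using y by (simp add: occupation_sum)
  finally show abs2: "(\<Sum>k<contrast_length y. \<bar>contrast_weight y h k\<bar>) \<le> 2" using y by linarith
  have "(\<Sum>k<contrast_length y. (contrast_weight y h k)\<^sup>2) \<le> (\<Sum>k<contrast_length y. 1 / y * \<bar>contrast_weight y h k\<bar>)"
  proof (rule sum_mono)
    fix k
    have "\<bar>contrast_weight y h k\<bar> * \<bar>contrast_weight y h k\<bar> \<le> 1 / y * \<bar>contrast_weight y h k\<bar>"
      by (intro mult_right_mono abs_le') simp
    then show "(contrast_weight y h k)\<^sup>2 \<le> 1 / y * \<bar>contrast_weight y h k\<bar>" by (simp add: power2_eq_square)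
  qed
  also have "\<dots> \<le> 1 / y * 2" unfolding sum_distrib_left[symmetric] using abs2 y by (intro mult_left_mono) auto
  finally show "(\<Sum>k<contrast_length y. (contrast_weight y h k)\<^sup>2) \<le> 2 / y" by simp
qed

lemma mean_increment_scaled_path:
  fixes Z :: "nat \<Rightarrow> real"
  assumes e: "0 < e" and h: "0 \<le> h" "h \<le> 1"
  shows "mean_increment h (\<lambda>t. \<kappa> * (Z (nat \<lfloor>t / e\<rfloor>) - t / e * \<mu>)) =
    \<kappa> * ((\<Sum>k<contrast_length (1 / e). contrast_weight (1 / e) h k * Z k) - h / e * \<mu>)"
proof -
  define y where "y = 1 / e"
  have y: "0 < y" unfolding y_def using e by simp
  obtain B where B: "\<forall>s\<in>{0..3 * y}. \<bar>Z (nat \<lfloor>1 * s\<rfloor>)\<bar> \<le> B" using step_path_bounded[of 1 "3 * y" Z] by auto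
  have int: "set_integrable lborel {1..1 + h} (\<lambda>s. Z (nat \<lfloor>y * s + d\<rfloor>))" if d: "0 \<le> d" "d \<le> y" for d
  proof (rule bounded_set_integrable[OF step_path_measurable _ emeasure_interval_finite(1)])
    fix s assume s: "s \<in> {1..1 + h}"
    have "y * s \<le> y * 2" using s h y by (intro mult_left_mono) auto
    moreover have "0 \<le> y * s" using s y by simp
    ultimately show "\<bar>Z (nat \<lfloor>y * s + d\<rfloor>)\<bar> \<le> B" using B d by auto
  qed simp
  have ic: "set_integrable lborel {1..1 + h} (\<lambda>s. y * \<mu>)"
    by (rule bounded_set_integrable[OF _ _ emeasure_interval_finite(1) order_refl]) auto
  have lc: "(LINT s:{1..1 + h}|lborel. y * \<mu>) = h * (y * \<mu>)" using h by (simp add: set_lebesgue_integral_def)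
  have "mean_increment h (\<lambda>t. \<kappa> * (Z (nat \<lfloor>t / e\<rfloor>) - t / e * \<mu>)) =
      (LINT s:{1..1 + h}|lborel. \<kappa> * ((Z (nat \<lfloor>y * s + y\<rfloor>) - Z (nat \<lfloor>y * s + 0\<rfloor>)) - y * \<mu>))"
    unfolding mean_increment_def y_def by (simp add: algebra_simps add_divide_distrib)
  also have "\<dots> = \<kappa> * (LINT s:{1..1 + h}|lborel. (Z (nat \<lfloor>y * s + y\<rfloor>) - Z (nat \<lfloor>y * s + 0\<rfloor>)) - y * \<mu>)"
    by (rule set_integral_mult_right)
  also have "(LINT s:{1..1 + h}|lborel. (Z (nat \<lfloor>y * s + y\<rfloor>) - Z (nat \<lfloor>y * s + 0\<rfloor>)) - y * \<mu>) =
      (LINT s:{1..1 + h}|lborel. Z (nat \<lfloor>y * s + y\<rfloor>)) - (LINT s:{1..1 + h}|lborel. Z (nat \<lfloor>y * s + 0\<rfloor>)) - h * (y * \<mu>)"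
    using int[of y] int[of 0] ic y by (simp only: set_integral_diff lc order_refl less_imp_le)
  also have "\<dots> = (\<Sum>k<contrast_length y. contrast_weight y h k * Z k) - h * (y * \<mu>)"
    using y h by (simp only: step_path_window_integral less_imp_le order_refl contrast_weight_def)
      (simp add: sum_subtractf[symmetric] algebra_simps)
  finally show ?thesis unfolding y_def by simp
qed

definition contrast :: "real \<Rightarrow> real \<Rightarrow> (nat \<Rightarrow> real) \<Rightarrow> real" where
  "contrast h y x = (\<Sum>k<contrast_length y. contrast_weight y h k * area x k)"

lemma contrast_measurable [measurable]: "contrast h y \<in> borel_measurable seq_space"
  unfolding contrast_def by measurable

text \<open>
  At \<open>\<epsilon> = 1 / y\<close> the averaged increment of the normalized process is the contrast divided by
  \<open>y powr (2 / \<alpha>) / ell y\<close>, up to an additive constant, in which the centring \<open>mu_W\<close> disappears.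
  The limit process runs at speed \<open>1 / E_tau1\<close>; it is not constant as the mean return time is positive.
\<close>

lemma queue_contrast_spread:
  assumes q: "mg1_queue M lamA muU \<alpha> A U" and \<alpha>: "2 < \<alpha>"
    and ell: "slowly_varying ell" and L: "stable_levy_process (\<alpha> / 2) N L"
    and conv: "weakly_converges_M1 (at_right 0)
      M (\<lambda>\<epsilon> \<omega> t. \<epsilon> powr (2 / \<alpha>) * ell (1 / \<epsilon>) * (Z1 A U \<omega> (t / \<epsilon>) - t / \<epsilon> * mu_W M A U))
      N (\<lambda>\<omega> t. L \<omega> (t / E_tau1 M A U))"
  obtains h c y0 where "0 < h" "h \<le> 1" "0 < c" "c < 1" "1 \<le> y0"
    "\<And>y. y0 \<le> y \<Longrightarrow> 0 < ell y"
    "\<And>y r. y0 \<le> y \<Longrightarrow> measure M {\<omega> \<in> space M.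
       \<bar>contrast h y (\<lambda>k. U k \<omega> - A (Suc k) \<omega>) - r\<bar> \<le> c * (y powr (2 / \<alpha>) / ell y)} \<le> 1 - c"
proof -
  define Q where "Q = distr (distr M borel (U 0) \<Otimes>\<^sub>M density lborel (exponential_density lamA)) borel (\<lambda>(u, a). u - a)"
  define X where "X \<omega> k = U k \<omega> - A (Suc k) \<omega>" for \<omega> k
  have iid: "iid_sequence M Q (\<lambda>k \<omega>. X \<omega> k)" and Qint: "integrable Q (\<lambda>x. x)" and Qneg: "(\<integral>x. x \<partial>Q) < 0"
    using mg1_queue_increments[OF q \<alpha>] unfolding Q_def X_def by auto
  interpret prob_space M using q unfolding mg1_queue_def by simp
  have E: "0 < E_tau1 M A U"
    using iid_first_return_mean_pos[OF iid Qint Qneg] unfolding E_tau1_def tau1_def delay_eq_lindley X_def .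
  obtain h where h: "0 < h" "h \<le> 1" and Ym: "(\<lambda>\<omega>. mean_increment h (\<lambda>t. L \<omega> (t / E_tau1 M A U))) \<in> borel_measurable N"
    and nd: "\<not> (\<exists>a. AE \<omega> in N. mean_increment h (\<lambda>t. L \<omega> (t / E_tau1 M A U)) = a)"
    using stable_mean_increment_nondegenerate[OF L E] by blast
  have N: "prob_space N" using L unfolding stable_levy_process_def levy_process_def by simp
  define \<mu> where "\<mu> = mu_W M A U"
  define b where "b y = y powr (2 / \<alpha>) / ell y" for y
  let ?Y = "\<lambda>\<epsilon> \<omega> t. \<epsilon> powr (2 / \<alpha>) * ell (1 / \<epsilon>) * (Z1 A U \<omega> (t / \<epsilon>) - t / \<epsilon> * mu_W M A U)"
  have MI: "mean_increment h (?Y e \<omega>) = e powr (2 / \<alpha>) * ell (1 / e) * (contrast h (1 / e) (X \<omega>) - h / e * \<mu>)" if "0 < e" for e \<omega>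
    unfolding Z1_eq_area contrast_def X_def \<mu>_def
    by (rule mean_increment_scaled_path[OF that less_imp_le[OF h(1)] h(2), of _ "area (\<lambda>k. U k \<omega> - A (Suc k) \<omega>)"])
  have Cm[measurable]: "(\<lambda>\<omega>. contrast h y (X \<omega>)) \<in> borel_measurable M" for y
    using measurable_compose[OF iid_path_measurable[OF iid] contrast_measurable] .
  have Xm: "(\<lambda>\<omega>. mean_increment h (?Y e \<omega>)) \<in> borel_measurable M" if "0 < e" for e
    unfolding MI[OF that] by (intro borel_measurable_times borel_measurable_diff borel_measurable_const Cm)
  obtain c where c: "0 < c" "c < 1"
    "\<forall>\<^sub>F e in at_right (0::real). \<forall>r. measure M {\<omega> \<in> space M. \<bar>mean_increment h (?Y e \<omega>) - r\<bar> \<le> c} \<le> 1 - c"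
    by (rule weak_limit_nonconcentration[OF prob_space_axioms N conv less_imp_le[OF h(1)] Xm Ym nd])
  obtain d where d: "0 < d" "\<And>e r. 0 < e \<Longrightarrow> e < d \<Longrightarrow> measure M {\<omega> \<in> space M. \<bar>mean_increment h (?Y e \<omega>) - r\<bar> \<le> c} \<le> 1 - c"
    using c(3) unfolding eventually_at_right_field by auto
  obtain y1 where y1: "\<And>y. y1 \<le> y \<Longrightarrow> 0 < ell y" using ell unfolding regularly_varying_def by auto
  define y0 where "y0 = max (max 1 y1) (2 / d)"
  have y0: "1 \<le> y0" "y1 \<le> y0" "2 / d \<le> y0" unfolding y0_def by auto
  show thesis
  proof (rule that[OF h c(1,2) y0(1)])
    show "0 < ell y" if "y0 \<le> y" for y using that y0 by (intro y1) simp
    fix y r assume y: "y0 \<le> y"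
    have yp: "0 < y" using y y0 by simp
    have ep: "0 < ell y" using y y0 by (intro y1) simp
    define e where "e = 1 / y"
    have e: "0 < e" "1 / e = y" unfolding e_def using yp by auto
    have "2 / d \<le> y" using y y0 by simp
    then have "1 / d < y" using d(1) by (simp add: divide_simps split: if_splits)
    then have ed: "e < d" unfolding e_def using d(1) yp by (simp add: divide_simps mult.commute split: if_splits)
    have bp: "0 < b y" unfolding b_def using ep yp by simp
    have sc: "e powr (2 / \<alpha>) * ell (1 / e) = 1 / b y"
      unfolding e(2) b_def e_def using yp by (simp add: powr_divide)
    have "{\<omega> \<in> space M. \<bar>contrast h y (X \<omega>) - r\<bar> \<le> c * b y} =
        {\<omega> \<in> space M. \<bar>mean_increment h (?Y e \<omega>) - (r - h / e * \<mu>) / b y\<bar> \<le> c}"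
    proof (rule Collect_cong, rule conj_cong[OF refl])
      fix \<omega>
      have "mean_increment h (?Y e \<omega>) - (r - h / e * \<mu>) / b y = (contrast h y (X \<omega>) - r) / b y"
        by (subst MI[OF e(1)]) (simp only: sc, simp add: e(2) diff_divide_distrib)
      then show "(\<bar>contrast h y (X \<omega>) - r\<bar> \<le> c * b y) = (\<bar>mean_increment h (?Y e \<omega>) - (r - h / e * \<mu>) / b y\<bar> \<le> c)"
        using bp by (simp only: abs_divide abs_of_pos pos_divide_le_eq)
    qed
    also have "prob \<dots> \<le> 1 - c" by (rule d(2)[OF e(1) ed])
    finally show "prob {\<omega> \<in> space M. \<bar>contrast h y (\<lambda>k. U k \<omega> - A (Suc k) \<omega>) - r\<bar> \<le> c * (y powr (2 / \<alpha>) / ell y)} \<le> 1 - c"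
      unfolding X_def b_def .
  qed
qed

text \<open>
  Markov's inequality for the contrast bounds its scale from above, because the areas have linearly
  growing mean.
\<close>

lemma contrast_scale_linear_bound:
  assumes iid: "iid_sequence M Q X" and sq: "integrable Q (\<lambda>x. x\<^sup>2)" and neg: "(\<integral>x. x \<partial>Q) < 0"
    and h: "0 \<le> h" "h \<le> 1" and c: "0 < c"
    and spread: "\<And>y. 1 \<le> y0 \<Longrightarrow> y0 \<le> y \<Longrightarrow> 0 < b y \<and> measure M {\<omega> \<in> space M. \<bar>contrast h y (\<lambda>k. X k \<omega>)\<bar> \<le> c * b y} \<le> 1 - c"
    and y0: "1 \<le> y0"
  obtains C where "0 < C" "\<And>y. y0 \<le> y \<Longrightarrow> b y \<le> C * y"
proof -
  interpret prob_space M using iid unfolding iid_sequence_def by simp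
  define s where "s = (\<integral>x. x\<^sup>2 \<partial>Q) / - (\<integral>x. x \<partial>Q)"
  have s0: "0 \<le> s" unfolding s_def using neg by (intro divide_nonneg_pos Bochner_Integration.integral_nonneg) auto
  note W = iid_mean_waiting_time[OF iid sq neg, folded s_def]
  have aint: "integrable M (\<lambda>\<omega>. area (\<lambda>k. X k \<omega>) n)" for n
    unfolding area_def using W(1) by simp
  have Ea: "expectation (\<lambda>\<omega>. area (\<lambda>k. X k \<omega>) n) \<le> real n * s" for n
  proof -
    have "expectation (\<lambda>\<omega>. area (\<lambda>k. X k \<omega>) n) = (\<Sum>i = 1..n. expectation (\<lambda>\<omega>. lindley 0 (\<lambda>k. X k \<omega>) i))"
      unfolding area_def using W(1) by (intro Bochner_Integration.integral_sum) auto
    also have "\<dots> \<le> (\<Sum>i = 1..n. s)" by (intro sum_mono W(2))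
    finally show ?thesis by simp
  qed
  \<comment> \<open>The contrast is at most twice the area at \<open>contrast_length y \<le> 5 * y\<close>, of mean at most \<open>5 * y * s\<close>.\<close>
  define C where "C = 10 * s / (c * c) + 1"
  have C: "0 < C" unfolding C_def using s0 c by (intro add_nonneg_pos divide_nonneg_pos) auto
  have "b y \<le> C * y" if y: "y0 \<le> y" for y
  proof -
    have y1: "1 \<le> y" using y y0 by simp
    have bp: "0 < b y" and P: "prob {\<omega> \<in> space M. \<bar>contrast h y (\<lambda>k. X k \<omega>)\<bar> \<le> c * b y} \<le> 1 - c" using spread[OF y0 y] by auto
    let ?K = "contrast_length y"
    let ?F = "\<lambda>\<omega>. \<bar>contrast h y (\<lambda>k. X k \<omega>)\<bar>"
    have Kb: "real ?K \<le> 5 * y" unfolding contrast_length_def using y1 by linarith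
    have Fle: "?F \<omega> \<le> 2 * area (\<lambda>k. X k \<omega>) ?K" for \<omega>
    proof -
      have "?F \<omega> \<le> (\<Sum>k<?K. \<bar>contrast_weight y h k\<bar> * area (\<lambda>k. X k \<omega>) ?K)"
        unfolding contrast_def
      proof (rule order_trans[OF sum_abs sum_mono])
        fix k assume "k \<in> {..<?K}"
        then have "area (\<lambda>k. X k \<omega>) k \<le> area (\<lambda>k. X k \<omega>) ?K" by (intro area_mono) simp
        then show "\<bar>contrast_weight y h k * area (\<lambda>k. X k \<omega>) k\<bar> \<le> \<bar>contrast_weight y h k\<bar> * area (\<lambda>k. X k \<omega>) ?K"
          unfolding abs_mult using area_nonneg[of "\<lambda>k. X k \<omega>" k] by (intro mult_left_mono) auto
      qed
      also have "\<dots> \<le> 2 * area (\<lambda>k. X k \<omega>) ?K"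
        unfolding sum_distrib_right[symmetric] using y1 h by (intro mult_right_mono contrast_weight_square_sum(2) area_nonneg) auto
      finally show ?thesis .
    qed
    have Fm[measurable]: "?F \<in> borel_measurable M"
      using measurable_compose[OF iid_path_measurable[OF iid] contrast_measurable] by measurable
    have Fint: "integrable M ?F"
      by (rule Bochner_Integration.integrable_bound[where f = "\<lambda>\<omega>. 2 * area (\<lambda>k. X k \<omega>) ?K"])
        (use aint Fle area_nonneg in auto)
    have EF: "expectation ?F \<le> 10 * s * y"
    proof -
      have "expectation ?F \<le> expectation (\<lambda>\<omega>. 2 * area (\<lambda>k. X k \<omega>) ?K)"
        by (rule integral_mono[OF Fint _ Fle]) (use aint in simp)
      also have "\<dots> \<le> 2 * (real ?K * s)" using Ea[of ?K] by simp
      also have "\<dots> \<le> 2 * (5 * y * s)" using Kb s0 by (intro mult_left_mono mult_right_mono) auto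
      finally show ?thesis by (simp add: mult_ac)
    qed
    have "c \<le> 1 - prob {\<omega> \<in> space M. ?F \<omega> \<le> c * b y}" using P by simp
    also have "\<dots> = prob (space M - {\<omega> \<in> space M. ?F \<omega> \<le> c * b y})" by (rule prob_compl[symmetric]) measurable
    also have "\<dots> \<le> prob {\<omega> \<in> space M. c * b y \<le> ?F \<omega>}" by (rule finite_measure_mono) auto
    also have "\<dots> \<le> expectation ?F / (c * b y)"
      by (rule integral_Markov_inequality_measure[OF Fint, where A = "{}"]) (use c bp in auto)
    finally have "c * (c * b y) \<le> expectation ?F" using c bp by (simp add: pos_le_divide_eq)
    then have "c * c * b y \<le> 10 * s * y" using EF by simp
    then have "b y \<le> 10 * s * y / (c * c)" using c by (simp add: pos_le_divide_eq mult_ac)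
    also have "\<dots> \<le> C * y" unfolding C_def using y1 by (simp add: distrib_right)
    finally show ?thesis .
  qed
  with C show thesis by (rule that)
qed

section \<open>Small values of the estimators\<close>

text \<open>
  The general bound for blocks, applied to the contrast. A block is unpredictable with probability at
  least \<open>c\<close>, of which half is given up to the event that the queue does not drain before
  \<open>y\<close>; both this event and a long queue at the start of the block have a probability of order \<open>1 / y\<close>.
\<close>

lemma (in prob_space) path_small_ball:
  fixes V :: "'i \<Rightarrow> 'a \<Rightarrow> real" and e :: "nat \<Rightarrow> 'i"
  assumes V: "indep_vars (\<lambda>_. borel) V I" and e: "inj e" "range e \<subseteq> I"
    and X: "iid_sequence M Q (\<lambda>k. V (e k))" and sq: "integrable Q (\<lambda>x. x\<^sup>2)" and neg: "(\<integral>x. x \<partial>Q) < 0"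
    and h: "0 \<le> h" "h \<le> 1" and c: "0 < c" "c < 1"
    and spread: "\<And>y r. y0 \<le> y \<Longrightarrow> prob {\<omega> \<in> space M. \<bar>contrast h y (\<lambda>k. V (e k) \<omega>) - r\<bar> \<le> c * b y} \<le> 1 - c"
  obtains y1 C where "0 < C"
    "\<And>y k T n g R. y1 \<le> y \<Longrightarrow> T \<le> n \<Longrightarrow> real k * (4 * y) \<le> real n - real T \<Longrightarrow>
      (\<And>i. T \<le> i \<Longrightarrow> i < n \<Longrightarrow> g i \<in> borel_measurable (past M V (I - e ` {T..}))) \<Longrightarrow>
      sqrt (2 / y * R) \<le> c * b y \<Longrightarrow>
      \<exists>E\<in>events. {\<omega> \<in> space M. (\<Sum>i = T..<n. (area (\<lambda>k. V (e k) \<omega>) i - g i \<omega>)\<^sup>2) \<le> R} \<subseteq> E \<and>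
        prob E \<le> (1 - c / 2) ^ k + real k * (C / y)"
proof -
  obtain C1 d where C1: "0 < C1" and d: "0 < d"
    and walk: "\<And>n. 0 < n \<Longrightarrow> prob {\<omega> \<in> space M. - (d * real n) < (\<Sum>i<n. V (e i) \<omega>)} \<le> C1 / real n"
    using iid_walk_tail[OF X sq neg] by blast
  define s where "s = (\<integral>x. x\<^sup>2 \<partial>Q) / - (\<integral>x. x \<partial>Q)"
  have s0: "0 \<le> s" unfolding s_def using neg by (intro divide_nonneg_pos Bochner_Integration.integral_nonneg) auto
  define y1 where "y1 = max (max 2 y0) (4 * C1 / c)"
  define C where "C = 2 * s / d + 1"
  have C: "0 < C" unfolding C_def using s0 d by (intro add_nonneg_pos divide_nonneg_pos) auto
  show thesis
  proof (rule that[OF C, of y1])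
    fix y R :: real and k T n :: nat and g :: "nat \<Rightarrow> 'a \<Rightarrow> real"
    assume y: "y1 \<le> y" and Tn: "T \<le> n" and len: "real k * (4 * y) \<le> real n - real T"
      and g: "\<And>i. T \<le> i \<Longrightarrow> i < n \<Longrightarrow> g i \<in> borel_measurable (past M V (I - e ` {T..}))"
      and R: "sqrt (2 / y * R) \<le> c * b y"
    have y2: "2 \<le> y" "y0 \<le> y" "4 * C1 / c \<le> y" using y unfolding y1_def by auto
    define p where "p = nat \<lfloor>y\<rfloor>"
    have p: "y / 2 \<le> real p" "real p \<le> y" unfolding p_def using y2 by linarith+
    have p0: "0 < p" using p y2 by (cases p) auto
    define v where "v = d * real p"
    have v: "0 < v" unfolding v_def using d p0 by simp
    let ?K = "contrast_length y"
    have K4: "real ?K \<le> 4 * y" unfolding contrast_length_def using y2 by linarith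
    have pK: "p \<le> ?K" unfolding contrast_length_def p_def using y2 by linarith
    have kK: "T + k * ?K \<le> n"
    proof -
      have "real (k * ?K) \<le> real k * (4 * y)" using K4 by (simp add: mult_left_mono)
      then have "real (T + k * ?K) \<le> real n" using len by simp
      then show ?thesis by (simp only: of_nat_le_iff)
    qed
    have wm[measurable]: "(\<lambda>\<omega>. V (e i) \<omega>) \<in> borel_measurable M" for i by (rule iid_measurable[OF X])
    have cm[measurable]: "(\<lambda>\<omega>. contrast h y (\<lambda>k. V (e k) \<omega>)) \<in> borel_measurable M"
      using measurable_compose[OF iid_path_measurable[OF X] contrast_measurable] .
    have q: "prob {\<omega> \<in> space M. \<bar>(\<Sum>i<?K. contrast_weight y h i * area (\<lambda>k. V (e k) \<omega>) i) - r\<bar> \<le> c * b y \<or> - v < (\<Sum>i<p. V (e i) \<omega>)} \<le> 1 - c / 2" for r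
    proof -
      have "prob {\<omega> \<in> space M. \<bar>contrast h y (\<lambda>k. V (e k) \<omega>) - r\<bar> \<le> c * b y \<or> - v < (\<Sum>i<p. V (e i) \<omega>)} \<le>
          prob ({\<omega> \<in> space M. \<bar>contrast h y (\<lambda>k. V (e k) \<omega>) - r\<bar> \<le> c * b y} \<union> {\<omega> \<in> space M. - v < (\<Sum>i<p. V (e i) \<omega>)})"
        by (rule finite_measure_mono) auto
      also have "\<dots> \<le> prob {\<omega> \<in> space M. \<bar>contrast h y (\<lambda>k. V (e k) \<omega>) - r\<bar> \<le> c * b y} + prob {\<omega> \<in> space M. - v < (\<Sum>i<p. V (e i) \<omega>)}"
        by (rule measure_Un_le) measurable
      also have "\<dots> \<le> (1 - c) + C1 / real p" unfolding v_def by (intro add_mono spread y2 walk p0)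
      also have "C1 / real p \<le> c / 2"
      proof -
        have "4 * C1 \<le> y * c" using y2(3) c by (simp add: pos_divide_le_eq)
        also have "\<dots> \<le> 2 * real p * c" using p c by (intro mult_right_mono) auto
        finally have "2 * C1 \<le> c * real p" by simp
        then show ?thesis using p0 by (simp add: pos_divide_le_eq)
      qed
      finally show ?thesis unfolding contrast_def by simp
    qed
    have B: "prob {\<omega> \<in> space M. v < lindley 0 (\<lambda>k. V (e k) \<omega>) t} \<le> C / y" for t
    proof -
      have "prob {\<omega> \<in> space M. v < lindley 0 (\<lambda>k. V (e k) \<omega>) t} \<le> s / v"
        unfolding s_def by (rule iid_waiting_time_tail[OF X sq neg v])
      also have "\<dots> \<le> s / (d * (y / 2))"
        unfolding v_def using p d y2 s0 by (intro divide_left_mono mult_left_mono mult_pos_pos) auto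
      also have "\<dots> = 2 * s / d / y" by simp
      also have "\<dots> \<le> C / y" unfolding C_def using y2 by (intro divide_right_mono) auto
      finally show ?thesis .
    qed
    obtain E where E: "E \<in> events"
      "{\<omega> \<in> space M. (\<Sum>i = T..<T + k * ?K. (area (\<lambda>k. V (e k) \<omega>) i - g i \<omega>)\<^sup>2) \<le> R} \<subseteq> E"
      "prob E \<le> (1 - c / 2) ^ k + real k * (C / y)"
    proof (rule small_ball_blocks[OF V e X contrast_weight_sum _ pK contrast_weight_square_sum(1) R q B g])
      show "contrast_weight y h i = 0" if "i < p" for i
        using that y2 unfolding p_def by (intro contrast_weight_early) auto
    qed (use y2 h kK in auto)
    have "{\<omega> \<in> space M. (\<Sum>i = T..<n. (area (\<lambda>k. V (e k) \<omega>) i - g i \<omega>)\<^sup>2) \<le> R} \<subseteq> E"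
    proof (rule subset_trans[OF _ E(2)], safe)
      fix \<omega> assume "(\<Sum>i = T..<n. (area (\<lambda>k. V (e k) \<omega>) i - g i \<omega>)\<^sup>2) \<le> R"
      moreover have "(\<Sum>i = T..<T + k * ?K. (area (\<lambda>k. V (e k) \<omega>) i - g i \<omega>)\<^sup>2) \<le> (\<Sum>i = T..<n. (area (\<lambda>k. V (e k) \<omega>) i - g i \<omega>)\<^sup>2)"
        using kK by (intro sum_mono2) auto
      ultimately show "(\<Sum>i = T..<T + k * ?K. (area (\<lambda>k. V (e k) \<omega>) i - g i \<omega>)\<^sup>2) \<le> R" by simp
    qed
    then show "\<exists>E\<in>events. {\<omega> \<in> space M. (\<Sum>i = T..<n. (area (\<lambda>k. V (e k) \<omega>) i - g i \<omega>)\<^sup>2) \<le> R} \<subseteq> E \<and>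
        prob E \<le> (1 - c / 2) ^ k + real k * (C / y)"
      using E(1,3) by blast
  qed
qed

text \<open>
  In all three cases \<open>t * Z\<^sub>2 t\<close> dominates, uniformly in \<open>t \<ge> N\<close>, the squared distance on a window
  of length of order \<open>N\<close> between the areas of one queue and a path that does not depend on
  what happens to this queue in the window.
\<close>

lemma estimator_distance_bound:
  fixes M :: "'a measure" and A U :: "nat \<Rightarrow> 'a \<Rightarrow> real" and Ac Uc :: "nat \<Rightarrow> nat \<Rightarrow> 'a \<Rightarrow> real"
    and m :: nat and X :: "nat \<Rightarrow> 'a \<Rightarrow> real" and Xc :: "nat \<times> nat \<Rightarrow> 'a \<Rightarrow> real"
    and J :: "scaling \<Rightarrow> 'a \<Rightarrow> real \<Rightarrow> real"
  assumes m: "2 \<le> m"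
  defines "X \<equiv> \<lambda>k \<omega>. U k \<omega> - A (Suc k) \<omega>" and "Xc \<equiv> \<lambda>(i::nat, k) \<omega>. Uc i k \<omega> - Ac i (Suc k) \<omega>"
  defines "J \<equiv> \<lambda>\<iota> \<omega> t. t * Z2_star \<iota> m (Z1 A U \<omega>) (\<lambda>i. Z1 (Ac i) (Uc i) \<omega>) t"
  obtains (Sec) \<kappa> c0 N0 where "\<iota> = Sec" "0 < \<kappa>" "1 \<le> c0" "1 \<le> N0"
    "\<And>N. N0 \<le> N \<Longrightarrow> \<exists>T n g. T \<le> n \<and> N / c0 \<le> real n - real T \<and>
      (\<forall>i. T \<le> i \<longrightarrow> i < n \<longrightarrow> g i \<in> borel_measurable (past M Xc ({1..m} \<times> UNIV - Pair 1 ` {T..}))) \<and>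
      (\<forall>\<omega> t. N \<le> t \<longrightarrow> \<kappa> * (\<Sum>i = T..<n. (area (\<lambda>k. Xc (1, k) \<omega>) i - g i \<omega>)\<^sup>2) \<le> J \<iota> \<omega> t)"
  | (single) \<kappa> c0 N0 where "\<iota> \<noteq> Sec" "0 < \<kappa>" "1 \<le> c0" "1 \<le> N0"
    "\<And>N. N0 \<le> N \<Longrightarrow> \<exists>T n g. T \<le> n \<and> N / c0 \<le> real n - real T \<and>
      (\<forall>i. T \<le> i \<longrightarrow> i < n \<longrightarrow> g i \<in> borel_measurable (past M X (UNIV - (\<lambda>k. k) ` {T..}))) \<and>
      (\<forall>\<omega> t. N \<le> t \<longrightarrow> \<kappa> * (\<Sum>i = T..<n. (area (\<lambda>k. X k \<omega>) i - g i \<omega>)\<^sup>2) \<le> J \<iota> \<omega> t)"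
proof (cases \<iota>)
  \<comment> \<open>The other queue is independent of the first one, so the window may start at 0.\<close>
  case 1: Sec
  show thesis
  proof (rule Sec[OF 1, of "1 / (2 * (real m - 1))" 2 2])
    show "0 < 1 / (2 * (real m - 1))" using m by simp
    fix N :: real assume N: "2 \<le> N"
    define n where "n = nat \<lfloor>N\<rfloor>"
    have n: "real n \<le> N" "N / 2 \<le> real n - real 0" unfolding n_def using N by linarith+
    show "\<exists>T n g. T \<le> n \<and> N / 2 \<le> real n - real T \<and>
      (\<forall>i. T \<le> i \<longrightarrow> i < n \<longrightarrow> g i \<in> borel_measurable (past M Xc ({1..m} \<times> UNIV - Pair 1 ` {T..}))) \<and>
      (\<forall>\<omega> t. N \<le> t \<longrightarrow> 1 / (2 * (real m - 1)) * (\<Sum>i = T..<n. (area (\<lambda>k. Xc (1, k) \<omega>) i - g i \<omega>)\<^sup>2) \<le> J \<iota> \<omega> t)"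
    proof (rule exI[of _ 0], rule exI[of _ n], rule exI[of _ "\<lambda>i \<omega>. area (\<lambda>k. Xc (2, k) \<omega>) i"], intro conjI allI impI n(2))
      fix i show "(\<lambda>\<omega>. area (\<lambda>k. Xc (2, k) \<omega>) i) \<in> borel_measurable (past M Xc ({1..m} \<times> UNIV - Pair 1 ` {0..}))"
        by (intro area_measurable_upto past_coordinate) (use m in auto)
    next
      fix \<omega> t assume t: "N \<le> t"
      have "(\<Sum>i<n. (area (\<lambda>k. Xc (1, k) \<omega>) i - area (\<lambda>k. Xc (2, k) \<omega>) i)\<^sup>2) / (2 * (real m - 1))
          \<le> t * Z2_sec m (\<lambda>i s. area (\<lambda>k. Xc (i, k) \<omega>) (nat \<lfloor>s\<rfloor>)) t"
        using t N n by (intro Z2_sec_lower_bound[OF m]) auto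
      then show "1 / (2 * (real m - 1)) * (\<Sum>i = 0..<n. (area (\<lambda>k. Xc (1, k) \<omega>) i - area (\<lambda>k. Xc (2, k) \<omega>) i)\<^sup>2) \<le> J \<iota> \<omega> t"
        unfolding J_def 1 Xc_def by (simp add: atLeast0LessThan Z1_eq_area[abs_def])
    qed simp
  qed auto
next
  case 2: Bm
  \<comment> \<open>Up to time \<open>N\<close> the competing path only looks at times up to \<open>c * N\<close>, where the window starts.\<close>
  define c where "c = 1 - 1 / real m"
  have c: "0 < c" "c \<le> 1" unfolding c_def using m by auto
  show thesis
  proof (rule single[of "c\<^sup>2 / (real m - 1)" "2 * real m" "4 * real m"])
    show "0 < c\<^sup>2 / (real m - 1)" using m c by simp
    fix N :: real assume N: "4 * real m \<le> N"
    have N8: "8 \<le> N" using N m by simp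
    define n where "n = nat \<lfloor>N\<rfloor>"
    define T where "T = nat \<lceil>c * N\<rceil>"
    define g where "g i \<omega> = (LINT s:{real i..<real i + 1}|lborel. area (\<lambda>k. X k \<omega>) (nat \<lfloor>c * s\<rfloor>)) / c" for i and \<omega>
    have n: "real n \<le> N" "N - 1 \<le> real n" unfolding n_def using N8 by linarith+
    have T: "c * N \<le> real T" "real T \<le> c * N + 1" unfolding T_def using N8 c by (auto simp: of_nat_ceiling)
    have "N / (2 * real m) + 2 \<le> N / real m" using N m by (simp add: field_simps)
    moreover have "c * N = N - N / real m" unfolding c_def by (simp add: algebra_simps)
    ultimately have len: "N / (2 * real m) \<le> real n - real T" using n T by linarith
    have "0 \<le> N / (2 * real m)" using N8 by simp
    then have Tn: "T \<le> n" using len by simp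
    show "\<exists>T n g. T \<le> n \<and> N / (2 * real m) \<le> real n - real T \<and>
      (\<forall>i. T \<le> i \<longrightarrow> i < n \<longrightarrow> g i \<in> borel_measurable (past M X (UNIV - (\<lambda>k. k) ` {T..}))) \<and>
      (\<forall>\<omega> t. N \<le> t \<longrightarrow> c\<^sup>2 / (real m - 1) * (\<Sum>i = T..<n. (area (\<lambda>k. X k \<omega>) i - g i \<omega>)\<^sup>2) \<le> J \<iota> \<omega> t)"
    proof (rule exI[of _ T], rule exI[of _ n], rule exI[of _ g], intro conjI allI impI Tn len)
      fix i assume i: "T \<le> i" "i < n"
      have fin: "emeasure lborel {real i..<real i + 1} < \<infinity>" by (rule emeasure_interval_finite)
      have cs: "0 \<le> c * s + 0 \<and> c * s + 0 < real T" if s: "s \<in> {real i..<real i + 1}" for s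
      proof -
        have "real i + 1 \<le> real n" using i by (simp add: nat_less_real_le)
        then have "s < N" using s n by simp
        then have "c * s < c * N" using c by simp
        moreover have "0 \<le> c * s" using s c by simp
        ultimately show ?thesis using T by simp
      qed
      have eq: "g i \<omega> = (\<Sum>k<T. area (\<lambda>k. X k \<omega>) k * measure lborel ({real i..<real i + 1} \<inter> {s. real k \<le> c * s + 0 \<and> c * s + 0 < real k + 1})) / c" for \<omega>
        unfolding g_def using step_path_integral[OF _ fin cs, of "area (\<lambda>k. X k \<omega>)"] by simp
      show "g i \<in> borel_measurable (past M X (UNIV - (\<lambda>k. k) ` {T..}))"
        unfolding eq[abs_def]
        by (intro borel_measurable_divide borel_measurable_sum borel_measurable_times borel_measurable_const area_measurable_upto past_coordinate) auto
    next
      fix \<omega> t assume t: "N \<le> t"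
      show "c\<^sup>2 / (real m - 1) * (\<Sum>i = T..<n. (area (\<lambda>k. X k \<omega>) i - g i \<omega>)\<^sup>2) \<le> J \<iota> \<omega> t"
        using Z2_bm_lower_bound[OF m, where t = t and n = n and ?T0.0 = T and Z = "area (\<lambda>k. X k \<omega>)"] t N8 n
        unfolding J_def 2 g_def X_def c_def by (simp add: Z1_eq_area[abs_def])
    qed
  qed (use m 2 in auto)
next
  case 3: Rs
  show thesis
  \<comment> \<open>The regression line is fitted on the first half of \<open>[0, N / 2]\<close> and used on the second half.\<close>
  proof (rule single[of "1 / 164" 8 4])
    fix N :: real assume N: "4 \<le> N"
    define n where "n = nat \<lfloor>N / 2\<rfloor>"
    define T where "T = n div 2"
    define g where "g i \<omega> = (\<Sum>i<T. (real i + 1 / 2) * area (\<lambda>k. X k \<omega>) i) / (\<Sum>i<T. (real i + 1 / 2)\<^sup>2) * (real i + 1 / 2)" for i \<omega>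
    have n: "real n \<le> N / 2" "N / 2 - 1 \<le> real n" unfolding n_def using N by linarith+
    have n2: "2 \<le> n" unfolding n_def using N by linarith
    have T: "0 < T" "n \<le> 3 * T" "T \<le> n" "2 * T \<le> n" unfolding T_def using n2 by auto
    have "2 * real T \<le> real n" using T(4) by linarith
    then have len: "N / 8 \<le> real n - real T" using n N by linarith
    show "\<exists>T n g. T \<le> n \<and> N / 8 \<le> real n - real T \<and>
      (\<forall>i. T \<le> i \<longrightarrow> i < n \<longrightarrow> g i \<in> borel_measurable (past M X (UNIV - (\<lambda>k. k) ` {T..}))) \<and>
      (\<forall>\<omega> t. N \<le> t \<longrightarrow> 1 / 164 * (\<Sum>i = T..<n. (area (\<lambda>k. X k \<omega>) i - g i \<omega>)\<^sup>2) \<le> J \<iota> \<omega> t)"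
    proof (rule exI[of _ T], rule exI[of _ n], rule exI[of _ g], intro conjI allI impI T(3) len)
      fix i show "g i \<in> borel_measurable (past M X (UNIV - (\<lambda>k. k) ` {T..}))"
        unfolding g_def[abs_def]
        by (intro borel_measurable_divide borel_measurable_sum borel_measurable_times borel_measurable_const area_measurable_upto past_coordinate) auto
    next
      fix \<omega> t assume t: "N \<le> t"
      show "1 / 164 * (\<Sum>i = T..<n. (area (\<lambda>k. X k \<omega>) i - g i \<omega>)\<^sup>2) \<le> J \<iota> \<omega> t"
        using Z2_rs_lower_bound[where N = N and t = t and n = n and T = T and Z = "area (\<lambda>k. X k \<omega>)"] t N n T
        unfolding J_def 3 g_def X_def by (simp add: Z1_eq_area[abs_def])
    qed
  qed (use 3 in auto)
qed

lemma (in prob_space) distant_path_small_ball: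
  fixes V :: "'i \<Rightarrow> 'a \<Rightarrow> real" and e :: "nat \<Rightarrow> 'i" and J :: "'a \<Rightarrow> real \<Rightarrow> real"
  assumes V: "indep_vars (\<lambda>_. borel) V I" and e: "inj e" "range e \<subseteq> I"
    and X: "iid_sequence M Q (\<lambda>k. V (e k))" and sq: "integrable Q (\<lambda>x. x\<^sup>2)" and neg: "(\<integral>x. x \<partial>Q) < 0"
    and h: "0 \<le> h" "h \<le> 1" and c: "0 < c" "c < 1"
    and spread: "\<And>y r. y0 \<le> y \<Longrightarrow> prob {\<omega> \<in> space M. \<bar>contrast h y (\<lambda>k. V (e k) \<omega>) - r\<bar> \<le> c * b y} \<le> 1 - c"
    and \<kappa>: "0 < \<kappa>"
    and dist: "\<And>n. N0 \<le> n \<Longrightarrow> \<exists>T n' g. T \<le> n' \<and> n / c0 \<le> real n' - real T \<and>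
        (\<forall>i. T \<le> i \<longrightarrow> i < n' \<longrightarrow> g i \<in> borel_measurable (past M V (I - e ` {T..}))) \<and>
        (\<forall>\<omega> t. n \<le> t \<longrightarrow> \<kappa> * (\<Sum>i = T..<n'. (area (\<lambda>k. V (e k) \<omega>) i - g i \<omega>)\<^sup>2) \<le> J \<omega> t)"
  obtains y2 C where "0 < C"
    "\<forall>n y k R. N0 \<le> n \<longrightarrow> y2 \<le> y \<longrightarrow> real k * (4 * y) \<le> n / c0 \<longrightarrow> sqrt (2 / y * (R / \<kappa>)) \<le> c * b y \<longrightarrow>
      (\<exists>E\<in>events. {\<omega> \<in> space M. \<exists>t\<ge>n. J \<omega> t \<le> R} \<subseteq> E \<and> prob E \<le> (1 - c / 2) ^ k + real k * (C / y))"
proof (rule path_small_ball[OF V e X sq neg h c spread])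
  fix y2 C
  assume C: "0 < C" and ball: "\<And>y k T n g R. y2 \<le> y \<Longrightarrow> T \<le> n \<Longrightarrow> real k * (4 * y) \<le> real n - real T \<Longrightarrow>
      (\<And>i. T \<le> i \<Longrightarrow> i < n \<Longrightarrow> g i \<in> borel_measurable (past M V (I - e ` {T..}))) \<Longrightarrow>
      sqrt (2 / y * R) \<le> c * b y \<Longrightarrow>
      \<exists>E\<in>events. {\<omega> \<in> space M. (\<Sum>i = T..<n. (area (\<lambda>k. V (e k) \<omega>) i - g i \<omega>)\<^sup>2) \<le> R} \<subseteq> E \<and>
        prob E \<le> (1 - c / 2) ^ k + real k * (C / y)"
  show thesis
  proof (rule that[OF C, of y2], intro allI impI)
    fix n y R :: real and k :: nat
    assume n: "N0 \<le> n" and y: "y2 \<le> y" and k: "real k * (4 * y) \<le> n / c0"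
      and R: "sqrt (2 / y * (R / \<kappa>)) \<le> c * b y"
    obtain T n' g where T: "T \<le> n'" "n / c0 \<le> real n' - real T"
      and g: "\<forall>i. T \<le> i \<longrightarrow> i < n' \<longrightarrow> g i \<in> borel_measurable (past M V (I - e ` {T..}))"
      and low: "\<forall>\<omega> t. n \<le> t \<longrightarrow> \<kappa> * (\<Sum>i = T..<n'. (area (\<lambda>k. V (e k) \<omega>) i - g i \<omega>)\<^sup>2) \<le> J \<omega> t"
      using dist[OF n] by (elim exE conjE) (rule that)
    have len: "real k * (4 * y) \<le> real n' - real T" using k T(2) by linarith
    have "\<exists>E\<in>events. {\<omega> \<in> space M. (\<Sum>i = T..<n'. (area (\<lambda>k. V (e k) \<omega>) i - g i \<omega>)\<^sup>2) \<le> R / \<kappa>} \<subseteq> E \<and>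
        prob E \<le> (1 - c / 2) ^ k + real k * (C / y)"
    proof (rule ball[OF y T(1) len _ R])
      show "g i \<in> borel_measurable (past M V (I - e ` {T..}))" if "T \<le> i" "i < n'" for i
        using g that by blast
    qed
    then obtain E where E: "E \<in> events"
      "{\<omega> \<in> space M. (\<Sum>i = T..<n'. (area (\<lambda>k. V (e k) \<omega>) i - g i \<omega>)\<^sup>2) \<le> R / \<kappa>} \<subseteq> E"
      "prob E \<le> (1 - c / 2) ^ k + real k * (C / y)"
      by (elim bexE conjE)
    have "{\<omega> \<in> space M. \<exists>t\<ge>n. J \<omega> t \<le> R} \<subseteq> E"
    proof (rule subset_trans[OF _ E(2)], safe)
      fix \<omega> t assume "n \<le> t" "J \<omega> t \<le> R"
      then have "\<kappa> * (\<Sum>i = T..<n'. (area (\<lambda>k. V (e k) \<omega>) i - g i \<omega>)\<^sup>2) \<le> R" using low by (meson order_trans)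
      then show "(\<Sum>i = T..<n'. (area (\<lambda>k. V (e k) \<omega>) i - g i \<omega>)\<^sup>2) \<le> R / \<kappa>"
        using \<kappa> by (simp add: pos_le_divide_eq mult.commute)
    qed
    then show "\<exists>E\<in>events. {\<omega> \<in> space M. \<exists>t\<ge>n. J \<omega> t \<le> R} \<subseteq> E \<and> prob E \<le> (1 - c / 2) ^ k + real k * (C / y)"
      using E(1,3) by blast
  qed
qed

text \<open>
  The distance bound turns a small estimator into a small ball event for the areas, whose radius is
  compared with the fluctuation \<open>b y\<close> of \<open>k\<close> blocks of length of order \<open>y\<close>. The union over all real
  \<open>t \<ge> n\<close> is uncountable, hence the measurable event \<open>E\<close> that covers it.
\<close>

lemma estimator_small_ball:
  fixes M :: "'a measure" and \<iota> :: scaling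
  assumes \<alpha>: "2 < \<alpha>"
    and q: "mg1_queue M lamA muU \<alpha> A U" and m: "2 \<le> m"
    and copies: "independent_mg1_copies M lamA muU \<alpha> U m Ac Uc"
    and ell: "slowly_varying ell" and L: "stable_levy_process (\<alpha> / 2) N L"
    and conv: "weakly_converges_M1 (at_right 0)
      M (\<lambda>\<epsilon> \<omega> t. \<epsilon> powr (2 / \<alpha>) * ell (1 / \<epsilon>) * (Z1 A U \<omega> (t / \<epsilon>) - t / \<epsilon> * mu_W M A U))
      N (\<lambda>\<omega> t. L \<omega> (t / E_tau1 M A U))"
  defines "b \<equiv> \<lambda>y. y powr (2 / \<alpha>) / ell y"
  obtains \<kappa> c c0 C C' y1 where "0 < \<kappa>" "0 < c" "c < 1" "1 \<le> c0" "0 < C" "0 < C'" "1 \<le> y1"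
    "\<And>y. y1 \<le> y \<Longrightarrow> 0 < ell y" "\<And>y. y1 \<le> y \<Longrightarrow> b y \<le> C' * y"
    "\<And>n y k R. y1 \<le> n \<Longrightarrow> y1 \<le> y \<Longrightarrow> real k * (4 * y) \<le> n / c0 \<Longrightarrow> sqrt (2 / y * (R / \<kappa>)) \<le> c * b y \<Longrightarrow>
      \<exists>E\<in>sets M. {\<omega> \<in> space M. \<exists>t\<ge>n. t * Z2_star \<iota> m (Z1 A U \<omega>) (\<lambda>i. Z1 (Ac i) (Uc i) \<omega>) t \<le> R} \<subseteq> E \<and>
        measure M E \<le> (1 - c / 2) ^ k + real k * (C / y)"
proof -
  define Q where "Q = distr (distr M borel (U 0) \<Otimes>\<^sub>M density lborel (exponential_density lamA)) borel (\<lambda>(u, a). u - a)"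
  define X where "X = (\<lambda>k \<omega>. U k \<omega> - A (Suc k) \<omega>)"
  define Xc where "Xc = (\<lambda>(i, k) \<omega>. Uc i k \<omega> - Ac i (Suc k) \<omega>)"
  define J where "J \<omega> t = t * Z2_star \<iota> m (Z1 A U \<omega>) (\<lambda>i. Z1 (Ac i) (Uc i) \<omega>) t" for \<omega> t
  interpret prob_space M using q unfolding mg1_queue_def by simp
  have iid: "iid_sequence M Q X" and sq: "integrable Q (\<lambda>x. x\<^sup>2)" and neg: "(\<integral>x. x \<partial>Q) < 0"
    using mg1_queue_increments[OF q \<alpha>] unfolding Q_def X_def by auto
  obtain h c y0 where h: "0 < h" "h \<le> 1" and c: "0 < c" "c < 1" and y0: "1 \<le> y0"
    and ellpos: "\<And>y. y0 \<le> y \<Longrightarrow> 0 < ell y"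
    and spread: "\<And>y r. y0 \<le> y \<Longrightarrow> prob {\<omega> \<in> space M. \<bar>contrast h y (\<lambda>k. X k \<omega>) - r\<bar> \<le> c * b y} \<le> 1 - c"
    using queue_contrast_spread[OF q \<alpha> ell L conv] unfolding X_def b_def by blast
  have bpos: "0 < b y" if "y0 \<le> y" for y unfolding b_def using ellpos[OF that] that y0 by simp
  obtain C' where C': "0 < C'" "\<And>y. y0 \<le> y \<Longrightarrow> b y \<le> C' * y"
  proof (rule contrast_scale_linear_bound[OF iid sq neg less_imp_le[OF h(1)] h(2) c(1) _ y0, of b])
    show "0 < b y \<and> prob {\<omega> \<in> space M. \<bar>contrast h y (\<lambda>k. X k \<omega>)\<bar> \<le> c * b y} \<le> 1 - c" if "y0 \<le> y" for y
      using bpos[OF that] spread[OF that, of 0] by simp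
  qed blast
  note found = that
  have finish: thesis
    if \<kappa>: "0 < \<kappa>" and c0: "1 \<le> c0" and C: "0 < C" and
      ball: "\<forall>n y k R. N0 \<le> n \<longrightarrow> y2 \<le> y \<longrightarrow> real k * (4 * y) \<le> n / c0 \<longrightarrow> sqrt (2 / y * (R / \<kappa>)) \<le> c * b y \<longrightarrow>
        (\<exists>E\<in>events. {\<omega> \<in> space M. \<exists>t\<ge>n. J \<omega> t \<le> R} \<subseteq> E \<and> prob E \<le> (1 - c / 2) ^ k + real k * (C / y))"
    for \<kappa> c0 C N0 y2
  proof (rule found[of \<kappa> c c0 C C' "max y0 (max N0 y2)", OF \<kappa> c c0 C C'(1)])
    show "1 \<le> max y0 (max N0 y2)" using y0 by simp
    show "0 < ell y" "b y \<le> C' * y" if "max y0 (max N0 y2) \<le> y" for y using that by (auto intro: ellpos C'(2))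
    show "\<exists>E\<in>events. {\<omega> \<in> space M. \<exists>t\<ge>n. t * Z2_star \<iota> m (Z1 A U \<omega>) (\<lambda>i. Z1 (Ac i) (Uc i) \<omega>) t \<le> R} \<subseteq> E \<and>
        prob E \<le> (1 - c / 2) ^ k + real k * (C / y)"
      if "max y0 (max N0 y2) \<le> n" "max y0 (max N0 y2) \<le> y" "real k * (4 * y) \<le> n / c0" "sqrt (2 / y * (R / \<kappa>)) \<le> c * b y"
      for n y k R
      using ball that unfolding J_def by simp
  qed
  show thesis
  proof (rule estimator_distance_bound[OF m, where \<iota> = \<iota> and M = M and A = A and U = U and Ac = Ac and Uc = Uc])
    fix \<kappa> c0 N0 :: real
    assume a: "\<iota> = Sec" "0 < \<kappa>" "1 \<le> c0" "1 \<le> N0"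
      and dist: "\<And>N. N0 \<le> N \<Longrightarrow> \<exists>T n g. T \<le> n \<and> N / c0 \<le> real n - real T \<and>
      (\<forall>i. T \<le> i \<longrightarrow> i < n \<longrightarrow> g i \<in> borel_measurable (past M (\<lambda>(i, k) \<omega>. Uc i k \<omega> - Ac i (Suc k) \<omega>) ({1..m} \<times> UNIV - Pair 1 ` {T..}))) \<and>
      (\<forall>\<omega> t. N \<le> t \<longrightarrow> \<kappa> * (\<Sum>i = T..<n. (area (\<lambda>k. (case (1, k) of (i, k) \<Rightarrow> \<lambda>\<omega>. Uc i k \<omega> - Ac i (Suc k) \<omega>) \<omega>) i - g i \<omega>)\<^sup>2)
        \<le> t * Z2_star \<iota> m (Z1 A U \<omega>) (\<lambda>i. Z1 (Ac i) (Uc i) \<omega>) t)"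
    have iidc: "iid_sequence M Q (\<lambda>k. Xc (1, k))" and indc: "indep_vars (\<lambda>_. borel) Xc ({1..m} \<times> UNIV)"
      using mg1_copies_increments[OF copies \<alpha> m] unfolding Q_def Xc_def by auto
    have spreadc: "prob {\<omega> \<in> space M. \<bar>contrast h y (\<lambda>k. Xc (1, k) \<omega>) - r\<bar> \<le> c * b y} \<le> 1 - c" if "y0 \<le> y" for y r
    proof -
      have "Measurable.pred seq_space (\<lambda>x. \<bar>contrast h y x - r\<bar> \<le> c * b y)" by measurable
      from iid_same_law[OF iidc iid this] spread[OF that] show ?thesis by simp
    qed
    have eI: "inj (Pair (1::nat) :: nat \<Rightarrow> _)" "range (Pair (1::nat) :: nat \<Rightarrow> _) \<subseteq> {1..m} \<times> UNIV"
      using m by (auto simp: inj_def)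
    obtain y2 C where y2: "0 < C" "\<forall>n y k R. N0 \<le> n \<longrightarrow> y2 \<le> y \<longrightarrow> real k * (4 * y) \<le> n / c0 \<longrightarrow> sqrt (2 / y * (R / \<kappa>)) \<le> c * b y \<longrightarrow>
      (\<exists>E\<in>events. {\<omega> \<in> space M. \<exists>t\<ge>n. J \<omega> t \<le> R} \<subseteq> E \<and> prob E \<le> (1 - c / 2) ^ k + real k * (C / y))"
      by (rule distant_path_small_ball[OF indc eI iidc sq neg less_imp_le[OF h(1)] h(2) c spreadc a(2) dist[folded Xc_def J_def]]) blast
    show thesis by (rule finish[OF a(2,3) y2])
  next
    fix \<kappa> c0 N0 :: real
    assume a: "\<iota> \<noteq> Sec" "0 < \<kappa>" "1 \<le> c0" "1 \<le> N0"
      and dist: "\<And>N. N0 \<le> N \<Longrightarrow> \<exists>T n g. T \<le> n \<and> N / c0 \<le> real n - real T \<and>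
      (\<forall>i. T \<le> i \<longrightarrow> i < n \<longrightarrow> g i \<in> borel_measurable (past M (\<lambda>k \<omega>. U k \<omega> - A (Suc k) \<omega>) (UNIV - (\<lambda>k. k) ` {T..}))) \<and>
      (\<forall>\<omega> t. N \<le> t \<longrightarrow> \<kappa> * (\<Sum>i = T..<n. (area (\<lambda>k. U k \<omega> - A (Suc k) \<omega>) i - g i \<omega>)\<^sup>2)
        \<le> t * Z2_star \<iota> m (Z1 A U \<omega>) (\<lambda>i. Z1 (Ac i) (Uc i) \<omega>) t)"
    have ind: "indep_vars (\<lambda>_. borel) X UNIV" using iid unfolding iid_sequence_def by simp
    have eI: "inj (\<lambda>k::nat. k)" "range (\<lambda>k::nat. k) \<subseteq> UNIV" by auto
    obtain y2 C where y2: "0 < C" "\<forall>n y k R. N0 \<le> n \<longrightarrow> y2 \<le> y \<longrightarrow> real k * (4 * y) \<le> n / c0 \<longrightarrow> sqrt (2 / y * (R / \<kappa>)) \<le> c * b y \<longrightarrow>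
      (\<exists>E\<in>events. {\<omega> \<in> space M. \<exists>t\<ge>n. J \<omega> t \<le> R} \<subseteq> E \<and> prob E \<le> (1 - c / 2) ^ k + real k * (C / y))"
    proof (rule distant_path_small_ball[OF ind eI iid sq neg less_imp_le[OF h(1)] h(2) c spread a(2)])
      show "\<exists>T n' g. T \<le> n' \<and> n / c0 \<le> real n' - real T \<and>
          (\<forall>i. T \<le> i \<longrightarrow> i < n' \<longrightarrow> g i \<in> borel_measurable (past M X (UNIV - (\<lambda>k. k) ` {T..}))) \<and>
          (\<forall>\<omega> t. n \<le> t \<longrightarrow> \<kappa> * (\<Sum>i = T..<n'. (area (\<lambda>k. X k \<omega>) i - g i \<omega>)\<^sup>2) \<le> J \<omega> t)" if "N0 \<le> n" for n
        using dist[OF that] unfolding X_def J_def .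
    qed blast
    show thesis by (rule finish[OF a(2,3) y2])
  qed
qed

section \<open>Dyadic levels\<close>

text \<open>
  Bookkeeping for the levels \<open>a / 2 ^ (l + 1) < n \<le> a / 2 ^ l\<close>, where \<open>a = Ainv (1 / \<epsilon>)\<close>. On level
  \<open>l\<close> the window is cut into \<open>l\<close> blocks, whose scale \<open>y\<close> is smaller than the window by the factor
  \<open>2 ^ (l div d)\<close>. Since \<open>\<epsilon> * A y\<close> decays geometrically in \<open>l\<close>, at least like \<open>2 powr (- (1 - 2 / \<alpha>) l / 2)\<close>,
  a large \<open>d\<close> makes a block fluctuate more than the estimator admits. All scales differ from \<open>a\<close> by
  powers of 2, so that the limit of \<open>A (2 * x) / A x\<close> and iteration control all ratios that occur.
\<close>

lemma dyadic_levels: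
  fixes \<alpha> \<nu> K \<kappa> c c0 C C' y1 :: real and ell Ainv :: "real \<Rightarrow> real"
  defines "b \<equiv> \<lambda>y. y powr (2 / \<alpha>) / ell y"
  assumes \<alpha>: "2 < \<alpha>" and \<nu>: "0 < \<nu>" and K: "0 < K" and \<kappa>: "0 < \<kappa>" and c: "0 < c" and c0: "1 \<le> c0"
    and C: "0 < C" and C': "0 < C'" and y1: "1 \<le> y1"
    and ell: "slowly_varying ell" and ellpos: "\<And>y. y1 \<le> y \<Longrightarrow> 0 < ell y" and bC: "\<And>y. y1 \<le> y \<Longrightarrow> b y \<le> C' * y"
    and Ainv: "asymptotic_inverse (\<lambda>x. x powr (1 - 2 / \<alpha>) * ell x) Ainv"
  obtains \<epsilon>0 :: real and l0 d :: nat where "0 < \<epsilon>0" "\<epsilon>0 \<le> 1"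
    "\<forall>\<epsilon> l a n y. 0 < \<epsilon> \<longrightarrow> \<epsilon> < \<epsilon>0 \<longrightarrow> l0 \<le> l \<longrightarrow> a = Ainv (1 / \<epsilon>) \<longrightarrow> \<epsilon> powr (- \<nu>) \<le> a / 2 ^ l \<longrightarrow>
      n = a / 2 ^ Suc l \<longrightarrow> y = n / 2 ^ (l div d) \<longrightarrow>
      y1 \<le> n \<and> y1 \<le> y \<and> real l * (4 * y) \<le> n / c0 \<and> sqrt (2 / y * (8 * K\<^sup>2 * \<epsilon>\<^sup>2 * n ^ 3 / \<kappa>)) \<le> c * b y \<and>
      real l * (C / y) \<le> 2 * C * \<epsilon> powr (- (\<nu> / 2)) * 2 ^ l / a"
proof -
  define \<gamma> where "\<gamma> = 1 - 2 / \<alpha>"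
  have \<gamma>: "0 < \<gamma>" unfolding \<gamma>_def using \<alpha> by simp
  define A where "A x = x powr \<gamma> * ell x" for x
  have bA: "b y = y / A y" if "0 < y" for y
  proof -
    have "y = y powr (2 / \<alpha>) * y powr \<gamma>" unfolding \<gamma>_def using that by (simp add: powr_add[symmetric])
    then show ?thesis unfolding b_def A_def using that
      by (metis mult_divide_mult_cancel_right powr_gt_zero less_irrefl mult.commute)
  qed
  define \<rho> where "\<rho> = 2 powr (\<gamma> / 2)"
  have \<rho>1: "1 < \<rho>" unfolding \<rho>_def using \<gamma> by simp
  have "((\<lambda>x. ell (2 * x) / ell x) \<longlongrightarrow> 2 powr 0) at_top" using ell unfolding regularly_varying_def by auto
  then have "((\<lambda>x. ell (2 * x) / ell x) \<longlongrightarrow> 1) at_top" by simp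
  moreover have "2 powr (- (\<gamma> / 2)) < (1::real)" using \<gamma> powr_less_mono[of "- (\<gamma> / 2)" 0 "2::real"] by simp
  ultimately have "\<forall>\<^sub>F x in at_top. 2 powr (- (\<gamma> / 2)) < ell (2 * x) / ell x" by (rule order_tendstoD)
  then obtain x1 where x1: "\<And>x. x1 \<le> x \<Longrightarrow> 2 powr (- (\<gamma> / 2)) < ell (2 * x) / ell x"
    unfolding eventually_at_top_linorder by blast
  define X1 where "X1 = max y1 x1"
  have X1: "1 \<le> X1" "y1 \<le> X1" "x1 \<le> X1" unfolding X1_def using y1 by auto
  have Apos: "0 < A x" if "X1 \<le> x" for x unfolding A_def using ellpos[of x] X1 that by simp
  have Astep: "\<rho> * A x \<le> A (2 * x)" if x: "X1 \<le> x" for x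
  proof -
    have x0: "0 < x" using x X1 by simp
    have e0: "0 < ell x" using ellpos X1 x by simp
    have "2 powr (- (\<gamma> / 2)) * ell x < ell (2 * x)" using x1[of x] X1 x e0 by (simp add: pos_less_divide_eq)
    then have "(2 * x) powr \<gamma> * (2 powr (- (\<gamma> / 2)) * ell x) \<le> A (2 * x)"
      unfolding A_def by (intro mult_left_mono) auto
    moreover have "(2 * x) powr \<gamma> * (2 powr (- (\<gamma> / 2)) * ell x) = (2 powr \<gamma> * 2 powr (- (\<gamma> / 2))) * A x"
      unfolding A_def using x0 by (simp add: powr_mult)
    moreover have "2 powr \<gamma> * 2 powr (- (\<gamma> / 2)) = \<rho>" unfolding \<rho>_def by (simp add: powr_add[symmetric])
    ultimately show ?thesis by simp
  qed
  have Apow: "\<rho> ^ j * A x \<le> A (2 ^ j * x)" if x: "X1 \<le> x" for j x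
  proof (induction j)
    case (Suc j)
    have "\<rho> ^ Suc j * A x \<le> \<rho> * A (2 ^ j * x)" using Suc \<rho>1 by simp
    also have "\<dots> \<le> A (2 * (2 ^ j * x))"
    proof (rule Astep)
      have "1 * x \<le> 2 ^ j * x" using x X1 by (intro mult_right_mono) auto
      then show "X1 \<le> 2 ^ j * x" using x by simp
    qed
    finally show ?case by (simp add: mult.assoc)
  qed simp
  \<comment> \<open>Iteration alone relates values along one sequence \<open>x, 2x, 4x, \<dots>\<close>; the bound on \<open>b\<close> provides a common
    starting value.\<close>
  have Alow: "1 / C' \<le> A x" if x: "X1 \<le> x" for x
  proof -
    have x0: "0 < x" using x X1 by simp
    have "x / A x \<le> C' * x" using bC[of x] bA[OF x0] X1 x by simp
    then have "x \<le> C' * x * A x" using Apos[OF x] by (simp add: pos_divide_le_eq)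
    then have "x * 1 \<le> x * (C' * A x)" by (simp add: mult_ac)
    then have "1 \<le> C' * A x" using x0 by (rule mult_left_le_imp_le)
    then show ?thesis using C' by (simp add: pos_divide_le_eq mult.commute)
  qed
  \<comment> \<open>The inverse grows at most polynomially.\<close>
  define D where "D = 2 / \<gamma> + 1"
  define B where "B = 2 * X1 * (2 * C') powr (2 / \<gamma>)"
  have B: "0 < B" unfolding B_def using X1 C' by simp
  have growth: "a \<le> B * \<epsilon> powr (- (2 / \<gamma>))" if a: "X1 \<le> a" and e: "0 < \<epsilon>" and Aa: "A a \<le> 2 / \<epsilon>" for a \<epsilon>
  proof -
    have "\<exists>j. a < 2 ^ j * X1"
    proof -
      obtain j where "a < 2 ^ j" using real_arch_pow[of 2 a] by auto
      also have "2 ^ j \<le> 2 ^ j * X1" using X1 by simp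
      finally show ?thesis by blast
    qed
    then obtain j where j: "a < 2 ^ j * X1" "\<And>i. i < j \<Longrightarrow> \<not> a < 2 ^ i * X1"
      using exists_least_iff[of "\<lambda>j. a < 2 ^ j * X1"] by blast
    have "j \<noteq> 0" using j(1) a by (cases j) auto
    then obtain i where i: "j = Suc i" by (cases j) auto
    have xi: "X1 \<le> a / 2 ^ i" using j(2)[of i] unfolding i by (simp add: pos_le_divide_eq mult.commute)
    have "\<rho> ^ i * (1 / C') \<le> \<rho> ^ i * A (a / 2 ^ i)" using Alow[OF xi] \<rho>1 by (intro mult_left_mono) auto
    also have "\<dots> \<le> A (2 ^ i * (a / 2 ^ i))" by (rule Apow[OF xi])
    also have "\<dots> = A a" by simp
    finally have "\<rho> ^ i / C' \<le> 2 / \<epsilon>" using Aa by simp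
    then have "\<rho> ^ i \<le> 2 / \<epsilon> * C'" by (simp only: pos_divide_le_eq[OF C'])
    then have "\<rho> ^ i \<le> 2 * C' / \<epsilon>" by simp
    moreover have "\<rho> ^ i = (2 ^ i) powr (\<gamma> / 2)"
      unfolding \<rho>_def by (simp add: powr_realpow[symmetric] powr_powr mult.commute)
    ultimately have "((2 ^ i) powr (\<gamma> / 2)) powr (2 / \<gamma>) \<le> (2 * C' / \<epsilon>) powr (2 / \<gamma>)" using \<gamma> by (intro powr_mono2) auto
    moreover have "((2 ^ i) powr (\<gamma> / 2)) powr (2 / \<gamma>) = (2::real) ^ i" using \<gamma> by (simp add: powr_powr)
    moreover have "(2 * C' / \<epsilon>) powr (2 / \<gamma>) = (2 * C') powr (2 / \<gamma>) * \<epsilon> powr (- (2 / \<gamma>))"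
      using C' e by (simp add: powr_divide powr_minus_divide)
    ultimately have "2 ^ i \<le> (2 * C') powr (2 / \<gamma>) * \<epsilon> powr (- (2 / \<gamma>))" by simp
    then have "2 * X1 * 2 ^ i \<le> 2 * X1 * ((2 * C') powr (2 / \<gamma>) * \<epsilon> powr (- (2 / \<gamma>)))" using X1 by (intro mult_left_mono) auto
    then show ?thesis using j(1) unfolding i B_def by (simp add: mult_ac)
  qed
  have "\<forall>\<^sub>F x in at_top. A (Ainv x) \<le> 2 * x"
  proof -
    have "((\<lambda>x. if A (Ainv x) = 0 \<and> x = 0 then 1 else A (Ainv x) / x) \<longlongrightarrow> 1) at_top"
      using Ainv unfolding asymptotic_inverse_def asymp_equiv_def A_def \<gamma>_def .
    then have "\<forall>\<^sub>F x in at_top. (if A (Ainv x) = 0 \<and> x = 0 then 1 else A (Ainv x) / x) < 2"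
      by (rule order_tendstoD) simp
    then show ?thesis using eventually_gt_at_top[of "0::real"]
      by eventually_elim (simp add: pos_divide_less_eq split: if_splits)
  qed
  then obtain x2 where x2: "\<And>x. x2 \<le> x \<Longrightarrow> A (Ainv x) \<le> 2 * x" unfolding eventually_at_top_linorder by blast
  \<comment> \<open>The ratio of window and block scale.\<close>
  obtain d1 where d1: "8 < \<rho> ^ d1" using real_arch_pow[OF \<rho>1] by blast
  obtain d2 where d2: "4 * D / \<nu> \<le> real d2" using real_arch_simple by blast
  define d where "d = max 1 (max d1 d2)"
  have d: "1 \<le> d" "8 \<le> \<rho> ^ d" "4 * D / \<nu> \<le> real d"
  proof -
    show "1 \<le> d" unfolding d_def by simp
    have "\<rho> ^ d1 \<le> \<rho> ^ d" using \<rho>1 unfolding d_def by (intro power_increasing) auto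
    then show "8 \<le> \<rho> ^ d" using d1 by simp
    have "real d2 \<le> real d" unfolding d_def by simp
    then show "4 * D / \<nu> \<le> real d" using d2 by linarith
  qed
  have "\<forall>\<^sub>F l in sequentially. 4 * c0 * real l \<le> 2 ^ (l div d)"
  proof -
    have lim: "(\<lambda>s. real s / 2 ^ s) \<longlonglongrightarrow> 0" using lim_n_over_pown[of "2::real"] by simp
    have lim2: "(\<lambda>s. 1 / (2::real) ^ s) \<longlonglongrightarrow> 0" using LIMSEQ_inverse_realpow_zero[of "2::real"] by (simp add: inverse_eq_divide)
    have "(\<lambda>s. real s / 2 ^ s + 1 / 2 ^ s) \<longlonglongrightarrow> 0 + 0" by (rule tendsto_add[OF lim lim2])
    then have "\<forall>\<^sub>F s in sequentially. real s / 2 ^ s + 1 / 2 ^ s < 1 / (4 * c0 * real d)"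
      by (rule order_tendstoD) (use c0 d in simp)
    then have "\<forall>\<^sub>F s in sequentially. 4 * c0 * real d * (real s + 1) \<le> 2 ^ s"
    proof eventually_elim
      case (elim s)
      then have "(real s + 1) / 2 ^ s < 1 / (4 * c0 * real d)" by (simp add: add_divide_distrib)
      then show ?case using c0 d by (simp add: divide_simps mult_ac split: if_splits)
    qed
    then obtain s0 where s0: "\<And>s. s0 \<le> s \<Longrightarrow> 4 * c0 * real d * (real s + 1) \<le> 2 ^ s"
      unfolding eventually_sequentially by blast
    show ?thesis unfolding eventually_sequentially
    proof (intro exI allI impI)
      fix l assume l: "s0 * d \<le> l"
      then have s: "s0 \<le> l div d" using d(1) by (simp add: less_eq_div_iff_mult_less_eq)
      have "l \<le> d * (l div d + 1)" using d(1) by (metis add.commute dividend_less_times_div less_eq_nat.simps(1) less_imp_le mult_Suc_right order_less_le_trans plus_1_eq_Suc zero_less_one)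
      then have "real l \<le> real d * (real (l div d) + 1)" by (metis of_nat_1 of_nat_add of_nat_le_iff of_nat_mult)
      then have "4 * c0 * real l \<le> 4 * c0 * (real d * (real (l div d) + 1))" using c0 by (intro mult_left_mono) auto
      also have "\<dots> \<le> 2 ^ (l div d)" using s0[OF s] by (simp add: mult.assoc)
      finally show "4 * c0 * real l \<le> 2 ^ (l div d)" .
    qed
  qed
  moreover have "\<forall>\<^sub>F l in sequentially. 64 * K\<^sup>2 / \<kappa> / c\<^sup>2 \<le> \<rho> ^ l"
    using filterlim_realpow_sequentially_gt1[of \<rho>] \<rho>1
    by (auto simp: filterlim_at_infinity_conv_norm_at_top norm_power filterlim_at_top)
  ultimately have "\<forall>\<^sub>F l in sequentially. 4 * c0 * real l \<le> 2 ^ (l div d) \<and> 64 * K\<^sup>2 / \<kappa> / c\<^sup>2 \<le> \<rho> ^ l"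
    by (rule eventually_conj)
  then obtain l0 where l0: "\<And>l. l0 \<le> l \<Longrightarrow> 4 * c0 * real l \<le> 2 ^ (l div d) \<and> 64 * K\<^sup>2 / \<kappa> / c\<^sup>2 \<le> \<rho> ^ l"
    unfolding eventually_sequentially by blast
  \<comment> \<open>The exponent \<open>3/4 * \<nu>\<close> is left for \<open>y\<close>: the level contributes \<open>\<nu>\<close>, and cutting the window
    into blocks costs at most \<open>\<nu> / 4\<close>.\<close>
  have "\<exists>\<epsilon>0>0. \<epsilon>0 \<le> 1 \<and> (\<forall>\<epsilon>. 0 < \<epsilon> \<longrightarrow> \<epsilon> < \<epsilon>0 \<longrightarrow> x2 \<le> 1 / \<epsilon> \<and> B \<le> 1 / \<epsilon> \<and> 2 * X1 \<le> \<epsilon> powr (- (3 / 4 * \<nu>)))"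
  proof -
    define \<epsilon>0 where "\<epsilon>0 = min 1 (min (1 / max 1 x2) (min (1 / B) ((2 * X1) powr (- (1 / (3 / 4 * \<nu>))))))"
    have "0 < \<epsilon>0" unfolding \<epsilon>0_def using B X1 by simp
    moreover have "\<epsilon>0 \<le> 1" unfolding \<epsilon>0_def by simp
    moreover have "x2 \<le> 1 / \<epsilon> \<and> B \<le> 1 / \<epsilon> \<and> 2 * X1 \<le> \<epsilon> powr (- (3 / 4 * \<nu>))" if e: "0 < \<epsilon>" "\<epsilon> < \<epsilon>0" for \<epsilon>
    proof (intro conjI)
      have e1: "\<epsilon> \<le> 1 / max 1 x2" and e2: "\<epsilon> \<le> 1 / B" and e3: "\<epsilon> \<le> (2 * X1) powr (- (1 / (3 / 4 * \<nu>)))"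
        using e unfolding \<epsilon>0_def by auto
      have "max 1 x2 \<le> 1 / \<epsilon>" using e1 e by (simp add: divide_simps mult.commute split: if_splits)
      then show "x2 \<le> 1 / \<epsilon>" by simp
      show "B \<le> 1 / \<epsilon>" using e2 e B by (simp add: divide_simps mult.commute split: if_splits)
      have "((2 * X1) powr (- (1 / (3 / 4 * \<nu>)))) powr (- (3 / 4 * \<nu>)) \<le> \<epsilon> powr (- (3 / 4 * \<nu>))"
        using e3 e \<nu> by (intro powr_mono2') auto
      then show "2 * X1 \<le> \<epsilon> powr (- (3 / 4 * \<nu>))" using \<nu> X1 by (simp add: powr_powr)
    qed
    ultimately show ?thesis by blast
  qed
  then obtain \<epsilon>0 where \<epsilon>0: "0 < \<epsilon>0" "\<epsilon>0 \<le> 1" and small: "\<And>\<epsilon>. 0 < \<epsilon> \<Longrightarrow> \<epsilon> < \<epsilon>0 \<Longrightarrow> x2 \<le> 1 / \<epsilon> \<and> B \<le> 1 / \<epsilon> \<and> 2 * X1 \<le> \<epsilon> powr (- (3 / 4 * \<nu>))"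
    by blast
  show thesis
  proof (rule that[OF \<epsilon>0, of l0 d], intro allI impI)
    fix \<epsilon> a n y :: real and l :: nat
    assume e: "0 < \<epsilon>" "\<epsilon> < \<epsilon>0" and l: "l0 \<le> l" and a: "a = Ainv (1 / \<epsilon>)" and big: "\<epsilon> powr (- \<nu>) \<le> a / 2 ^ l"
      and n: "n = a / 2 ^ Suc l" and y: "y = n / 2 ^ (l div d)"
    define s where "s = l div d"
    have e1: "\<epsilon> \<le> 1" using e \<epsilon>0 by simp
    note sm = small[OF e]
    have Aa: "A a \<le> 2 / \<epsilon>" using x2[of "1 / \<epsilon>"] sm unfolding a by simp
    have X1e: "X1 \<le> \<epsilon> powr (- \<nu>)"
    proof -
      have "\<epsilon> powr (- (3 / 4 * \<nu>)) \<le> \<epsilon> powr (- \<nu>)" using e e1 \<nu> by (intro powr_mono') auto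
      then show ?thesis using sm X1 by linarith
    qed
    have pl: "\<epsilon> powr (- \<nu>) * 2 ^ l \<le> a" using big by (simp add: pos_le_divide_eq)
    have p1: "1 \<le> \<epsilon> powr (- \<nu>)" using X1e X1 by simp
    have "1 * 2 ^ l \<le> \<epsilon> powr (- \<nu>) * 2 ^ l" using p1 by (intro mult_right_mono) auto
    from order_trans[OF this pl] have la: "2 ^ l \<le> a" by (simp only: mult_1)
    have "\<epsilon> powr (- \<nu>) * 1 \<le> \<epsilon> powr (- \<nu>) * 2 ^ l" by (intro mult_left_mono) auto
    from order_trans[OF this pl] have aX: "X1 \<le> a" using X1e by (simp only: mult_1_right)
    then have a0: "0 < a" using X1 by simp
    have "a \<le> B * \<epsilon> powr (- (2 / \<gamma>))" by (rule growth[OF aX e(1) Aa])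
    also have "\<dots> \<le> 1 / \<epsilon> * \<epsilon> powr (- (2 / \<gamma>))" using sm by (intro mult_right_mono) auto
    also have "\<dots> = \<epsilon> powr (- D)" unfolding D_def using e by (simp add: powr_diff powr_minus divide_inverse powr_add)
    finally have aD: "a \<le> \<epsilon> powr (- D)" .
    have D0: "0 < D" unfolding D_def using \<gamma> by (simp add: add_pos_pos)
    have s2: "2 ^ s \<le> \<epsilon> powr (- (\<nu> / 4))"
    proof -
      have "(2 ^ s) ^ d = (2::real) ^ (s * d)" by (simp add: power_mult)
      also have "\<dots> \<le> 2 ^ l" unfolding s_def by (intro power_increasing) auto
      also have "\<dots> \<le> \<epsilon> powr (- D)" using la aD by simp
      finally have "(2 ^ s) powr real d \<le> \<epsilon> powr (- D)" by (simp add: powr_realpow)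
      then have "((2 ^ s) powr real d) powr (1 / real d) \<le> (\<epsilon> powr (- D)) powr (1 / real d)" by (intro powr_mono2) auto
      then have "2 ^ s \<le> \<epsilon> powr (- (D / real d))" using d(1) by (simp add: powr_powr)
      also have "\<dots> \<le> \<epsilon> powr (- (\<nu> / 4))"
      proof (intro powr_mono')
        have "4 * D \<le> real d * \<nu>" using d(3) \<nu> by (simp add: pos_divide_le_eq)
        then show "- (\<nu> / 4) \<le> - (D / real d)" using d(1) by (simp add: divide_simps mult.commute)
      qed (use e e1 in auto)
      finally show ?thesis .
    qed
    have ny: "n = 2 ^ s * y" unfolding y s_def by simp
    have ay: "a = 2 ^ (Suc l + s) * y" unfolding ny[symmetric] n by (simp add: power_add y s_def[symmetric] n)
    have yX: "X1 \<le> y"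
    proof -
      have "2 * X1 * 2 ^ s \<le> \<epsilon> powr (- (3 / 4 * \<nu>)) * \<epsilon> powr (- (\<nu> / 4))"
        using sm s2 X1 by (intro mult_mono) auto
      also have "\<dots> = \<epsilon> powr (- \<nu>)" by (simp add: powr_add[symmetric])
      also have "\<dots> \<le> a / 2 ^ l" by (rule big)
      also have "\<dots> = 2 * (2 ^ s * y)" unfolding ay by (simp add: power_add)
      finally have "2 ^ s * X1 \<le> 2 ^ s * y" by simp
      then show ?thesis by simp
    qed
    have y0: "0 < y" using yX X1 by simp
    have yn: "y \<le> n" unfolding ny using y0 mult_right_mono[of 1 "2 ^ s" y] by simp
    have "\<rho> ^ l * (\<epsilon> * A y) \<le> 2"
    proof -
      have "\<rho> ^ l * A y \<le> \<rho> ^ (Suc l + s) * A y"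
        using Apos[OF yX] \<rho>1 by (intro mult_right_mono power_increasing) auto
      also have "\<dots> \<le> A a" unfolding ay by (rule Apow[OF yX])
      finally have "\<rho> ^ l * A y \<le> 2 / \<epsilon>" using Aa by simp
      then show ?thesis using e by (simp add: pos_le_divide_eq mult_ac)
    qed
    then have "(\<rho> ^ l * (\<epsilon> * A y))\<^sup>2 \<le> 2\<^sup>2"
      using Apos[OF yX] \<rho>1 e by (intro power_mono mult_nonneg_nonneg) auto
    then have eA: "(\<rho> ^ l)\<^sup>2 * (\<epsilon> * A y)\<^sup>2 \<le> 4" by (simp add: power_mult_distrib)
    have s8: "(2 ^ s) ^ 3 \<le> \<rho> ^ l"
    proof -
      have "((2::real) ^ s) ^ 3 = 8 ^ s" by (simp add: power_mult[symmetric] mult.commute[of s]) (simp add: power_mult)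
      also have "\<dots> \<le> (\<rho> ^ d) ^ s" using d(2) by (intro power_mono) auto
      also have "\<dots> = \<rho> ^ (d * s)" by (simp add: power_mult)
      also have "\<dots> \<le> \<rho> ^ l" unfolding s_def using \<rho>1 by (intro power_increasing) auto
      finally show ?thesis .
    qed
    have Ll: "4 * c0 * real l \<le> 2 ^ s" "64 * K\<^sup>2 / \<kappa> / c\<^sup>2 \<le> \<rho> ^ l" using l0[OF l] unfolding s_def by auto
    have first: "real l * (4 * y) \<le> n / c0"
    proof -
      have "(4 * c0 * real l) * y \<le> 2 ^ s * y" using Ll(1) y0 by (intro mult_right_mono) auto
      then show ?thesis unfolding ny using c0 by (simp add: pos_le_divide_eq mult_ac)
    qed
    have second: "sqrt (2 / y * (8 * K\<^sup>2 * \<epsilon>\<^sup>2 * n ^ 3 / \<kappa>)) \<le> c * b y"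
    proof (rule real_le_lsqrt)
      show "0 \<le> c * b y" unfolding bA[OF y0] using c y0 Apos[OF yX] by simp
      define t where "t = \<epsilon> * A y"
      have "16 * K\<^sup>2 / \<kappa> * (2 ^ s) ^ 3 * t\<^sup>2 \<le> 16 * K\<^sup>2 / \<kappa> * \<rho> ^ l * t\<^sup>2"
        using s8 \<kappa> by (intro mult_right_mono mult_left_mono) auto
      also have "\<dots> \<le> 16 * K\<^sup>2 / \<kappa> * (4 / \<rho> ^ l)"
      proof -
        have "\<rho> ^ l * (\<rho> ^ l * t\<^sup>2) \<le> 4" using eA unfolding t_def by (simp add: power2_eq_square mult_ac)
        then have "\<rho> ^ l * t\<^sup>2 \<le> 4 / \<rho> ^ l" using \<rho>1 by (simp add: pos_le_divide_eq mult.commute)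
        then have "16 * K\<^sup>2 / \<kappa> * (\<rho> ^ l * t\<^sup>2) \<le> 16 * K\<^sup>2 / \<kappa> * (4 / \<rho> ^ l)" using \<kappa> by (intro mult_left_mono) auto
        then show ?thesis by (simp add: mult_ac)
      qed
      also have "\<dots> \<le> c\<^sup>2"
      proof -
        have c2: "0 < c\<^sup>2" using c by simp
        have "64 * K\<^sup>2 / \<kappa> \<le> \<rho> ^ l * c\<^sup>2" using Ll(2) unfolding pos_divide_le_eq[OF c2] .
        moreover have "0 < \<rho> ^ l" using \<rho>1 by simp
        ultimately have "64 * K\<^sup>2 / \<kappa> / \<rho> ^ l \<le> c\<^sup>2" by (simp only: pos_divide_le_eq mult.commute)
        then show ?thesis by simp
      qed
      finally have le: "16 * K\<^sup>2 / \<kappa> * (2 ^ s) ^ 3 * t\<^sup>2 \<le> c\<^sup>2" .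
      have "2 / y * (8 * K\<^sup>2 * \<epsilon>\<^sup>2 * n ^ 3 / \<kappa>) = (16 * K\<^sup>2 / \<kappa> * (2 ^ s) ^ 3 * t\<^sup>2) * (y / A y)\<^sup>2"
        unfolding ny t_def using y0 Apos[OF yX] \<kappa> by (simp add: field_simps power2_eq_square power3_eq_cube)
      also have "\<dots> \<le> c\<^sup>2 * (y / A y)\<^sup>2" using le by (rule mult_right_mono) simp
      finally show "2 / y * (8 * K\<^sup>2 * \<epsilon>\<^sup>2 * n ^ 3 / \<kappa>) \<le> (c * b y)\<^sup>2" unfolding bA[OF y0] by (simp only: power_mult_distrib)
    qed
    have third: "real l * (C / y) \<le> 2 * C * \<epsilon> powr (- (\<nu> / 2)) * 2 ^ l / a"
    proof -
      have "real l \<le> 4 * c0 * real l" using c0 mult_right_mono[of 1 "4 * c0" "real l"] by simp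
      also note Ll(1)
      also note s2
      finally have "real l * 2 ^ s \<le> \<epsilon> powr (- (\<nu> / 4)) * \<epsilon> powr (- (\<nu> / 4))" using s2 by (intro mult_mono) auto
      also have "\<dots> = \<epsilon> powr (- (\<nu> / 2))" by (simp add: powr_add[symmetric])
      finally have "2 * C * 2 ^ l / a * (real l * 2 ^ s) \<le> 2 * C * 2 ^ l / a * \<epsilon> powr (- (\<nu> / 2))"
        using C a0 by (intro mult_left_mono) auto
      moreover have "2 * C * 2 ^ l / a * (real l * 2 ^ s) = real l * (C / y)"
        unfolding ay using y0 by (simp add: power_add field_simps)
      ultimately show ?thesis by (simp add: mult_ac)
    qed
    show "y1 \<le> n \<and> y1 \<le> y \<and> real l * (4 * y) \<le> n / c0 \<and> sqrt (2 / y * (8 * K\<^sup>2 * \<epsilon>\<^sup>2 * n ^ 3 / \<kappa>)) \<le> c * b y \<and>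
      real l * (C / y) \<le> 2 * C * \<epsilon> powr (- (\<nu> / 2)) * 2 ^ l / a"
      using first second third X1 yX yn by auto
  qed
qed

section \<open>Scaling processes of the queue are not too small\<close>

theorem theorem5p5:
  fixes M :: "'a measure" and A U :: "nat \<Rightarrow> 'a \<Rightarrow> real"
    and Ac Uc :: "nat \<Rightarrow> nat \<Rightarrow> 'a \<Rightarrow> real"
    and N :: "'b measure" and L :: "'b \<Rightarrow> real \<Rightarrow> real"
    and lamA muU \<alpha> :: real and ell Ainv :: "real \<Rightarrow> real" and m :: nat
  assumes alpha: "2 < \<alpha>" "\<alpha> < 4"
    and queue: "mg1_queue M lamA muU \<alpha> A U"
    and m: "2 \<le> m"
    and copies: "independent_mg1_copies M lamA muU \<alpha> U m Ac Uc"
    and sv: "slowly_varying ell"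
    and L: "stable_levy_process (\<alpha> / 2) N L" "mean_zero N L" "spectrally_positive N L"
    and conv: "weakly_converges_M1 (at_right 0)
      M (\<lambda>\<epsilon> \<omega> t. \<epsilon> powr (2 / \<alpha>) * ell (1 / \<epsilon>) * (Z1 A U \<omega> (t / \<epsilon>) - t / \<epsilon> * mu_W M A U))
      N (\<lambda>\<omega> t. L \<omega> (t / E_tau1 M A U))"
    and Ainv: "asymptotic_inverse (\<lambda>x. x powr (1 - 2 / \<alpha>) * ell x) Ainv"
  shows "\<forall>\<iota> :: scaling. \<forall>\<nu> K :: real. 0 < \<nu> \<longrightarrow> \<nu> < \<alpha> / (\<alpha> - 2) \<longrightarrow> 0 < K \<longrightarrow>
    ((\<lambda>\<eta>. Limsup (at_right 0) (\<lambda>\<epsilon>. ereal (measure M {\<omega> \<in> space M.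
        (INF n\<in>{n :: nat. \<epsilon> powr (- \<nu>) \<le> real n \<and> real n \<le> \<eta> * Ainv (1 / \<epsilon>)}.
           ereal (sqrt (Z2_star \<iota> m (Z1 A U \<omega>) (\<lambda>i. Z1 (Ac i) (Uc i) \<omega>) (real n)) / real n))
        \<le> ereal (K * \<epsilon>)})))
      \<longlongrightarrow> 0) (at_right 0)"
proof (intro allI impI)
  fix \<iota> :: scaling and \<nu> K :: real
  assume \<nu>: "0 < \<nu>" and K: "0 < K"
  interpret prob_space M using queue unfolding mg1_queue_def by simp
  obtain \<kappa> c c0 C C' y1 where \<kappa>: "0 < \<kappa>" and c: "0 < c" "c < 1" and c0: "1 \<le> c0" and C: "0 < C" and C': "0 < C'" and y1: "1 \<le> y1"
    and ellpos: "\<And>y. y1 \<le> y \<Longrightarrow> 0 < ell y" and bC: "\<And>y. y1 \<le> y \<Longrightarrow> y powr (2 / \<alpha>) / ell y \<le> C' * y"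
    and ball: "\<And>n y k R. y1 \<le> n \<Longrightarrow> y1 \<le> y \<Longrightarrow> real k * (4 * y) \<le> n / c0 \<Longrightarrow> sqrt (2 / y * (R / \<kappa>)) \<le> c * (y powr (2 / \<alpha>) / ell y) \<Longrightarrow>
      \<exists>E\<in>events. {\<omega> \<in> space M. \<exists>t\<ge>n. t * Z2_star \<iota> m (Z1 A U \<omega>) (\<lambda>i. Z1 (Ac i) (Uc i) \<omega>) t \<le> R} \<subseteq> E \<and>
        prob E \<le> (1 - c / 2) ^ k + real k * (C / y)"
    by (rule estimator_small_ball[OF alpha(1) queue m copies sv L(1) conv, of \<iota>]) blast
  obtain \<epsilon>0 :: real and l0 d :: nat where \<epsilon>0: "0 < \<epsilon>0" "\<epsilon>0 \<le> 1" and level: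
    "\<forall>\<epsilon> l a n y. 0 < \<epsilon> \<longrightarrow> \<epsilon> < \<epsilon>0 \<longrightarrow> l0 \<le> l \<longrightarrow> a = Ainv (1 / \<epsilon>) \<longrightarrow> \<epsilon> powr (- \<nu>) \<le> a / 2 ^ l \<longrightarrow>
      n = a / 2 ^ Suc l \<longrightarrow> y = n / 2 ^ (l div d) \<longrightarrow>
      y1 \<le> n \<and> y1 \<le> y \<and> real l * (4 * y) \<le> n / c0 \<and>
      sqrt (2 / y * (8 * K\<^sup>2 * \<epsilon>\<^sup>2 * n ^ 3 / \<kappa>)) \<le> c * (y powr (2 / \<alpha>) / ell y) \<and>
      real l * (C / y) \<le> 2 * C * \<epsilon> powr (- (\<nu> / 2)) * 2 ^ l / a"
    by (rule dyadic_levels[OF alpha(1) \<nu> K \<kappa> c(1) c0 C C' y1 sv ellpos bC Ainv]) blast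
  define S where "S \<omega> n = sqrt (Z2_star \<iota> m (Z1 A U \<omega>) (\<lambda>i. Z1 (Ac i) (Uc i) \<omega>) (real n)) / real n" for \<omega> and n :: nat
  define Bad where "Bad \<eta> \<epsilon> = {\<omega> \<in> space M. (INF n\<in>{n :: nat. \<epsilon> powr (- \<nu>) \<le> real n \<and> real n \<le> \<eta> * Ainv (1 / \<epsilon>)}. ereal (S \<omega> n)) \<le> ereal (K * \<epsilon>)}" for \<eta> \<epsilon>
  define q where "q = 1 - c / 2"
  have q: "0 \<le> q" "q < 1" "1 - q = c / 2" unfolding q_def using c by auto
  have bound: "prob (Bad \<eta> \<epsilon>) \<le> q ^ i * (2 / c) + 4 * C * \<epsilon> powr (\<nu> / 2)"
    if \<epsilon>: "0 < \<epsilon>" "\<epsilon> < \<epsilon>0" and \<eta>: "0 < \<eta>" "\<eta> \<le> 1 / 2 ^ i" and i: "l0 \<le> i" for \<epsilon> \<eta> i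
  proof -
    define a where "a = Ainv (1 / \<epsilon>)"
    define Lv where "Lv = {l. i \<le> l \<and> \<epsilon> powr (- \<nu>) \<le> a / 2 ^ l}"
    have lev: "2 ^ l \<le> a * \<epsilon> powr \<nu>" if "l \<in> Lv" for l
    proof -
      have "\<epsilon> powr (- \<nu>) * 2 ^ l \<le> a" using that unfolding Lv_def by (simp add: pos_le_divide_eq)
      then have "\<epsilon> powr \<nu> * (\<epsilon> powr (- \<nu>) * 2 ^ l) \<le> \<epsilon> powr \<nu> * a" by (intro mult_left_mono) auto
      moreover have "\<epsilon> powr \<nu> * (\<epsilon> powr (- \<nu>) * 2 ^ l) = 2 ^ l" using \<epsilon> by (simp add: mult.assoc[symmetric] powr_add[symmetric])
      ultimately show ?thesis by (simp only: mult.commute)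
    qed
    have finLv: "finite Lv"
    proof -
      obtain j where j: "a * \<epsilon> powr \<nu> < 2 ^ j" using real_arch_pow[of 2 "a * \<epsilon> powr \<nu>"] by auto
      have "Lv \<subseteq> {..j}"
      proof
        fix l assume "l \<in> Lv"
        from le_less_trans[OF lev[OF this] j] have "(2::real) ^ l < 2 ^ j" .
        then have "l < j" by (simp only: power_strict_increasing_iff one_less_numeral_iff semiring_norm)
        then show "l \<in> {..j}" by simp
      qed
      then show ?thesis using finite_subset by blast
    qed
    define n where "n l = a / 2 ^ Suc l" for l
    define F where "F l = {\<omega> \<in> space M. \<exists>t\<ge>n l. t * Z2_star \<iota> m (Z1 A U \<omega>) (\<lambda>i. Z1 (Ac i) (Uc i) \<omega>) t \<le> 8 * K\<^sup>2 * \<epsilon>\<^sup>2 * n l ^ 3}" for l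
    have "\<exists>E\<in>events. F l \<subseteq> E \<and> prob E \<le> q ^ l + 2 * C * \<epsilon> powr (- (\<nu> / 2)) * 2 ^ l / a" if l: "l \<in> Lv" for l
    proof -
      define y where "y = n l / 2 ^ (l div d)"
      have "l0 \<le> l" "\<epsilon> powr (- \<nu>) \<le> a / 2 ^ l" using l i unfolding Lv_def by auto
      from level[rule_format, OF \<epsilon> this(1) a_def this(2) n_def y_def]
      have lv: "y1 \<le> n l" "y1 \<le> y" "real l * (4 * y) \<le> n l / c0"
        "sqrt (2 / y * (8 * K\<^sup>2 * \<epsilon>\<^sup>2 * n l ^ 3 / \<kappa>)) \<le> c * (y powr (2 / \<alpha>) / ell y)"
        "real l * (C / y) \<le> 2 * C * \<epsilon> powr (- (\<nu> / 2)) * 2 ^ l / a" by blast+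
      obtain E where "E \<in> events" "F l \<subseteq> E" "prob E \<le> q ^ l + real l * (C / y)"
        using ball[OF lv(1-4)] unfolding F_def q_def by blast
      then show ?thesis using lv(5) by (intro bexI[of _ E]) auto
    qed
    then obtain E where E: "\<And>l. l \<in> Lv \<Longrightarrow> E l \<in> events" "\<And>l. l \<in> Lv \<Longrightarrow> F l \<subseteq> E l"
      "\<And>l. l \<in> Lv \<Longrightarrow> prob (E l) \<le> q ^ l + 2 * C * \<epsilon> powr (- (\<nu> / 2)) * 2 ^ l / a" by metis
    have "Bad \<eta> \<epsilon> \<subseteq> (\<Union>l\<in>Lv. E l)"
    proof
      fix \<omega> assume "\<omega> \<in> Bad \<eta> \<epsilon>"
      then have \<omega>: "\<omega> \<in> space M"
        and inf: "(INF n\<in>{n :: nat. \<epsilon> powr (- \<nu>) \<le> real n \<and> real n \<le> \<eta> * a}. ereal (S \<omega> n)) \<le> ereal (K * \<epsilon>)"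
        unfolding Bad_def a_def by auto
      \<comment> \<open>The infimum of a finite set is attained, and that of the empty set is infinite.\<close>
      let ?I = "{n :: nat. \<epsilon> powr (- \<nu>) \<le> real n \<and> real n \<le> \<eta> * a}"
      have fin: "finite ?I"
      proof (rule finite_subset)
        show "?I \<subseteq> {..nat \<lceil>\<eta> * a\<rceil>}" by (auto simp: le_nat_iff) linarith
      qed simp
      have ne: "?I \<noteq> {}"
      proof
        assume "?I = {}"
        then have "(INF n\<in>?I. ereal (S \<omega> n)) = \<infinity>" by (simp only: image_empty Inf_empty top_ereal_def)
        with inf show False by simp
      qed
      have "(INF n\<in>?I. ereal (S \<omega> n)) \<in> (\<lambda>n. ereal (S \<omega> n)) ` ?I"
        using fin ne Min_in[of "(\<lambda>n. ereal (S \<omega> n)) ` ?I"] by (simp add: Min_Inf)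
      then obtain k where k: "k \<in> ?I" and eq: "(INF n\<in>?I. ereal (S \<omega> n)) = ereal (S \<omega> k)" by blast
      have Sk: "S \<omega> k \<le> K * \<epsilon>" using inf unfolding eq by simp
      have "0 < \<epsilon> powr (- \<nu>)" using \<epsilon> by simp
      also have "\<epsilon> powr (- \<nu>) \<le> real k" using k by simp
      finally have k0: "0 < real k" .
      have "0 < \<eta> * a" using k k0 by simp
      then have a0: "0 < a" using \<eta> by (simp add: zero_less_mult_iff)
      have ka: "real k \<le> a / 2 ^ i"
      proof -
        have "\<eta> * a \<le> 1 / 2 ^ i * a" using \<eta> a0 by (intro mult_right_mono) auto
        then show ?thesis using k by simp
      qed
      \<comment> \<open>The level of \<open>k\<close> is the last \<open>l\<close> with \<open>k \<le> a / 2 ^ l\<close>.\<close>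
      have "\<exists>j. a / 2 ^ j < real k"
      proof -
        obtain j where "a / real k < 2 ^ j" using real_arch_pow[of 2 "a / real k"] by auto
        then show ?thesis using k0 by (intro exI[of _ j]) (simp add: pos_divide_less_eq mult.commute)
      qed
      then obtain j where j: "a / 2 ^ j < real k" "\<And>j'. j' < j \<Longrightarrow> \<not> a / 2 ^ j' < real k"
        using exists_least_iff[of "\<lambda>j. a / 2 ^ j < real k"] by blast
      have "i < j"
      proof (rule ccontr)
        assume "\<not> i < j"
        then have "a / 2 ^ i \<le> a / 2 ^ j" using a0 by (intro divide_left_mono power_increasing) auto
        with j(1) ka show False by simp
      qed
      then obtain l where l: "j = Suc l" "i \<le> l" by (cases j) auto
      have kl: "n l < real k" "real k \<le> a / 2 ^ l" using j(1) j(2)[of l] unfolding l n_def by auto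
      have lLv: "l \<in> Lv" unfolding Lv_def using l kl k by simp
      have "real k \<le> 2 * n l" using kl(2) unfolding n_def by simp
      have "sqrt (Z2_star \<iota> m (Z1 A U \<omega>) (\<lambda>i. Z1 (Ac i) (Uc i) \<omega>) (real k)) \<le> K * \<epsilon> * real k"
        using Sk k0 unfolding S_def by (simp add: pos_divide_le_eq)
      then have "Z2_star \<iota> m (Z1 A U \<omega>) (\<lambda>i. Z1 (Ac i) (Uc i) \<omega>) (real k) \<le> (K * \<epsilon> * real k)\<^sup>2" by (rule sqrt_le_D)
      then have "real k * Z2_star \<iota> m (Z1 A U \<omega>) (\<lambda>i. Z1 (Ac i) (Uc i) \<omega>) (real k) \<le> real k * (K * \<epsilon> * real k)\<^sup>2"
        using k0 by (intro mult_left_mono) auto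
      also have "\<dots> = K\<^sup>2 * \<epsilon>\<^sup>2 * real k ^ 3" by (simp add: power_mult_distrib power2_eq_square power3_eq_cube)
      also have "\<dots> \<le> K\<^sup>2 * \<epsilon>\<^sup>2 * (2 * n l) ^ 3" using \<open>real k \<le> 2 * n l\<close> by (intro mult_left_mono power_mono) auto
      also have "\<dots> = 8 * K\<^sup>2 * \<epsilon>\<^sup>2 * n l ^ 3" by (simp add: power_mult_distrib)
      finally have "\<omega> \<in> F l" unfolding F_def using \<omega> kl(1) by (auto intro!: exI[of _ "real k"])
      then show "\<omega> \<in> (\<Union>l\<in>Lv. E l)" using E(2)[OF lLv] lLv by blast
    qed
    then have "prob (Bad \<eta> \<epsilon>) \<le> prob (\<Union>l\<in>Lv. E l)"
      using E(1) finLv by (intro finite_measure_mono sets.finite_UN) auto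
    also have "\<dots> \<le> (\<Sum>l\<in>Lv. prob (E l))" using E(1) finLv by (intro finite_measure_subadditive_finite) auto
    also have "\<dots> \<le> (\<Sum>l\<in>Lv. q ^ l + 2 * C * \<epsilon> powr (- (\<nu> / 2)) * 2 ^ l / a)" by (intro sum_mono E(3))
    also have "\<dots> = (\<Sum>l\<in>Lv. q ^ l) + 2 * C * \<epsilon> powr (- (\<nu> / 2)) / a * (\<Sum>l\<in>Lv. 2 ^ l)"
      by (simp add: sum.distrib sum_distrib_left)
    also have "(\<Sum>l\<in>Lv. q ^ l) \<le> q ^ i * (2 / c)"
    proof -
      have "(\<Sum>l\<in>Lv. q ^ l) \<le> (\<Sum>l. q ^ (l + i))"
      proof -
        have "(\<Sum>l\<in>Lv. q ^ l) = (\<Sum>l\<in>(\<lambda>l. l - i) ` Lv. q ^ (l + i))"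
          by (subst sum.reindex) (auto simp: Lv_def inj_on_def)
        also have "\<dots> \<le> (\<Sum>l. q ^ (l + i))"
          using finLv q by (intro sum_le_suminf) (auto simp: power_add intro!: summable_mult2 summable_geometric)
        finally show ?thesis .
      qed
      also have "\<dots> = q ^ i * (1 / (1 - q))"
        using q by (simp add: power_add suminf_mult2[symmetric] summable_geometric suminf_geometric mult.commute)
      finally show ?thesis unfolding q(3) by simp
    qed
    also have "2 * C * \<epsilon> powr (- (\<nu> / 2)) / a * (\<Sum>l\<in>Lv. 2 ^ l) \<le> 4 * C * \<epsilon> powr (\<nu> / 2)"
    proof (cases "Lv = {}")
      case False
      define m' where "m' = Max Lv"
      have m': "m' \<in> Lv" "\<And>l. l \<in> Lv \<Longrightarrow> l \<le> m'" unfolding m'_def using finLv False by auto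
      have "0 < a * \<epsilon> powr \<nu>" using lev[OF m'(1)] by (rule less_le_trans[rotated]) simp
      then have a0: "0 < a" using \<epsilon> by (simp add: zero_less_mult_iff)
      have "(\<Sum>l\<in>Lv. (2::real) ^ l) \<le> (\<Sum>l<Suc m'. 2 ^ l)" using m' by (intro sum_mono2) (auto simp: less_Suc_eq_le)
      also have "\<dots> = 2 ^ Suc m' - 1" by (subst geometric_sum) auto
      also have "\<dots> \<le> 2 * (a * \<epsilon> powr \<nu>)" using lev[OF m'(1)] by simp
      finally have "2 * C * \<epsilon> powr (- (\<nu> / 2)) / a * (\<Sum>l\<in>Lv. 2 ^ l) \<le> 2 * C * \<epsilon> powr (- (\<nu> / 2)) / a * (2 * (a * \<epsilon> powr \<nu>))"
        using C a0 by (intro mult_left_mono) auto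
      also have "\<dots> = 4 * C * (\<epsilon> powr (- (\<nu> / 2)) * \<epsilon> powr \<nu>)" using a0 by simp
      also have "\<epsilon> powr (- (\<nu> / 2)) * \<epsilon> powr \<nu> = \<epsilon> powr (\<nu> / 2)" by (simp add: powr_add[symmetric])
      finally show ?thesis .
    qed (use C in simp)
    finally show ?thesis by simp
  qed
  have Lim: "Limsup (at_right 0) (\<lambda>\<epsilon>. ereal (prob (Bad \<eta> \<epsilon>))) \<le> ereal (q ^ i * (2 / c))"
    if "0 < \<eta>" "\<eta> \<le> 1 / 2 ^ i" "l0 \<le> i" for \<eta> i
  proof -
    have "((\<lambda>\<epsilon>. \<epsilon> powr (\<nu> / 2)) \<longlongrightarrow> 0) (at_right (0::real))"
      by (rule tendsto_powr'[of "\<lambda>\<epsilon>. \<epsilon>" 0 _ "\<lambda>_. \<nu> / 2" "\<nu> / 2", simplified]) (use \<nu> in \<open>auto intro!: tendsto_intros simp: eventually_at_filter\<close>)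
    then have "((\<lambda>\<epsilon>. q ^ i * (2 / c) + 4 * C * \<epsilon> powr (\<nu> / 2)) \<longlongrightarrow> q ^ i * (2 / c) + 4 * C * 0) (at_right (0::real))"
      by (intro tendsto_intros)
    then have "((\<lambda>\<epsilon>. ereal (q ^ i * (2 / c) + 4 * C * \<epsilon> powr (\<nu> / 2))) \<longlongrightarrow> ereal (q ^ i * (2 / c))) (at_right (0::real))"
      by simp
    then have lim: "Limsup (at_right 0) (\<lambda>\<epsilon>. ereal (q ^ i * (2 / c) + 4 * C * \<epsilon> powr (\<nu> / 2))) = ereal (q ^ i * (2 / c))"
      by (intro lim_imp_Limsup) (auto simp: trivial_limit_at_right_real)
    have "\<forall>\<^sub>F \<epsilon> in at_right 0. ereal (prob (Bad \<eta> \<epsilon>)) \<le> ereal (q ^ i * (2 / c) + 4 * C * \<epsilon> powr (\<nu> / 2))"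
      unfolding eventually_at_right_field using \<epsilon>0(1) bound[OF _ _ that] by (intro exI[of _ \<epsilon>0]) auto
    from Limsup_mono[OF this] show ?thesis unfolding lim .
  qed
  have "((\<lambda>\<eta>. Limsup (at_right 0) (\<lambda>\<epsilon>. ereal (prob (Bad \<eta> \<epsilon>)))) \<longlongrightarrow> 0) (at_right 0)"
  proof (rule order_tendstoI)
    fix z :: ereal assume z: "z < 0"
    have "0 \<le> Limsup (at_right 0) (\<lambda>\<epsilon>. ereal (prob (Bad \<eta> \<epsilon>)))" for \<eta>
      by (rule le_Limsup) (auto simp: trivial_limit_at_right_real)
    then show "\<forall>\<^sub>F \<eta> in at_right 0. z < Limsup (at_right 0) (\<lambda>\<epsilon>. ereal (prob (Bad \<eta> \<epsilon>)))"
      using z by (auto intro!: always_eventually intro: less_le_trans)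
  next
    fix z :: ereal assume z: "0 < z"
    have "(\<lambda>i. q ^ i * (2 / c)) \<longlonglongrightarrow> 0 * (2 / c)"
      by (intro tendsto_mult LIMSEQ_power_zero tendsto_const) (use q in simp)
    then have "(\<lambda>i. ereal (q ^ i * (2 / c))) \<longlonglongrightarrow> 0" by (simp add: zero_ereal_def)
    from order_tendstoD(2)[OF this z] obtain i0 where i0: "\<And>i. i0 \<le> i \<Longrightarrow> ereal (q ^ i * (2 / c)) < z"
      unfolding eventually_sequentially by blast
    define i where "i = max i0 l0"
    have "Limsup (at_right 0) (\<lambda>\<epsilon>. ereal (prob (Bad \<eta> \<epsilon>))) < z" if "0 < \<eta>" "\<eta> < 1 / 2 ^ i" for \<eta>
      using Lim[OF that(1) less_imp_le[OF that(2)]] i0[of i] unfolding i_def by (meson le_less_trans max.cobounded1 max.cobounded2)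
    then show "\<forall>\<^sub>F \<eta> in at_right 0. Limsup (at_right 0) (\<lambda>\<epsilon>. ereal (prob (Bad \<eta> \<epsilon>))) < z"
      unfolding eventually_at_right_field by (intro exI[of _ "1 / 2 ^ i"]) auto
  qed
  then show "((\<lambda>\<eta>. Limsup (at_right 0) (\<lambda>\<epsilon>. ereal (measure M {\<omega> \<in> space M.
        (INF n\<in>{n :: nat. \<epsilon> powr (- \<nu>) \<le> real n \<and> real n \<le> \<eta> * Ainv (1 / \<epsilon>)}.
           ereal (sqrt (Z2_star \<iota> m (Z1 A U \<omega>) (\<lambda>i. Z1 (Ac i) (Uc i) \<omega>) (real n)) / real n))
        \<le> ereal (K * \<epsilon>)})))
      \<longlongrightarrow> 0) (at_right 0)"
    unfolding Bad_def S_def .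
qed

end
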